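(* Let $X$ be an orientable compact connected Euclidean surface with conical singularities, with nonempty singular set $P$. (i) For any geodesic $\gamma$ of $X$, either $\gamma$ is periodic, or the closure of $\gamma$ meets $P$. (ii) For $\varepsilon > 0$ let $U_\varepsilon$ denote the $\varepsilon$-neighbourhood of $P$. Then any geodesic avoiding $U_\varepsilon$ (which is periodic by part (i)) belongs to a maximal cylinder, and the number of such maximal cylinders (those containing a geodesic avoiding $U_\varepsilon$) is finite.
   Context: A Euclidean surface with conical singularities (ESCS) is a surface $X$ with a metric $g$ such that $X = X_0 \cup P$, where $g$ is Euclidean (flat) on $X_0 = X\setminus P$, and $P$ (the singular set) is a finite set of points $p_i$ (the conical points), each having a neighbourhood isometric to a neighbourhood of the tip of a Euclidean cone, with the tip corresponding to $p_i$. Geodesics are maximal geodesics of the Euclidean metric; a geodesic is singular if it hits a conical point, and non-singular otherwise. A geodesic avoids $U_\varepsilon$ if its image in $X$ is disjoint from $U_\varepsilon$. A cylinder is an isometric immersion $h$ of $\mathbb{S}^1_l \times I$ (flat product metric) into $X_0$, where $I\subset\mathbb{R}$ is an interval and $\mathbb{S}^1_l$ is the circle of length $l$. A periodic geodesic belongs to the cylinder if it is one of the closed geodesics $h(\cdot, s)$, $s\in I$. Writing $I = (-\delta,\delta)$, as $s \uparrow \delta$ (respectively $s\downarrow -\delta$) the periodic geodesics $h(\cdot, s)$ converge to a possibly singular periodic geodesic; the cylinder is called maximal if both of these limiting geodesics are singular (i.e. meet $P$). Cylinders that differ only by reparametrization are counted as the same.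
   Formalization: The circumference l of a cylinder is required to be its least period; otherwise the k-fold coverings of one maximal cylinder, of circumference kl, would be infinitely many maximal cylinders containing the same geodesics, and the finiteness claim would fail. *)

theory Defs
  imports "HOL-Analysis.Analysis"
begin

section \<open>Euclidean surfaces with conical singularities\<close>

text \<open>
  The surface is a set \<open>X\<close> in a metric space, and \<open>dist\<close> restricted to \<open>X\<close> is the intrinsic
  distance of the Riemannian metric \<open>g\<close>: the infimum of the lengths of the curves in \<open>X\<close>
  joining two points. That \<open>g\<close> is Euclidean, respectively conical, near a point is then the
  existence of an isometry between a neighbourhood of that point and an open subset of the
  Euclidean plane, respectively a neighbourhood of the tip of a Euclidean cone.
\<close>

definition curve_length :: "(real \<Rightarrow> 'a::metric_space) \<Rightarrow> ereal" where
  "curve_length g =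
     (SUP ts \<in> {ts. sorted ts \<and> set ts \<subseteq> {0..1}}.
        ereal (\<Sum>i<length ts - 1. dist (g (ts ! i)) (g (ts ! Suc i))))"

definition intrinsic_metric :: "'a::metric_space set \<Rightarrow> bool" where
  "intrinsic_metric X \<longleftrightarrow>
     (\<forall>x\<in>X. \<forall>y\<in>X.
        ereal (dist x y) =
          (INF g \<in> {g. path g \<and> path_image g \<subseteq> X \<and> pathstart g = x \<and> pathfinish g = y}.
             curve_length g))"

text \<open>The complex numbers play the role of the Euclidean plane.\<close>

definition flat_chart ::
    "'a::metric_space set \<Rightarrow> 'a set \<Rightarrow> 'a set \<Rightarrow> ('a \<Rightarrow> complex) \<Rightarrow> bool" where
  "flat_chart X P U c \<longleftrightarrow>
     U \<subseteq> X - P \<and> openin (top_of_set X) U \<and> open (c ` U) \<and>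
     (\<forall>x\<in>U. \<forall>y\<in>U. dist (c x) (c y) = dist x y)"

text \<open>
  The cone of total angle \<open>\<theta>\<close> is written in polar coordinates \<open>(r, \<phi>)\<close>, with \<open>r \<ge> 0\<close>, \<open>\<phi>\<close> taken
  modulo \<open>\<theta>\<close>, and all \<open>(0, \<phi>)\<close> identified to the tip. The intrinsic distance of
  \<open>dr\<^sup>2 + r\<^sup>2 d\<phi>\<^sup>2\<close> between two points at angular distance \<open>\<alpha>\<close> is given by the law of cosines
  if \<open>\<alpha> \<le> \<pi>\<close>, while for \<open>\<alpha> \<ge> \<pi>\<close> the shortest curve passes through the tip and has length
  \<open>r + s\<close>. On coordinate pairs this is a pseudo-distance, so a map that preserves it respects the
  identifications and is an isometric embedding of the cone.
\<close>

definition angle_dist :: "real \<Rightarrow> real \<Rightarrow> real \<Rightarrow> real" where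
  "angle_dist \<theta> \<phi> \<psi> = (INF k::int. \<bar>\<phi> - \<psi> + of_int k * \<theta>\<bar>)"

definition cone_dist :: "real \<Rightarrow> real \<times> real \<Rightarrow> real \<times> real \<Rightarrow> real" where
  "cone_dist \<theta> = (\<lambda>(r, \<phi>) (s, \<psi>).
     sqrt (r\<^sup>2 + s\<^sup>2 - 2 * r * s * cos (min pi (angle_dist \<theta> \<phi> \<psi>))))"

definition cone_chart ::
    "'a::metric_space set \<Rightarrow> 'a \<Rightarrow> real \<Rightarrow> real \<Rightarrow> (real \<times> real \<Rightarrow> 'a) \<Rightarrow> bool" where
  "cone_chart X p \<theta> \<rho> f \<longleftrightarrow>
     0 < \<theta> \<and> 0 < \<rho> \<and> f (0, 0) = p \<and> f ` ({0..<\<rho>} \<times> UNIV) = X \<inter> ball p \<rho> \<and>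
     (\<forall>u \<in> {0..<\<rho>} \<times> UNIV. \<forall>v \<in> {0..<\<rho>} \<times> UNIV. dist (f u) (f v) = cone_dist \<theta> u v)"

definition escs :: "'a::metric_space set \<Rightarrow> 'a set \<Rightarrow> bool" where
  "escs X P \<longleftrightarrow>
     intrinsic_metric X \<and> P \<subseteq> X \<and> finite P \<and>
     (\<forall>x \<in> X - P. \<exists>U c. flat_chart X P U c \<and> x \<in> U) \<and>
     (\<forall>p \<in> P. \<exists>\<theta> \<rho> f. cone_chart X p \<theta> \<rho> f)"

text \<open>
  An orientation of \<open>X\<close> is an atlas of flat charts of \<open>X - P\<close>, together with a cone chart at each
  point of \<open>P\<close>, such that all coordinate changes are orientation preserving. A coordinate change
  is a local isometry of the plane, so it preserves orientation iff it is locally of the form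
  \<open>z \<mapsto> a z + b\<close> with \<open>\<bar>a\<bar> = 1\<close> (and not \<open>z \<mapsto> a cnj z + b\<close>). Away from the tip a cone chart is
  compared with a flat chart through the local flat coordinate \<open>r e\<^sup>i\<^sup>\<phi>\<close> of the cone.
\<close>

definition oriented_atlas ::
    "'a::metric_space set \<Rightarrow> 'a set \<Rightarrow> ('a set \<times> ('a \<Rightarrow> complex)) set \<Rightarrow> bool" where
  "oriented_atlas X P A \<longleftrightarrow>
     (\<forall>(U, c) \<in> A. flat_chart X P U c) \<and>
     (\<Union>(U, c) \<in> A. U) = X - P \<and>
     (\<forall>(U, c) \<in> A. \<forall>(V, d) \<in> A. \<forall>x \<in> U \<inter> V.
        \<exists>e>0. \<exists>a. norm a = 1 \<and> (\<forall>y \<in> U \<inter> V \<inter> ball x e. d y - d x = a * (c y - c x))) \<and>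
     (\<forall>p \<in> P. \<exists>\<theta> \<rho> f. cone_chart X p \<theta> \<rho> f \<and>
        (\<forall>(U, c) \<in> A. \<forall>r \<phi>. 0 < r \<and> r < \<rho> \<and> f (r, \<phi>) \<in> U \<longrightarrow>
           (\<exists>e>0. \<exists>a. norm a = 1 \<and>
              (\<forall>(s, \<psi>) \<in> ball (r, \<phi>) e.
                 c (f (s, \<psi>)) - c (f (r, \<phi>)) = a * (rcis s \<psi> - rcis r \<phi>)))))"

definition orientable :: "'a::metric_space set \<Rightarrow> 'a set \<Rightarrow> bool" where
  "orientable X P \<longleftrightarrow> (\<exists>A. oriented_atlas X P A)"


section \<open>Geodesics\<close>

definition local_isometry_on ::
    "'b::metric_space set \<Rightarrow> ('b \<Rightarrow> 'a::metric_space) \<Rightarrow> bool" where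
  "local_isometry_on S f \<longleftrightarrow>
     (\<forall>x\<in>S. \<exists>e>0. \<forall>y \<in> S \<inter> ball x e. \<forall>z \<in> S \<inter> ball x e. dist (f y) (f z) = dist y z)"

text \<open>
  Geodesics are parametrized by arc length on an interval \<open>J\<close>. They run in \<open>X - P\<close>, except that
  they may start or end at a conical point, beyond which they are not continued. Two
  parametrized curves are compared on their domains only.
\<close>

definition geodesic_curve ::
    "'a::metric_space set \<Rightarrow> 'a set \<Rightarrow> real set \<Rightarrow> (real \<Rightarrow> 'a) \<Rightarrow> bool" where
  "geodesic_curve X P J \<gamma> \<longleftrightarrow>
     is_interval J \<and> interior J \<noteq> {} \<and> continuous_on J \<gamma> \<and> \<gamma> ` J \<subseteq> X \<and>
     \<gamma> ` interior J \<subseteq> X - P \<and> local_isometry_on (interior J) \<gamma>"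

definition geodesic ::
    "'a::metric_space set \<Rightarrow> 'a set \<Rightarrow> real set \<Rightarrow> (real \<Rightarrow> 'a) \<Rightarrow> bool" where
  "geodesic X P J \<gamma> \<longleftrightarrow>
     geodesic_curve X P J \<gamma> \<and>
     (\<forall>J' \<gamma>'. geodesic_curve X P J' \<gamma>' \<and> J \<subseteq> J' \<and> (\<forall>t\<in>J. \<gamma>' t = \<gamma> t) \<longrightarrow> J' = J)"

definition periodic_geodesic :: "real set \<Rightarrow> (real \<Rightarrow> 'a) \<Rightarrow> bool" where
  "periodic_geodesic J \<gamma> \<longleftrightarrow> J = UNIV \<and> (\<exists>T>0. \<forall>t. \<gamma> (t + T) = \<gamma> t)"

definition singular_nbhd ::
    "'a::metric_space set \<Rightarrow> 'a set \<Rightarrow> real \<Rightarrow> 'a set" where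
  "singular_nbhd X P \<epsilon> = {x \<in> X. \<exists>p\<in>P. dist p x < \<epsilon>}"

definition geodesic_avoiding ::
    "'a::metric_space set \<Rightarrow> 'a set \<Rightarrow> real \<Rightarrow> real set \<Rightarrow> (real \<Rightarrow> 'a) \<Rightarrow> bool" where
  "geodesic_avoiding X P \<epsilon> J \<gamma> \<longleftrightarrow> geodesic X P J \<gamma> \<and> \<gamma> ` J \<inter> singular_nbhd X P \<epsilon> = {}"


section \<open>Cylinders\<close>

text \<open>
  A map on (circle of length \<open>l\<close>) \<open>\<times> I\<close> is given as a map on \<open>\<real> \<times> I\<close> that is \<open>l\<close>-periodic in the
  first variable; the distance on \<open>real \<times> real\<close> is the Euclidean one, and an isometric
  immersion between surfaces is a local isometry. The circumference \<open>l\<close> is required to be the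
  least period. Otherwise the \<open>k\<close>-fold coverings of one cylinder, for \<open>k = 1, 2, \<dots>\<close>, would be
  infinitely many different cylinders consisting of the same geodesics.
\<close>

type_synonym 'a cyl = "real \<times> real set \<times> (real \<times> real \<Rightarrow> 'a)"

definition cylinder :: "'a::metric_space set \<Rightarrow> 'a set \<Rightarrow> 'a cyl \<Rightarrow> bool" where
  "cylinder X P = (\<lambda>(l, I, h).
     0 < l \<and> is_interval I \<and> interior I \<noteq> {} \<and>
     h ` (UNIV \<times> I) \<subseteq> X - P \<and> local_isometry_on (UNIV \<times> I) h \<and>
     (\<forall>t. \<forall>s\<in>I. h (t + l, s) = h (t, s)) \<and>
     (\<forall>l'. 0 < l' \<and> l' < l \<longrightarrow> (\<exists>t. \<exists>s\<in>I. h (t + l', s) \<noteq> h (t, s))))"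

definition belongs_to :: "real set \<Rightarrow> (real \<Rightarrow> 'a) \<Rightarrow> 'a cyl \<Rightarrow> bool" where
  "belongs_to J \<gamma> = (\<lambda>(l, I, h). J = UNIV \<and> (\<exists>s\<in>I. \<forall>t. \<gamma> t = h (t, s)))"

definition maximal_cylinder :: "'a::metric_space set \<Rightarrow> 'a set \<Rightarrow> 'a cyl \<Rightarrow> bool" where
  "maximal_cylinder X P = (\<lambda>(l, I, h).
     cylinder X P (l, I, h) \<and>
     (\<exists>\<delta>>0. I = {-\<delta><..<\<delta>} \<and>
        (\<exists>\<eta>. (\<forall>t. ((\<lambda>s. h (t, s)) \<longlongrightarrow> \<eta> t) (at_left \<delta>)) \<and> range \<eta> \<inter> P \<noteq> {}) \<and>
        (\<exists>\<eta>. (\<forall>t. ((\<lambda>s. h (t, s)) \<longlongrightarrow> \<eta> t) (at_right (-\<delta>))) \<and> range \<eta> \<inter> P \<noteq> {})))"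

text \<open>
  Reparametrizations are the isometries between the products (circle) \<open>\<times> I\<close>: rotations and
  reflections of the circle, translations and reflections of the interval.
\<close>

definition same_cylinder :: "'a cyl rel" where
  "same_cylinder = {((l, I, h), (l', I', h')).
     l = l' \<and>
     (\<exists>\<sigma>\<in>{1, -1}. \<exists>\<tau>\<in>{1, -1}. \<exists>a b.
        I = (\<lambda>s. \<tau> * s + b) ` I' \<and>
        (\<forall>t. \<forall>s\<in>I'. h' (t, s) = h (\<sigma> * t + a, \<tau> * s + b)))}"

lemma same_cylinder_iff:
  "((l, I, h), (l', I', h')) \<in> same_cylinder \<longleftrightarrow>
     l = l' \<and>
     (\<exists>\<sigma>\<in>{1, -1}. \<exists>\<tau>\<in>{1, -1}. \<exists>a b.
        I = (\<lambda>s. \<tau> * s + b) ` I' \<and>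
        (\<forall>t. \<forall>s\<in>I'. h' (t, s) = h (\<sigma> * t + a, \<tau> * s + b)))"
  by (simp only: same_cylinder_def mem_Collect_eq case_prod_conv)

lemma equiv_same_cylinder: "equiv UNIV (same_cylinder :: 'a cyl rel)"
proof (rule equivI)
  show "refl (same_cylinder :: 'a cyl rel)"
    unfolding refl_on_def same_cylinder_def
    by (auto intro!: bexI[of _ 1] exI[of _ 0])
  show "sym (same_cylinder :: 'a cyl rel)"
  proof (rule symI)
    fix c c' :: "'a cyl"
    assume "(c, c') \<in> same_cylinder"
    moreover obtain l I h l' I' h' where c: "c = (l, I, h)" "c' = (l', I', h')"
      by (metis prod_cases3)
    ultimately obtain \<sigma> \<tau> a b :: real where *: "l = l'" "\<sigma> \<in> {1, -1}" "\<tau> \<in> {1, -1}"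
        "I = (\<lambda>s. \<tau> * s + b) ` I'"
        "\<And>t s. s \<in> I' \<Longrightarrow> h' (t, s) = h (\<sigma> * t + a, \<tau> * s + b)"
      unfolding c same_cylinder_iff by metis
    have sq: "\<sigma> * \<sigma> = 1" "\<tau> * \<tau> = 1" using *(2,3) by auto
    have "I' = (\<lambda>s. \<tau> * s + (- \<tau> * b)) ` I"
      using *(3) by (auto simp: *(4) image_image algebra_simps)
    moreover have "h (t, s) = h' (\<sigma> * t + (- \<sigma> * a), \<tau> * s + (- \<tau> * b))" if s: "s \<in> I" for t s
    proof -
      obtain s' where s': "s' \<in> I'" "s = \<tau> * s' + b" using s *(4) by auto
      then have "\<tau> * s + (- \<tau> * b) = s'" using *(3) by auto
      moreover have "\<sigma> * (\<sigma> * t + (- \<sigma> * a)) + a = t" using *(2) by auto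
      ultimately show ?thesis using *(5)[OF s'(1), of "\<sigma> * t + (- \<sigma> * a)"] s'(2) by simp
    qed
    ultimately show "(c', c) \<in> same_cylinder"
      unfolding c same_cylinder_iff using *(1,2,3) by blast
  qed
  show "trans (same_cylinder :: 'a cyl rel)"
  proof (rule transI)
    fix c c' c'' :: "'a cyl"
    assume "(c, c') \<in> same_cylinder" "(c', c'') \<in> same_cylinder"
    moreover obtain l I h l' I' h' l'' I'' h''
      where c: "c = (l, I, h)" "c' = (l', I', h')" "c'' = (l'', I'', h'')"
      by (metis prod_cases3)
    ultimately obtain \<sigma> \<tau> a b \<sigma>' \<tau>' a' b' :: real where *: "l = l'" "\<sigma> \<in> {1, -1}" "\<tau> \<in> {1, -1}"
        "I = (\<lambda>s. \<tau> * s + b) ` I'"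
        "\<And>t s. s \<in> I' \<Longrightarrow> h' (t, s) = h (\<sigma> * t + a, \<tau> * s + b)"
      and **: "l' = l''" "\<sigma>' \<in> {1, -1}" "\<tau>' \<in> {1, -1}"
        "I' = (\<lambda>s. \<tau>' * s + b') ` I''"
        "\<And>t s. s \<in> I'' \<Longrightarrow> h'' (t, s) = h' (\<sigma>' * t + a', \<tau>' * s + b')"
      unfolding c same_cylinder_iff by metis
    have "\<sigma> * \<sigma>' \<in> {1, -1}" "\<tau> * \<tau>' \<in> {1, -1}" using *(2,3) **(2,3) by auto
    moreover have "I = (\<lambda>s. (\<tau> * \<tau>') * s + (\<tau> * b' + b)) ` I''"
      by (simp add: *(4) **(4) image_image algebra_simps)
    moreover have "h'' (t, s) = h ((\<sigma> * \<sigma>') * t + (\<sigma> * a' + a), (\<tau> * \<tau>') * s + (\<tau> * b' + b))"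
      if "s \<in> I''" for t s
    proof -
      have "\<tau>' * s + b' \<in> I'" using that **(4) by blast
      then show ?thesis
        using *(5)[of "\<tau>' * s + b'" "\<sigma>' * t + a'"] **(5)[OF that, of t]
        by (simp add: algebra_simps)
    qed
    ultimately show "(c, c'') \<in> same_cylinder"
      unfolding c same_cylinder_iff using *(1) **(1) by blast
  qed
qed auto

end

theory Submission
  imports Defs
begin

text \<open>
  A geodesic at distance at least \<open>\<epsilon>\<close> from \<open>P\<close> is the axis of a locally isometric image of a flat
  strip of half-width \<open>\<epsilon>\<close>. Heights of strips are bounded, because a flat disc of radius \<open>r\<close> in
  \<open>X - P\<close> keeps its centre at distance \<open>r\<close> from \<open>P\<close>, and limits of strips are strips. If strips of
  half-width \<open>\<epsilon>\<close> cross a given strip at angles tending to \<open>0\<close>, then translates of the given strip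
  converge to a strip that is higher by \<open>\<epsilon>\<close>. For a strip whose height is nearly maximal in its orbit
  closure, and for a periodic strip that is maximal upwards, this is impossible, so that strips close
  to it are parallel to it. The first case gives periodicity, the second one finiteness.
\<close>

section \<open>Local isometries\<close>

text \<open>All objects are local isometries from open sets of the plane or the line into the flat
  part. Their images need not be embedded, so a strip may overlap itself, and no developing map or
  unit tangent bundle has to be built. Unique continuation does the work of holonomy: two such maps
  with a common germ agree on a connected common domain. The gain in height is the same
  \<open>\<epsilon>\<close> each time, since all crossing strips have half-width
  \<open>\<epsilon>\<close>. So a height within \<open>\<epsilon>\<close> of the supremum is enough,
  and the supremum need not be attained. Recurrence is the obstacle to periodicity: nothing says
  directly that a strip comes back to itself. But its translates come close to one limit strip
  twice, and the difference of the two displacements is a translation under which the strip repeats.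
  Strips are prolonged upwards only, with a fixed lower edge; complex conjugation exchanges the two
  edges.\<close>

definition isom_on :: "'b::metric_space set \<Rightarrow> ('b \<Rightarrow> 'a::metric_space) \<Rightarrow> bool" where
  "isom_on S f \<longleftrightarrow> (\<forall>y\<in>S. \<forall>z\<in>S. dist (f y) (f z) = dist y z)"

lemma isom_onD: "isom_on S f \<Longrightarrow> y \<in> S \<Longrightarrow> z \<in> S \<Longrightarrow> dist (f y) (f z) = dist y z"
  by (simp add: isom_on_def)

lemma isom_on_subset: "isom_on S f \<Longrightarrow> T \<subseteq> S \<Longrightarrow> isom_on T f"
  by (auto simp: isom_on_def)

lemma isom_on_cong: "(\<And>z. z \<in> S \<Longrightarrow> f z = g z) \<Longrightarrow> isom_on S f \<longleftrightarrow> isom_on S g"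
  by (simp add: isom_on_def)

lemma local_isometry_on_open:
  assumes "open S"
  shows "local_isometry_on S f \<longleftrightarrow> (\<forall>x\<in>S. \<exists>e>0. ball x e \<subseteq> S \<and> isom_on (ball x e) f)"
proof
  assume L: "local_isometry_on S f"
  show "\<forall>x\<in>S. \<exists>e>0. ball x e \<subseteq> S \<and> isom_on (ball x e) f"
  proof
    fix x assume x: "x \<in> S"
    obtain e where e: "e > 0" "\<forall>y \<in> S \<inter> ball x e. \<forall>z \<in> S \<inter> ball x e. dist (f y) (f z) = dist y z"
      using L x unfolding local_isometry_on_def by blast
    obtain d where d: "d > 0" "ball x d \<subseteq> S"
      using assms x openE by blast
    have "isom_on (ball x (min d e)) f"
      using e(2) d(2) unfolding isom_on_def by (auto simp: subset_iff)
    then show "\<exists>e>0. ball x e \<subseteq> S \<and> isom_on (ball x e) f"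
      using e d by (intro exI[of _ "min d e"]) auto
  qed
next
  assume *: "\<forall>x\<in>S. \<exists>e>0. ball x e \<subseteq> S \<and> isom_on (ball x e) f"
  show "local_isometry_on S f"
    unfolding local_isometry_on_def
  proof
    fix x assume "x \<in> S"
    then obtain e where "e > 0" "isom_on (ball x e) f" using * by blast
    then show "\<exists>e>0. \<forall>y\<in>S \<inter> ball x e. \<forall>z\<in>S \<inter> ball x e. dist (f y) (f z) = dist y z"
      by (intro exI[of _ e]) (simp add: isom_on_def)
  qed
qed

lemma isom_on_imp_local_isometry_on: "isom_on S f \<Longrightarrow> local_isometry_on S f"
  unfolding isom_on_def local_isometry_on_def by (auto intro: exI[of _ 1])

lemma local_isometry_on_subset:
  "local_isometry_on S f \<Longrightarrow> T \<subseteq> S \<Longrightarrow> local_isometry_on T f"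
  unfolding local_isometry_on_def
proof
  fix x assume L: "\<forall>x\<in>S. \<exists>e>0. \<forall>y\<in>S \<inter> ball x e. \<forall>z\<in>S \<inter> ball x e. dist (f y) (f z) = dist y z"
    and "T \<subseteq> S" "x \<in> T"
  then obtain e where "e > 0" "\<forall>y\<in>S \<inter> ball x e. \<forall>z\<in>S \<inter> ball x e. dist (f y) (f z) = dist y z"
    by blast
  with \<open>T \<subseteq> S\<close> show "\<exists>e>0. \<forall>y\<in>T \<inter> ball x e. \<forall>z\<in>T \<inter> ball x e. dist (f y) (f z) = dist y z"
    by (intro exI[of _ e]) auto
qed

lemma local_isometry_on_cong:
  "(\<And>z. z \<in> S \<Longrightarrow> f z = g z) \<Longrightarrow> local_isometry_on S f \<longleftrightarrow> local_isometry_on S g"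
  unfolding local_isometry_on_def by simp

lemma local_isometry_on_compose:
  assumes "local_isometry_on S f" "isom_on T g" "g ` T \<subseteq> S"
  shows "local_isometry_on T (\<lambda>z. f (g z))"
  unfolding local_isometry_on_def
proof
  fix x assume x: "x \<in> T"
  then have "g x \<in> S" using assms by auto
  then obtain e where e: "e > 0"
    "\<And>y z. y \<in> S \<inter> ball (g x) e \<Longrightarrow> z \<in> S \<inter> ball (g x) e \<Longrightarrow> dist (f y) (f z) = dist y z"
    using assms(1) unfolding local_isometry_on_def by metis
  have "dist (f (g y)) (f (g z)) = dist y z" if "y \<in> T \<inter> ball x e" "z \<in> T \<inter> ball x e" for y z
  proof -
    have "g y \<in> S \<inter> ball (g x) e" "g z \<in> S \<inter> ball (g x) e"
      using that x assms(2,3) by (auto simp: isom_on_def)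
    then show ?thesis using e(2) assms(2) that by (auto simp: isom_on_def)
  qed
  then show "\<exists>e>0. \<forall>y\<in>T \<inter> ball x e. \<forall>z\<in>T \<inter> ball x e. dist (f (g y)) (f (g z)) = dist y z"
    using e(1) by blast
qed

lemma local_isometry_on_continuous:
  assumes "local_isometry_on S f"
  shows "continuous_on S f"
  unfolding continuous_on_iff
proof (intro ballI allI impI)
  fix x and e :: real assume x: "x \<in> S" "0 < e"
  obtain d where d: "d > 0" "\<forall>y \<in> S \<inter> ball x d. \<forall>z \<in> S \<inter> ball x d. dist (f y) (f z) = dist y z"
    using assms x unfolding local_isometry_on_def by blast
  show "\<exists>d>0. \<forall>x'\<in>S. dist x' x < d \<longrightarrow> dist (f x') (f x) < e"
    using d x by (intro exI[of _ "min d e"]) (auto simp: dist_commute)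
qed

text \<open>Short pieces of the segment from \<open>y\<close> to \<open>z\<close> keep their length,
  and the triangle inequality adds them up. Only the inequality survives globally, because the image
  may turn back towards its start.\<close>

lemma local_isometry_on_lipschitz:
  fixes f :: "'b::real_normed_vector \<Rightarrow> 'a::metric_space"
  assumes "local_isometry_on S f" "convex S" "y \<in> S" "z \<in> S"
  shows "dist (f y) (f z) \<le> dist y z"
proof -
  define p where "p t = y + t *\<^sub>R (z - y)" for t :: real
  have pS: "p t \<in> S" if "0 \<le> t" "t \<le> 1" for t
  proof -
    have "p t = (1 - t) *\<^sub>R y + t *\<^sub>R z" by (simp add: p_def algebra_simps)
    then show ?thesis using assms that by (simp add: convex_alt)
  qed
  have dp: "dist (p s) (p t) = \<bar>s - t\<bar> * dist y z" for s t
  proof -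
    have "p s - p t = (s - t) *\<^sub>R (z - y)" by (simp add: p_def algebra_simps)
    then show ?thesis by (simp add: dist_norm norm_minus_commute)
  qed
  \<comment> \<open>Bolzano's bisection principle asks for the property on all short intervals
    around a point, also on those that leave \<open>{0..1}\<close>; the guards make it vacuous
    there.\<close>
  define P where "P s t \<longleftrightarrow> 0 \<le> s \<and> s \<le> t \<and> t \<le> 1 \<longrightarrow> dist (f (p s)) (f (p t)) \<le> (t - s) * dist y z"
    for s t :: real
  have "P 0 1"
  proof (rule Bolzano)
    fix a b c assume *: "P a b" "P b c" "a \<le> b" "b \<le> c"
    show "P a c" unfolding P_def
    proof (intro impI)
      assume "0 \<le> a \<and> a \<le> c \<and> c \<le> 1"
      then have "dist (f (p a)) (f (p b)) \<le> (b - a) * dist y z"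
        "dist (f (p b)) (f (p c)) \<le> (c - b) * dist y z" using * by (auto simp: P_def)
      then show "dist (f (p a)) (f (p c)) \<le> (c - a) * dist y z"
        using dist_triangle[of "f (p a)" "f (p c)" "f (p b)"] by (simp add: algebra_simps)
    qed
  next
    fix x :: real assume x: "0 \<le> x" "x \<le> 1"
    obtain e where e: "e > 0"
      "\<And>u v. u \<in> S \<inter> ball (p x) e \<Longrightarrow> v \<in> S \<inter> ball (p x) e \<Longrightarrow> dist (f u) (f v) = dist u v"
      using assms(1) pS[OF x] unfolding local_isometry_on_def by metis
    \<comment> \<open>The summand 1 covers the case \<open>y = z\<close>.\<close>
    define d where "d = e / (dist y z + 1)"
    have d: "d > 0" using e by (simp add: d_def add_nonneg_pos)
    have near: "p t \<in> S \<inter> ball (p x) e" if "0 \<le> t" "t \<le> 1" "\<bar>x - t\<bar> < d" for t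
    proof -
      have "\<bar>x - t\<bar> * dist y z \<le> \<bar>x - t\<bar> * (dist y z + 1)" by (simp add: mult_left_mono)
      also have "\<dots> < e" using that(3) unfolding d_def
        by (subst (asm) pos_less_divide_eq) (auto intro: add_nonneg_pos)
      finally show ?thesis using pS that by (simp add: dp)
    qed
    have "P a b" if "a \<le> x" "x \<le> b" "b - a < d" for a b
      unfolding P_def
    proof (intro impI)
      assume "0 \<le> a \<and> a \<le> b \<and> b \<le> 1"
      then show "dist (f (p a)) (f (p b)) \<le> (b - a) * dist y z"
        using e(2)[OF near[of a] near[of b]] that by (auto simp: dp)
    qed
    then show "\<exists>d>0. \<forall>a b. a \<le> x \<and> x \<le> b \<and> b - a < d \<longrightarrow> P a b"
      using d by blast
  qed simp
  then show ?thesis by (simp add: P_def p_def)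
qed


section \<open>Isometries of the plane\<close>

text \<open>Polarization: the three mutual distances determine the inner product. Linearity of
  isometries is derived from this, without surjectivity.\<close>

lemma isom_on_inner:
  fixes F :: "'b::real_inner \<Rightarrow> 'c::real_inner"
  assumes F: "isom_on S F" and S: "u \<in> S" "v \<in> S" "y \<in> S"
  shows "(F u - F y) \<bullet> (F v - F y) = (u - y) \<bullet> (v - y)"
proof -
  have sq: "2 * (p \<bullet> q) = (norm p)\<^sup>2 + (norm q)\<^sup>2 - (norm (p - q))\<^sup>2" for p q :: "'d::real_inner"
    by (simp add: power2_norm_eq_inner inner_diff inner_commute)
  have "norm (F u - F v) = norm (u - v)" "norm (F u - F y) = norm (u - y)" "norm (F v - F y) = norm (v - y)"
    using isom_onD[OF F] S by (simp_all add: dist_norm)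
  then show ?thesis using sq[of "F u - F y" "F v - F y"] sq[of "u - y" "v - y"] by simp
qed

text \<open>Centred at \<open>z\<close> the map preserves inner products. Turning the image of one
  real vector back to the real axis makes it preserve real parts; then all imaginary parts are kept
  or all are negated, and one imaginary vector decides which.\<close>

lemma isometry_plane:
  assumes F: "isom_on (ball z r) F" and r: "r > 0"
  obtains a :: complex where "norm a = 1"
    "(\<forall>u\<in>ball z r. F u = F z + a * (u - z)) \<or> (\<forall>u\<in>ball z r. F u = F z + a * cnj (u - z))"
proof -
  define s where "s = r / 2"
  have s: "s > 0" "s < r" using r by (auto simp: s_def)
  define G where "G u = F (z + u) - F z" for u
  have Gi: "G u \<bullet> G v = u \<bullet> v" if "norm u < r" "norm v < r" for u v
    using isom_on_inner[OF F, of "z + u" "z + v" z] that r by (simp add: G_def dist_norm)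
  have Gn: "norm (G u) = norm u" if "norm u < r" for u
    using Gi[OF that that] by (simp add: norm_eq_sqrt_inner)
  define a where "a = G (of_real s) / of_real s"
  have na: "norm a = 1" using s Gn[of "of_real s"] by (simp add: a_def norm_divide)
  have aa: "cnj a * a = 1" using na complex_norm_square[of a] by (simp add: mult.commute)
  define H where "H u = cnj a * G u" for u
  have Gs: "G (of_real s) = of_real s * a" using s by (simp add: a_def)
  have Hre: "Re (H u) = Re u" if "norm u < r" for u
  proof -
    have "G u \<bullet> (of_real s * a) = u \<bullet> of_real s"
      using Gi[OF that, of "of_real s"] s Gs by simp
    moreover have "G u \<bullet> (of_real s * a) = s * Re (H u)"
      by (simp add: H_def inner_complex_def algebra_simps)
    moreover have "u \<bullet> of_real s = s * Re u" by (simp add: inner_complex_def)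
    ultimately show ?thesis using s by simp
  qed
  have Hi: "H u \<bullet> H v = u \<bullet> v" if "norm u < r" "norm v < r" for u v
  proof -
    have "H u \<bullet> H v = Re (cnj (H u) * H v)" by (simp add: inner_complex_def)
    also have "cnj (H u) * H v = (cnj a * a) * (cnj (G u) * G v)" by (simp add: H_def mult_ac)
    also have "Re \<dots> = G u \<bullet> G v" by (simp add: aa inner_complex_def)
    finally show ?thesis using Gi[OF that] by simp
  qed
  have Him: "Im (H u) * Im (H v) = Im u * Im v" if "norm u < r" "norm v < r" for u v
    using Hi[OF that] Hre[OF that(1)] Hre[OF that(2)] by (simp add: inner_complex_def)
  have GH: "G u = a * H u" for u
    using aa by (metis H_def mult.assoc mult.commute mult_1)
  have nis: "norm (\<i> * of_real s) < r" using s by (simp add: norm_mult)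
  have "Im (H (\<i> * of_real s)) * Im (H (\<i> * of_real s)) = s * s"
    using Him[OF nis nis] by simp
  then have sq: "Im (H (\<i> * of_real s)) = s \<or> Im (H (\<i> * of_real s)) = - s"
    by (simp add: square_eq_iff)
  then show thesis
  proof
    assume "Im (H (\<i> * of_real s)) = s"
    then have "H u = u" if "norm u < r" for u
      using Him[OF that nis] Hre[OF that] s by (simp add: complex_eq_iff)
    then have "F u = F z + a * (u - z)" if "u \<in> ball z r" for u
      using GH[of "u - z"] that by (simp add: G_def dist_norm norm_minus_commute diff_eq_eq add.commute)
    then show thesis using that na by blast
  next
    assume "Im (H (\<i> * of_real s)) = - s"
    then have "H u = cnj u" if "norm u < r" for u
    proof -
      have "Im (H u) * s = (- Im u) * s"
        using Him[OF that nis] \<open>Im (H (\<i> * of_real s)) = - s\<close> by simp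
      then have "Im (H u) = - Im u" using s by (simp only: mult_cancel_right) simp
      then show ?thesis using Hre[OF that] by (simp add: complex_eq_iff)
    qed
    then have "F u = F z + a * cnj (u - z)" if "u \<in> ball z r" for u
      using GH[of "u - z"] that by (simp add: G_def dist_norm norm_minus_commute diff_eq_eq add.commute)
    then show thesis using that na by blast
  qed
qed

text \<open>Both maps send two independent vectors at \<open>y\<close> to the same vectors
  \<open>p\<close> and \<open>q\<close>. The inner products with these are prescribed, so
  \<open>F u - G u\<close> is orthogonal to both and vanishes.\<close>

lemma isometry_plane_eqI:
  fixes F G :: "complex \<Rightarrow> complex"
  assumes F: "isom_on (ball z r) F" and G: "isom_on (ball z r) G"
    and s: "s > 0" "ball y s \<subseteq> ball z r" "\<And>u. u \<in> ball y s \<Longrightarrow> F u = G u"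
    and u: "u \<in> ball z r"
  shows "F u = G u"
proof -
  define t where "t = s / 2"
  have t: "t > 0" "t < s" using s by (auto simp: t_def)
  define v where "v = y + of_real t"
  define w where "w = y + \<i> * of_real t"
  have b: "y \<in> ball y s" "v \<in> ball y s" "w \<in> ball y s"
    using t s by (auto simp: v_def w_def dist_norm norm_mult)
  note b' = b[THEN subsetD[OF s(2)]]
  note e = b[THEN s(3)]
  define p where "p = F v - F y"
  define q where "q = F w - F y"
  define D where "D = F u - G u"
  have "p \<bullet> p = t\<^sup>2" "q \<bullet> q = t\<^sup>2" "p \<bullet> q = 0"
    unfolding p_def q_def isom_on_inner[OF F b'(2,2,1)] isom_on_inner[OF F b'(3,3,1)]
      isom_on_inner[OF F b'(2,3,1)]
    by (simp_all add: v_def w_def inner_complex_def power2_eq_square)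
  \<comment> \<open>Lagrange's identity: the squared determinant is the product of the squared norms
    minus the squared inner product.\<close>
  then have "(Re p * Im q - Im p * Re q)\<^sup>2 = t\<^sup>2 * t\<^sup>2"
    unfolding inner_complex_def by algebra
  then have det: "Re p * Im q - Im p * Re q \<noteq> 0" using t by auto
  have "D = (F u - F y) - (G u - G y)" using e(1) by (simp add: D_def)
  then have "D \<bullet> p = 0" "D \<bullet> q = 0"
    using isom_on_inner[OF F u b'(2,1)] isom_on_inner[OF G u b'(2,1)]
      isom_on_inner[OF F u b'(3,1)] isom_on_inner[OF G u b'(3,1)] e
    by (simp_all add: inner_diff_left p_def q_def)
  then have "(Re p * Im q - Im p * Re q) * Re D = 0" "(Re p * Im q - Im p * Re q) * Im D = 0"
    unfolding inner_complex_def by algebra+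
  then show ?thesis using det by (simp add: D_def complex_eq_iff)
qed

text \<open>The equality case of Cauchy-Schwarz: \<open>G u\<close> has norm
  \<open>\<bar>u\<bar>\<close> and inner product \<open>u\<close> with the unit vector
  \<open>v\<close>, hence is a multiple of \<open>v\<close>.\<close>

lemma isometry_line:
  fixes F :: "real \<Rightarrow> complex"
  assumes F: "isom_on (ball t r) F" and r: "r > 0"
  obtains v where "norm v = 1" "\<And>u. u \<in> ball t r \<Longrightarrow> F u = F t + of_real (u - t) * v"
proof -
  define s where "s = r / 2"
  have s: "s > 0" "s < r" using r by (auto simp: s_def)
  define G where "G u = F (t + u) - F t" for u
  have Gi: "G u \<bullet> G v = u * v" if "\<bar>u\<bar> < r" "\<bar>v\<bar> < r" for u v
    using isom_on_inner[OF F, of "t + u" "t + v" t] that r by (simp add: G_def dist_norm)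
  have Gn: "norm (G u) = \<bar>u\<bar>" if "\<bar>u\<bar> < r" for u
    using Gi[OF that that] by (simp add: norm_eq_sqrt_inner)
  define v where "v = G s / of_real s"
  have nv: "norm v = 1" using s Gn[of s] by (simp add: v_def norm_divide)
  have Gs: "G s = s *\<^sub>R v" using s by (simp add: v_def scaleR_conv_of_real)
  have "G u = u *\<^sub>R v" if u: "\<bar>u\<bar> < r" for u
  proof -
    have "G u \<bullet> G s = u * s" using Gi[OF u] s by simp
    then have i: "G u \<bullet> v = u" using s by (simp add: Gs)
    have "(norm (G u - u *\<^sub>R v))\<^sup>2 = (norm (G u))\<^sup>2 + u\<^sup>2 * (norm v)\<^sup>2 - 2 * u * (G u \<bullet> v)"
      unfolding power2_norm_eq_inner
      by (simp add: inner_diff inner_commute power2_eq_square algebra_simps)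
    also have "\<dots> = 0" using i nv Gn[OF u] by (simp add: power2_eq_square)
    finally show ?thesis by simp
  qed
  then have "F u = F t + of_real (u - t) * v" if "u \<in> ball t r" for u
    using that \<open>\<And>u. \<bar>u\<bar> < r \<Longrightarrow> G u = u *\<^sub>R v\<close>[of "u - t"]
    by (simp add: G_def dist_norm abs_minus_commute scaleR_conv_of_real algebra_simps)
  then show thesis using that nv by blast
qed


lemma rotate_ball:
  fixes a z :: complex
  assumes "norm a = 1"
  shows "(\<lambda>u. a * (u - z)) ` ball z r = ball 0 r" "(\<lambda>u. a * cnj (u - z)) ` ball z r = ball 0 r"
proof -
  have nz: "a \<noteq> 0" using assms by auto
  have n: "norm (v / a) = norm v" for v :: complex using assms by (simp add: norm_divide)
  show "(\<lambda>u. a * (u - z)) ` ball z r = ball 0 r"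
  proof (intro equalityI subsetI)
    fix v :: complex assume "v \<in> ball 0 r"
    then have "z + v / a \<in> ball z r" "v = a * (z + v / a - z)"
      using n nz by (auto simp: dist_norm)
    then show "v \<in> (\<lambda>u. a * (u - z)) ` ball z r" by blast
  qed (use assms in \<open>auto simp: norm_mult dist_norm norm_minus_commute\<close>)
  show "(\<lambda>u. a * cnj (u - z)) ` ball z r = ball 0 r"
  proof (intro equalityI subsetI)
    fix v :: complex assume "v \<in> ball 0 r"
    then have "z + cnj (v / a) \<in> ball z r" "v = a * cnj (z + cnj (v / a) - z)"
      using n nz by (auto simp: dist_norm simp del: complex_cnj_divide)
    then show "v \<in> (\<lambda>u. a * cnj (u - z)) ` ball z r" by blast
  qed (use assms in \<open>auto simp: norm_mult dist_norm norm_minus_commute simp flip: complex_cnj_diff\<close>)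
qed

lemma isom_on_rotate:
  fixes a z :: complex
  assumes "norm a = 1"
  shows "isom_on S (\<lambda>u. w + a * u)" "isom_on S (\<lambda>u. a * (u - z))" "isom_on S (\<lambda>u. a * cnj (u - z))"
proof -
  have "norm (a * u - a * v) = norm (u - v)" for u v
    using assms by (metis mult_1 norm_mult right_diff_distrib)
  moreover have "norm (cnj u - cnj v) = norm (u - v)" for u v
    by (metis complex_cnj_diff complex_mod_cnj)
  ultimately show "isom_on S (\<lambda>u. w + a * u)" "isom_on S (\<lambda>u. a * (u - z))"
    "isom_on S (\<lambda>u. a * cnj (u - z))"
    by (simp_all add: isom_on_def dist_norm)
qed

lemma isom_on_translate: "isom_on S (\<lambda>u::'b::real_normed_vector. u + w)" "isom_on S (\<lambda>u::'b. u - w)"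
  by (simp_all add: isom_on_def dist_norm)

lemma isom_on_cnj: "isom_on S cnj"
  by (simp add: isom_on_def dist_norm flip: complex_cnj_diff)


text \<open>Reads \<open>f\<close> in the chart \<open>e\<close>, so that statements about maps into
  the surface become statements about isometries into the plane.\<close>

lemma isom_on_lift:
  assumes e: "isom_on B e" and f: "f ` T \<subseteq> e ` B" "isom_on T f"
  defines "F \<equiv> \<lambda>u. inv_into B e (f u)"
  shows "isom_on T F" "\<And>u. u \<in> T \<Longrightarrow> F u \<in> B" "\<And>u. u \<in> T \<Longrightarrow> e (F u) = f u"
proof -
  show F: "F u \<in> B" "e (F u) = f u" if "u \<in> T" for u
  proof -
    have "f u \<in> e ` B" using that f(1) by blast
    then show "F u \<in> B" "e (F u) = f u"
      unfolding F_def by (rule inv_into_into, rule f_inv_into_f)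
  qed
  show "isom_on T F"
    unfolding isom_on_def
  proof (intro ballI)
    fix y z assume *: "y \<in> T" "z \<in> T"
    show "dist (F y) (F z) = dist y z"
      using isom_onD[OF e F(1)[OF *(1)] F(1)[OF *(2)]] isom_onD[OF f(2) *] F(2) * by simp
  qed
qed


section \<open>Flat surfaces with singularities\<close>

locale flat_surface =
  fixes X P :: "'a::metric_space set"
  assumes compact_X: "compact X" and finite_P: "finite P" and P_subset: "P \<subseteq> X" and P_nonempty: "P \<noteq> {}"
    and intrinsic: "intrinsic_metric X"
    and flat: "\<And>x. x \<in> X - P \<Longrightarrow> \<exists>U c. flat_chart X P U c \<and> x \<in> U"
begin

text \<open>With a domain in the plane this is an immersed flat piece of the surface, with a domain
  in the line a geodesic arc that stays off \<open>P\<close>.\<close>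

definition liso :: "'b::metric_space set \<Rightarrow> ('b \<Rightarrow> 'a) \<Rightarrow> bool" where
  "liso S f \<longleftrightarrow> local_isometry_on S f \<and> f ` S \<subseteq> X - P"

text \<open>The exponential map at \<open>x\<close> is an isometry of the disc of radius
  \<open>r\<close> onto the whole metric ball. Filling the ball is what allows nearby maps to be
  lifted through \<open>e\<close>.\<close>

definition normal :: "'a \<Rightarrow> real \<Rightarrow> bool" where
  "normal x r \<longleftrightarrow> 0 < r \<and> X \<inter> ball x r \<subseteq> X - P \<and>
     (\<exists>e::complex \<Rightarrow> 'a. isom_on (ball 0 r) e \<and> e 0 = x \<and> e ` ball 0 r = X \<inter> ball x r)"

lemma liso_subset: "liso S f \<Longrightarrow> T \<subseteq> S \<Longrightarrow> liso T f"
  unfolding liso_def using local_isometry_on_subset by blast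

lemma liso_cong: "(\<And>z. z \<in> S \<Longrightarrow> f z = g z) \<Longrightarrow> liso S f \<longleftrightarrow> liso S g"
  unfolding liso_def using local_isometry_on_cong[of S f g] by auto

lemma liso_compose: "liso S f \<Longrightarrow> isom_on T g \<Longrightarrow> g ` T \<subseteq> S \<Longrightarrow> liso T (\<lambda>z. f (g z))"
  unfolding liso_def using local_isometry_on_compose[of S f T g] by blast

lemma liso_in: "liso S f \<Longrightarrow> z \<in> S \<Longrightarrow> f z \<in> X - P"
  by (auto simp: liso_def)

lemma liso_ball:
  assumes "liso S f" "open S" "z \<in> S"
  obtains s where "s > 0" "ball z s \<subseteq> S" "isom_on (ball z s) f"
  using assms local_isometry_on_open unfolding liso_def by blast

lemma liso_openI:
  assumes "open S" "\<And>z. z \<in> S \<Longrightarrow> f z \<in> X - P"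
    "\<And>z. z \<in> S \<Longrightarrow> \<exists>s>0. isom_on (ball z s) f"
  shows "liso S f"
proof -
  have "\<exists>e>0. ball x e \<subseteq> S \<and> isom_on (ball x e) f" if x: "x \<in> S" for x
  proof -
    obtain s where s: "s > 0" "isom_on (ball x s) f" using assms(3) x by blast
    obtain d where d: "d > 0" "ball x d \<subseteq> S"
      using assms(1) x openE by blast
    then show ?thesis
      using s isom_on_subset[OF s(2) subset_ball, of "min s d"]
      by (intro exI[of _ "min s d"]) auto
  qed
  then show ?thesis
    unfolding liso_def using local_isometry_on_open[OF assms(1), of f] assms(2) by auto
qed

lemma liso_lipschitz:
  fixes f :: "'b::real_normed_vector \<Rightarrow> 'a"
  shows "liso S f \<Longrightarrow> convex S \<Longrightarrow> y \<in> S \<Longrightarrow> z \<in> S \<Longrightarrow> dist (f y) (f z) \<le> dist y z"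
  unfolding liso_def using local_isometry_on_lipschitz by blast

text \<open>The chart is recentred at \<open>y\<close>. The normal radius thus drops by at most the
  distance moved, which turns pointwise radii into uniform ones on compact sets.\<close>

lemma normal_moved:
  assumes "normal x r" "y \<in> X" "dist x y + r' \<le> r" "0 < r'"
  shows "normal y r'"
proof -
  obtain e :: "complex \<Rightarrow> 'a" where e: "isom_on (ball 0 r) e" "e 0 = x" "e ` ball 0 r = X \<inter> ball x r"
    and s: "X \<inter> ball x r \<subseteq> X - P"
    using assms(1) unfolding normal_def by blast
  have sub: "ball y r' \<subseteq> ball x r"
  proof
    fix v assume "v \<in> ball y r'"
    then show "v \<in> ball x r" using assms(3) dist_triangle[of x v y] by simp
  qed
  have "y \<in> e ` ball 0 r" using e(3) assms by auto
  then obtain w where w: "w \<in> ball 0 r" "e w = y" by blast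
  have "norm w = dist x y" using isom_onD[OF e(1), of 0 w] w e(2) assms(4)
    by (metis centre_in_ball dist_0_norm isom_onD mem_ball norm_ge_zero order.strict_trans1)
  then have wb: "w + u \<in> ball 0 r" if "u \<in> ball 0 r'" for u
    using that assms(3) norm_triangle_ineq[of w u] by simp
  define e' where "e' u = e (w + u)" for u
  have "isom_on (ball 0 r') e'"
    using e(1) wb unfolding isom_on_def e'_def by simp
  moreover have "e' 0 = y" by (simp add: e'_def w)
  moreover have "e' ` ball 0 r' = X \<inter> ball y r'"
  proof (intro equalityI subsetI)
    fix v assume "v \<in> e' ` ball 0 r'"
    then obtain u where u: "u \<in> ball 0 r'" "v = e' u" by blast
    then have "v \<in> X" using wb e(3) e'_def by blast
    moreover have "dist y v = norm u"
      using isom_onD[OF e(1) w(1) wb[OF u(1)]] u w by (simp add: e'_def dist_norm)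
    ultimately show "v \<in> X \<inter> ball y r'" using u by auto
  next
    fix v assume v: "v \<in> X \<inter> ball y r'"
    then have "v \<in> e ` ball 0 r" using sub e(3) by auto
    then obtain u where u: "u \<in> ball 0 r" "e u = v" by blast
    then have "norm (u - w) = dist y v"
      using isom_onD[OF e(1) w(1) u(1)] w by (simp add: dist_norm norm_minus_commute)
    then have "u - w \<in> ball 0 r'" "v = e' (u - w)" using v u by (auto simp: e'_def)
    then show "v \<in> e' ` ball 0 r'" by blast
  qed
  ultimately show ?thesis unfolding normal_def using assms(4) s sub by blast
qed

lemma normal_in: "normal x r \<Longrightarrow> x \<in> X"
  unfolding normal_def by (metis IntD1 centre_in_ball image_eqI)

lemma normal_smaller: "normal x r \<Longrightarrow> 0 < r' \<Longrightarrow> r' \<le> r \<Longrightarrow> normal x r'"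
  by (rule normal_moved[of x r]) (auto simp: normal_in)

lemma normal_exists:
  assumes "x \<in> X - P"
  obtains r where "normal x r"
proof -
  obtain U c where c: "U \<subseteq> X - P" "openin (top_of_set X) U" "open (c ` U)" "x \<in> U"
    "\<And>x y. x \<in> U \<Longrightarrow> y \<in> U \<Longrightarrow> dist (c x) (c y :: complex) = dist x y"
    using flat[OF assms] unfolding flat_chart_def by blast
  obtain r1 where r1: "r1 > 0" "X \<inter> ball x r1 \<subseteq> U"
    using c(2,4) unfolding openin_contains_ball by (auto simp: Int_commute)
  obtain r2 where r2: "r2 > 0" "ball (c x) r2 \<subseteq> c ` U"
    using c(3,4) by (meson image_eqI openE)
  \<comment> \<open>\<open>r1\<close> keeps the metric ball inside the domain of the flat chart,
    \<open>r2\<close> the Euclidean disc inside its image; together they make the two correspond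
    exactly.\<close>
  define r where "r = min r1 r2"
  have r: "r > 0" "X \<inter> ball x r \<subseteq> U" "ball (c x) r \<subseteq> c ` U" using r1 r2 by (auto simp: r_def)
  have inj: "inj_on c U" by (rule inj_onI) (metis c(5) dist_eq_0_iff)
  define e where "e u = inv_into U c (c x + u)" for u
  have e: "e u \<in> U" "c (e u) = c x + u" if "u \<in> ball 0 r" for u
  proof -
    have "c x + u \<in> c ` U" using r(3) that by (auto simp: dist_norm)
    then show "e u \<in> U" "c (e u) = c x + u" unfolding e_def
      by (auto simp: inv_into_into f_inv_into_f)
  qed
  have e0: "e 0 = x" using inj c(4) by (simp add: e_def)
  have "isom_on (ball 0 r) e"
  proof (unfold isom_on_def, intro ballI)
    fix y z :: complex assume "y \<in> ball 0 r" "z \<in> ball 0 r"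
    then show "dist (e y) (e z) = dist y z"
      using c(5)[OF e(1) e(1), of y z] e(2)[of y] e(2)[of z] by (simp add: dist_norm)
  qed
  moreover have "e ` ball 0 r = X \<inter> ball x r"
  proof (intro equalityI subsetI)
    fix v assume "v \<in> e ` ball 0 r"
    then obtain u where u: "u \<in> ball 0 r" "v = e u" by blast
    then have "dist x v = norm u" using c(5)[OF c(4) e(1)[OF u(1)]] e(2)[OF u(1)] by (simp add: dist_norm)
    then show "v \<in> X \<inter> ball x r" using u e(1) c(1) by auto
  next
    fix v assume v: "v \<in> X \<inter> ball x r"
    then have vU: "v \<in> U" using r by auto
    have "c v - c x \<in> ball 0 r" using c(5)[OF c(4) vU] v by (simp add: dist_norm norm_minus_commute)
    moreover have "v = e (c v - c x)" using vU inj by (simp add: e_def)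
    ultimately show "v \<in> e ` ball 0 r" by blast
  qed
  moreover have "X \<inter> ball x r \<subseteq> X - P" using r c by auto
  ultimately have "normal x r" unfolding normal_def using r(1) e0 by blast
  then show thesis using that by blast
qed

lemma germ_in_chart:
  fixes f :: "'b::metric_space \<Rightarrow> 'a"
  assumes f: "liso S f" "open S" "z \<in> S" and n: "normal (f z) \<rho>"
  obtains e s and F :: "'b \<Rightarrow> complex" where "isom_on (ball 0 \<rho>) e" "e ` ball 0 \<rho> = X \<inter> ball (f z) \<rho>"
    "s > 0" "s \<le> \<rho>" "ball z s \<subseteq> S" "isom_on (ball z s) F" "F z = 0"
    "\<And>u. u \<in> ball z s \<Longrightarrow> e (F u) = f u"
proof -
  obtain d where d: "d > 0" "ball z d \<subseteq> S" "isom_on (ball z d) f"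
    using liso_ball[OF f] by blast
  have \<rho>: "\<rho> > 0" using n by (simp add: normal_def)
  define s where "s = min d \<rho>"
  have s: "s > 0" "s \<le> \<rho>" "ball z s \<subseteq> S" "isom_on (ball z s) f"
    using d \<rho> isom_on_subset[OF d(3) subset_ball, of s] by (auto simp: s_def)
  have zs: "z \<in> ball z s" using s by simp
  have "f ` ball z s \<subseteq> X \<inter> ball (f z) \<rho>"
    using s liso_in[OF f(1)] isom_onD[OF s(4) zs] by auto
  moreover obtain e :: "complex \<Rightarrow> 'a" where e: "isom_on (ball 0 \<rho>) e" "e 0 = f z"
    "e ` ball 0 \<rho> = X \<inter> ball (f z) \<rho>"
    using n unfolding normal_def by blast
  ultimately have im: "f ` ball z s \<subseteq> e ` ball 0 \<rho>" by simp
  define F where "F u = inv_into (ball 0 \<rho>) e (f u)" for u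
  note F = isom_on_lift[OF e(1) im s(4), folded F_def]
  have "dist (F z) 0 = 0"
    using isom_onD[OF e(1) F(2)[OF zs], of 0] F(3)[OF zs] e(2) \<rho> by simp
  then show thesis using that[OF e(1,3) s(1,2,3) F(1) _ F(3)] by simp
qed

lemma isom_on_after_rotation:
  fixes e :: "complex \<Rightarrow> 'a"
  assumes e: "isom_on (ball 0 \<rho>) e" and a: "norm a = 1"
    and \<phi>: "\<phi> = (\<lambda>u. a * (u - z)) \<or> \<phi> = (\<lambda>u. a * cnj (u - z))"
  shows "isom_on (ball z \<rho>) (\<lambda>u. e (\<phi> u))" "(\<lambda>u. e (\<phi> u)) ` ball z \<rho> = e ` ball 0 \<rho>"
proof -
  have i: "isom_on (ball z \<rho>) \<phi>" "\<phi> ` ball z \<rho> = ball 0 \<rho>"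
    using \<phi> by (elim disjE; simp only: isom_on_rotate[OF a] rotate_ball[OF a])+
  have im: "\<phi> u \<in> ball 0 \<rho>" if "u \<in> ball z \<rho>" for u using that i(2) by blast
  show "isom_on (ball z \<rho>) (\<lambda>u. e (\<phi> u))"
    unfolding isom_on_def using isom_onD[OF e im im] isom_onD[OF i(1)] by simp
  show "(\<lambda>u. e (\<phi> u)) ` ball z \<rho> = e ` ball 0 \<rho>" using i(2) by (metis image_image)
qed

text \<open>In a chart the germ is a rotation or a reflection. This motion is absorbed into the
  chart, which leaves a single isometry of the full normal disc that prolongs the germ.\<close>

lemma liso_germ:
  fixes f :: "complex \<Rightarrow> 'a"
  assumes f: "liso S f" "open S" "z \<in> S" and n: "normal (f z) \<rho>"
  obtains e s where "isom_on (ball z \<rho>) e" "e ` ball z \<rho> = X \<inter> ball (f z) \<rho>"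
    "s > 0" "s \<le> \<rho>" "ball z s \<subseteq> S" "\<And>u. u \<in> ball z s \<Longrightarrow> f u = e u"
proof (rule germ_in_chart[OF f n])
  fix e s and F :: "complex \<Rightarrow> complex"
  assume e: "isom_on (ball 0 \<rho>) e" "e ` ball 0 \<rho> = X \<inter> ball (f z) \<rho>"
    and s: "s > 0" "s \<le> \<rho>" "ball z s \<subseteq> S" and F: "isom_on (ball z s) F" "F z = 0"
    and eF: "\<And>u. u \<in> ball z s \<Longrightarrow> e (F u) = f u"
  obtain a where a: "norm a = 1"
    "(\<forall>u\<in>ball z s. F u = a * (u - z)) \<or> (\<forall>u\<in>ball z s. F u = a * cnj (u - z))"
    by (rule isometry_plane[OF F(1) s(1)]) (auto simp: F(2))
  then obtain \<phi> where \<phi>: "\<phi> = (\<lambda>u. a * (u - z)) \<or> \<phi> = (\<lambda>u. a * cnj (u - z))"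
    "\<And>u. u \<in> ball z s \<Longrightarrow> F u = \<phi> u"
    by metis
  from isom_on_after_rotation[OF e(1) a(1) \<phi>(1)] show thesis
    using that[of "\<lambda>u. e (\<phi> u)" s] e(2) s eF \<phi>(2) by metis
qed

text \<open>Thickens a geodesic arc to a flat disc whose real diameter is the arc. The mirror image
  of \<open>e\<close> would serve equally well, so the choice of side is made here.\<close>

lemma curve_germ:
  fixes f :: "real \<Rightarrow> 'a"
  assumes f: "liso S f" "open S" "t \<in> S" and n: "normal (f t) \<rho>"
  obtains e :: "complex \<Rightarrow> 'a" and s where "isom_on (ball (of_real t) \<rho>) e"
    "e ` ball (of_real t) \<rho> = X \<inter> ball (f t) \<rho>"
    "s > 0" "s \<le> \<rho>" "ball t s \<subseteq> S" "\<And>u. u \<in> ball t s \<Longrightarrow> f u = e (of_real u)"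
proof (rule germ_in_chart[OF f n])
  fix e s and F :: "real \<Rightarrow> complex"
  assume e: "isom_on (ball 0 \<rho>) e" "e ` ball 0 \<rho> = X \<inter> ball (f t) \<rho>"
    and s: "s > 0" "s \<le> \<rho>" "ball t s \<subseteq> S" and F: "isom_on (ball t s) F" "F t = 0"
    and eF: "\<And>u. u \<in> ball t s \<Longrightarrow> e (F u) = f u"
  obtain v where v: "norm v = 1" "\<And>u. u \<in> ball t s \<Longrightarrow> F u = F t + of_real (u - t) * v"
    using isometry_line[OF F(1) s(1)] by blast
  define \<phi> where "\<phi> = (\<lambda>u. v * (u - of_real t))"
  have "F u = \<phi> (of_real u)" if "u \<in> ball t s" for u
    using v(2)[OF that] F(2) by (simp add: \<phi>_def mult.commute)
  moreover have "\<phi> = (\<lambda>u. v * (u - of_real t)) \<or> \<phi> = (\<lambda>u. v * cnj (u - of_real t))"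
    by (simp add: \<phi>_def)
  note isom_on_after_rotation[OF e(1) v(1) this]
  ultimately show thesis
    using that[of "\<lambda>u. e (\<phi> u)" s] e(2) s eF by metis
qed

subsection \<open>Unique continuation\<close>

text \<open>The plane and the line share this proof; \<open>eqI\<close>, that isometries into the
  plane are determined by a germ, is all that depends on the domain. Agreement near one point
  spreads over a disc around every point, then over \<open>S\<close> by connectedness.\<close>

lemma liso_unique_aux:
  fixes f g :: "'b::real_normed_vector \<Rightarrow> 'a"
  assumes S: "connected S" "open S" and f: "liso S f" and g: "liso S g"
    and eqI: "\<And>z r s y u and F G :: 'b \<Rightarrow> complex. isom_on (ball z r) F \<Longrightarrow> isom_on (ball z r) G \<Longrightarrow>
      s > 0 \<Longrightarrow> ball y s \<subseteq> ball z r \<Longrightarrow> (\<And>u. u \<in> ball y s \<Longrightarrow> F u = G u) \<Longrightarrow> u \<in> ball z r \<Longrightarrow> F u = G u"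
    and ag: "\<delta> > 0" "ball v \<delta> \<subseteq> S" "\<And>u. u \<in> ball v \<delta> \<Longrightarrow> f u = g u" and z: "z \<in> S"
  shows "f z = g z"
proof -
  define Q where "Q x \<longleftrightarrow> (\<exists>s>0. \<forall>u\<in>ball x s. f u = g u)" for x
  have "Q z"
  proof (rule connected_induction_simple[OF S(1), where a = v and b = z and P = Q])
    show "v \<in> S" "z \<in> S" using ag z by auto
    show "Q v" using ag unfolding Q_def by blast
  next
    fix x assume x: "x \<in> S"
    obtain \<rho> where n: "normal (f x) \<rho>" using normal_exists liso_in[OF f x] by blast
    have \<rho>: "\<rho> > 0" using n by (simp add: normal_def)
    obtain d1 where d1: "d1 > 0" "ball x d1 \<subseteq> S" "isom_on (ball x d1) f" using liso_ball[OF f S(2) x] .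
    obtain d2 where d2: "d2 > 0" "ball x d2 \<subseteq> S" "isom_on (ball x d2) g" using liso_ball[OF g S(2) x] .
    \<comment> \<open>\<open>f x = g x\<close> is not yet known. A value \<open>g w\<close> is
      reached from \<open>f x\<close> through the common value at \<open>y\<close> in three hops
      shorter than \<open>s\<close>, so the third of \<open>\<rho>\<close> keeps both images in one
      chart.\<close>
    define s where "s = min (min d1 d2) (\<rho> / 3)"
    have s: "s > 0" "3 * s \<le> \<rho>" "ball x s \<subseteq> S" using d1 d2 \<rho> by (auto simp: s_def)
    have i: "isom_on (ball x s) f" "isom_on (ball x s) g"
      by (rule isom_on_subset[OF d1(3) subset_ball], simp add: s_def)
       (rule isom_on_subset[OF d2(3) subset_ball], simp add: s_def)
    have Qz: "Q z" if y: "y \<in> ball x s" "Q y" and zz: "z \<in> ball x s" for y z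
    proof -
      obtain s' where s': "s' > 0" "\<forall>u\<in>ball y s'. f u = g u" using y(2) unfolding Q_def by blast
      obtain s'' where s'': "s'' > 0" "ball y s'' \<subseteq> ball x s" using y(1) by (meson open_ball openE)
      have xs: "x \<in> ball x s" using s by simp
      have fy: "f y = g y" using s' by simp
      have fX: "f ` ball x s \<subseteq> X \<inter> ball (f x) \<rho>"
      proof (intro image_subsetI IntI)
        fix w assume w: "w \<in> ball x s"
        then show "f w \<in> X" using s(3) liso_in[OF f] by auto
        show "f w \<in> ball (f x) \<rho>" using isom_onD[OF i(1) xs w] s w by simp
      qed
      have gX: "g ` ball x s \<subseteq> X \<inter> ball (f x) \<rho>"
      proof -
        have "dist (f x) (g w) < \<rho>" if w: "w \<in> ball x s" for w
        proof -
          have "dist (f x) (f y) < s" "dist (g x) (g y) < s" "dist (g x) (g w) < s"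
            using isom_onD[OF i(1) xs y(1)] isom_onD[OF i(2) xs y(1)] isom_onD[OF i(2) xs w] w y(1) by auto
          moreover have "dist (f x) (g w) \<le> dist (f x) (f y) + dist (g y) (g x) + dist (g x) (g w)"
            using dist_triangle[of "f x" "g w" "f y"] dist_triangle[of "g y" "g w" "g x"] fy by simp
          ultimately show ?thesis using s(2) by (simp add: dist_commute)
        qed
        then show ?thesis using s liso_in[OF g] by fastforce
      qed
      obtain e :: "complex \<Rightarrow> 'a" where e: "isom_on (ball 0 \<rho>) e" "e ` ball 0 \<rho> = X \<inter> ball (f x) \<rho>"
        using n unfolding normal_def by blast
      define F where "F u = inv_into (ball 0 \<rho>) e (f u)" for u
      define G where "G u = inv_into (ball 0 \<rho>) e (g u)" for u
      note F = isom_on_lift[OF e(1) fX[folded e(2)] i(1), folded F_def]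
      note G = isom_on_lift[OF e(1) gX[folded e(2)] i(2), folded G_def]
      have *: "F u = G u" if "u \<in> ball x s" for u
      proof (rule eqI[of x s F G "min s' s''" y u, OF F(1) G(1)])
        show "F u = G u" if "u \<in> ball y (min s' s'')" for u
          using that s'(2) by (simp add: F_def G_def)
      qed (use s' s'' that in auto)
      have "f u = g u" if "u \<in> ball x s" for u
        using *[OF that] F(3)[OF that] G(3)[OF that] by metis
      moreover obtain s3 where "s3 > 0" "ball z s3 \<subseteq> ball x s" using zz by (meson open_ball openE)
      ultimately show "Q z" unfolding Q_def by blast
    qed
    have "openin (top_of_set S) (ball x s)" using s(3) open_ball by (rule open_subset)
    moreover have "x \<in> ball x s" using s(1) by simp
    ultimately show "\<exists>T. openin (top_of_set S) T \<and> x \<in> T \<and> (\<forall>y\<in>T. \<forall>z\<in>T. Q y \<longrightarrow> Q z)"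
      using Qz by blast
  qed
  then show ?thesis unfolding Q_def by auto
qed

lemma liso_unique:
  fixes f g :: "complex \<Rightarrow> 'a"
  assumes "connected S" "open S" "liso S f" "liso S g"
    and "\<delta> > 0" "ball v \<delta> \<subseteq> S" "\<And>u. u \<in> ball v \<delta> \<Longrightarrow> f u = g u" and "z \<in> S"
  shows "f z = g z"
  by (rule liso_unique_aux[OF assms(1-4) _ assms(5-8)]) (rule isometry_plane_eqI)

lemma curve_unique:
  fixes f g :: "real \<Rightarrow> 'a"
  assumes "connected S" "open S" "liso S f" "liso S g"
    and "\<delta> > 0" "ball v \<delta> \<subseteq> S" "\<And>u. u \<in> ball v \<delta> \<Longrightarrow> f u = g u" and "z \<in> S"
  shows "f z = g z"
proof (rule liso_unique_aux[OF assms(1-4) _ assms(5-8)])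
  fix z r s y u :: real and F G :: "real \<Rightarrow> complex"
  assume F: "isom_on (ball z r) F" and G: "isom_on (ball z r) G"
    and s: "s > 0" "ball y s \<subseteq> ball z r" "\<And>u. u \<in> ball y s \<Longrightarrow> F u = G u" and u: "u \<in> ball z r"
  have r: "r > 0" using u by (metis ball_eq_empty empty_iff not_le)
  obtain v where v: "\<And>u. u \<in> ball z r \<Longrightarrow> F u = F z + of_real (u - z) * v"
    using isometry_line[OF F r] by blast
  obtain w where w: "\<And>u. u \<in> ball z r \<Longrightarrow> G u = G z + of_real (u - z) * w"
    using isometry_line[OF G r] by blast
  have b: "y \<in> ball y s" "y + s / 2 \<in> ball y s" using s by (auto simp: dist_norm)
  note b' = b[THEN subsetD[OF s(2)]]
  note e = b[THEN s(3)]
  have "F (y + s / 2) - F y = of_real (s / 2) * v" "G (y + s / 2) - G y = of_real (s / 2) * w"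
    unfolding v[OF b'(1)] v[OF b'(2)] w[OF b'(1)] w[OF b'(2)] by (simp_all add: algebra_simps)
  then have "of_real (s / 2) * v = of_real (s / 2) * w" using e by metis
  then have "v = w" using s(1) by simp
  then have "F z = G z" using v[OF b'(1)] w[OF b'(1)] e(1) by simp
  then show "F u = G u" using v[OF u] w[OF u] \<open>v = w\<close> by simp
qed

text \<open>Near the centre \<open>f\<close> agrees with an isometry of the full disc, and unique
  continuation spreads this. So the scale on which a local isometry is an isometry depends only on
  the point \<open>f z\<close>, which gives uniformity over families of maps.\<close>

lemma liso_normal:
  fixes f :: "complex \<Rightarrow> 'a"
  assumes f: "liso (ball z \<rho>) f" and n: "normal (f z) \<rho>"
  shows "isom_on (ball z \<rho>) f" "f ` ball z \<rho> = X \<inter> ball (f z) \<rho>"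
proof -
  have \<rho>: "\<rho> > 0" and nP: "X \<inter> ball (f z) \<rho> \<subseteq> X - P" using n by (auto simp: normal_def)
  then have "z \<in> ball z \<rho>" by simp
  then obtain e s where e: "isom_on (ball z \<rho>) e" "e ` ball z \<rho> = X \<inter> ball (f z) \<rho>"
    and s: "s > 0" "s \<le> \<rho>" "ball z s \<subseteq> ball z \<rho>" "\<And>u. u \<in> ball z s \<Longrightarrow> f u = e u"
    by (rule liso_germ[OF f open_ball _ n]) (rule that)
  have "liso (ball z \<rho>) e"
    unfolding liso_def using isom_on_imp_local_isometry_on[OF e(1)] e(2) nP by blast
  then have "f u = e u" if "u \<in> ball z \<rho>" for u
    by (rule liso_unique[OF connected_ball open_ball f _ s(1,3,4) that])
  then have "isom_on (ball z \<rho>) f \<longleftrightarrow> isom_on (ball z \<rho>) e" "f ` ball z \<rho> = e ` ball z \<rho>"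
    by (intro isom_on_cong image_cong; simp)+
  then show "isom_on (ball z \<rho>) f" "f ` ball z \<rho> = X \<inter> ball (f z) \<rho>"
    using e(1,2) by simp_all
qed

text \<open>A Lebesgue number argument on the compact set of points at distance at least
  \<open>\<kappa>\<close> from \<open>P\<close>. Covering by half radii leaves the other half for
  recentring.\<close>

lemma uniform_normal:
  assumes "\<kappa> > 0"
  obtains \<rho> where "\<rho> > 0" "\<And>x. x \<in> X \<Longrightarrow> (\<And>p. p \<in> P \<Longrightarrow> \<kappa> \<le> dist p x) \<Longrightarrow> normal x \<rho>"
proof -
  define K where "K = {x\<in>X. \<forall>p\<in>P. \<kappa> \<le> dist p x}"
  have "K = X \<inter> (\<Inter>p\<in>P. {x. \<kappa> \<le> dist p x})" by (auto simp: K_def)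
  moreover have "closed (\<Inter>p\<in>P. {x. \<kappa> \<le> dist p x})"
    by (intro closed_INT ballI closed_Collect_le continuous_intros)
  ultimately have K: "compact K" using compact_X by (simp add: compact_Int_closed)
  have "K \<subseteq> X - P" using assms by (force simp: K_def)
  then have "\<forall>x\<in>K. \<exists>r. normal x r" using normal_exists by (meson subsetD)
  then obtain r where r: "\<And>x. x \<in> K \<Longrightarrow> normal x (r x)" by metis
  then have rp: "\<And>x. x \<in> K \<Longrightarrow> r x > 0" by (simp add: normal_def)
  have "\<exists>\<rho>>0. \<forall>x\<in>K. normal x \<rho>"
  proof -
    have "K \<subseteq> (\<Union>x\<in>K. ball x (r x / 2))" using rp by force
    then obtain D where D: "D \<subseteq> K" "finite D" "K \<subseteq> (\<Union>x\<in>D. ball x (r x / 2))"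
      using compactE_image[OF K, of K "\<lambda>x. ball x (r x / 2)"] by auto
    \<comment> \<open>The element 1 keeps the minimum defined when the cover is empty.\<close>
    define \<rho> where "\<rho> = Min (insert 1 ((\<lambda>x. r x / 2) ` D))"
    have "\<rho> > 0" using D rp by (auto simp: \<rho>_def)
    moreover have "normal y \<rho>" if y: "y \<in> K" for y
    proof -
      obtain x where x: "x \<in> D" "y \<in> ball x (r x / 2)" using D(3) y by blast
      moreover have "\<rho> \<le> r x / 2" unfolding \<rho>_def using x D(2) by (intro Min_le) auto
      ultimately show ?thesis
        using \<open>\<rho> > 0\<close> y D(1) by (intro normal_moved[OF r[of x]]) (auto simp: K_def)
    qed
    ultimately show ?thesis by blast
  qed
  then show thesis using that by (auto simp: K_def)
qed

end


definition strip :: "real \<Rightarrow> real \<Rightarrow> complex set" where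
  "strip a b = {z. a < Im z \<and> Im z < b}"

abbreviation band :: "real \<Rightarrow> complex set" where
  "band \<epsilon> \<equiv> strip (-\<epsilon>) \<epsilon>"

lemma strip_Int: "strip a b = {z. Im z > a} \<inter> {z. Im z < b}"
  by (auto simp: strip_def)

lemma open_strip [simp]: "open (strip a b)"
  unfolding strip_Int by (intro open_Int open_halfspace_Im_gt open_halfspace_Im_lt)

lemma convex_strip [simp]: "convex (strip a b)"
  unfolding strip_Int by (intro convex_Int convex_halfspace_Im_gt convex_halfspace_Im_lt)

lemma strip_ball: "a + r \<le> Im z \<Longrightarrow> Im z + r \<le> b \<Longrightarrow> ball z r \<subseteq> strip a b"
proof
  fix w assume "a + r \<le> Im z" "Im z + r \<le> b" "w \<in> ball z r"
  then show "w \<in> strip a b"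
    using abs_Im_le_cmod[of "z - w"] by (auto simp: strip_def dist_norm)
qed

context flat_surface
begin

section \<open>Distance to the singular set\<close>

lemma closed_P: "closed P"
  using finite_P by (rule finite_imp_closed)

lemma compact_far_from_P:
  assumes "compact C" "C \<subseteq> X - P"
  obtains \<kappa> where "\<kappa> > 0" "\<And>x p. x \<in> C \<Longrightarrow> p \<in> P \<Longrightarrow> \<kappa> \<le> dist p x"
proof (cases "C = {}")
  case False
  then obtain x where x: "x \<in> C" "\<And>y. y \<in> C \<Longrightarrow> infdist x P \<le> infdist y P"
    using continuous_attains_inf[OF assms(1) _ continuous_on_infdist[OF continuous_on_id], of P] by blast
  have "infdist x P > 0"
    using x(1) assms(2) in_closed_iff_infdist_zero[OF closed_P P_nonempty, of x] infdist_nonneg[of x P]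
    by force
  moreover have "infdist x P \<le> dist p y" if "y \<in> C" "p \<in> P" for y p
    using x(2)[OF that(1)] infdist_le[OF that(2), of y] by (simp add: dist_commute)
  ultimately show thesis using that by blast
qed (use that[of 1] in auto)

text \<open>Compactness gives the limit along a subsequence, and the Lipschitz bound turns it into a
  limit with a rate. Used for the end of a geodesic and for the edge of a strip; the limit may lie
  in \<open>P\<close>.\<close>

lemma limit_at_end:
  fixes k :: "real \<Rightarrow> 'a"
  assumes "a < b" and kX: "\<And>s. a < s \<Longrightarrow> s < b \<Longrightarrow> k s \<in> X"
    and lip: "\<And>s s'. a < s \<Longrightarrow> s < b \<Longrightarrow> a < s' \<Longrightarrow> s' < b \<Longrightarrow> dist (k s) (k s') \<le> \<bar>s - s'\<bar>"
  obtains x where "x \<in> X" "\<And>s. a < s \<Longrightarrow> s < b \<Longrightarrow> dist (k s) x \<le> b - s"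
proof -
  define q where "q n = b - (b - a) / 2 * inverse (real (Suc n))" for n
  have q: "a < q n" "q n < b" for n
  proof -
    have "(b - a) / 2 * inverse (real (Suc n)) \<le> (b - a) / 2 * 1"
      using assms(1) by (intro mult_left_mono) (auto simp: inverse_eq_divide)
    then show "a < q n" unfolding q_def mult_1_right using assms(1) by argo
    show "q n < b" using assms(1) by (simp add: q_def)
  qed
  have "k (q n) \<in> X" for n using kX q by blast
  then obtain x r where x: "x \<in> X" "strict_mono (r :: nat \<Rightarrow> nat)" "((\<lambda>n. k (q n)) \<circ> r) \<longlonglongrightarrow> x"
    using compact_imp_seq_compact[OF compact_X] unfolding seq_compact_def by metis
  have "q \<longlonglongrightarrow> b - (b - a) / 2 * 0"
    unfolding q_def by (intro tendsto_intros LIMSEQ_inverse_real_of_nat)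
  then have qr: "(\<lambda>n. q (r n)) \<longlonglongrightarrow> b" using LIMSEQ_subseq_LIMSEQ[OF _ x(2), of q b] by (simp add: o_def)
  have "dist (k s) x \<le> b - s" if s: "a < s" "s < b" for s
  proof -
    have "(\<lambda>n. dist (k s) (k (q (r n)))) \<longlonglongrightarrow> dist (k s) x"
      using x(3) by (intro tendsto_intros) (simp add: o_def)
    moreover have "(\<lambda>n. \<bar>s - q (r n)\<bar>) \<longlonglongrightarrow> \<bar>s - b\<bar>" using qr by (intro tendsto_intros)
    ultimately have "dist (k s) x \<le> \<bar>s - b\<bar>" using lip[OF s q] by (meson LIMSEQ_le)
    then show ?thesis using s by simp
  qed
  then show thesis using that x(1) by blast
qed

text \<open>
  A curve of length less than \<open>r\<close> starting at \<open>h z\<close> is lifted through \<open>h\<close> step by step, and the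
  lift stays in the disc because it is not longer. So no such curve ends in \<open>P\<close>.
\<close>

lemma disc_far:
  fixes h :: "complex \<Rightarrow> 'a"
  assumes h: "liso (ball z r) h" and r: "r > 0" and p: "p \<in> P"
  shows "r \<le> dist p (h z)"
proof (rule ccontr)
  assume "\<not> r \<le> dist p (h z)"
  then have "ereal (dist (h z) p) < ereal r" by (simp add: dist_commute)
  moreover have "h z \<in> X" "p \<in> X" using liso_in[OF h, of z] r p P_subset by auto
  then have "ereal (dist (h z) p) = (INF g \<in> {g. path g \<and> path_image g \<subseteq> X \<and> pathstart g = h z \<and> pathfinish g = p}.
    curve_length g)"
    using intrinsic unfolding intrinsic_metric_def by blast
  ultimately have "(INF g \<in> {g. path g \<and> path_image g \<subseteq> X \<and> pathstart g = h z \<and> pathfinish g = p}.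
    curve_length g) < ereal r"
    by simp
  then obtain g where g: "path g" "path_image g \<subseteq> X" "pathstart g = h z" "pathfinish g = p"
    and gl: "curve_length g < ereal r"
    unfolding INF_less_iff by blast
  \<comment> \<open>A length bound strictly below \<open>r\<close> confines the lift to a compact
    disc, whose image has a positive distance from \<open>P\<close> and hence a uniform normal
    radius.\<close>
  obtain L :: real where L: "curve_length g < ereal L" "L < r"
    using ereal_dense2[OF gl] by auto
  have partition: "(\<Sum>i<length ts - 1. dist (g (ts ! i)) (g (ts ! Suc i))) < L"
    if "sorted ts" "set ts \<subseteq> {0..1}" for ts
  proof -
    have "ereal (\<Sum>i<length ts - 1. dist (g (ts ! i)) (g (ts ! Suc i))) \<le> curve_length g"
      unfolding curve_length_def using that by (intro SUP_upper) simp
    from order.strict_trans1[OF this L(1)] show ?thesis by (rule less_ereal.simps(1)[THEN iffD1])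
  qed
  have L0: "L > 0" using partition[of "[]"] by simp
  have Kr: "cball z L \<subseteq> ball z r" using L(2) by auto
  have "compact (h ` cball z L)"
    using h Kr unfolding liso_def
    by (intro compact_continuous_image continuous_on_subset[OF local_isometry_on_continuous]) auto
  moreover have "h ` cball z L \<subseteq> X - P" using liso_in[OF h] Kr by blast
  ultimately obtain \<kappa> where \<kappa>: "\<kappa> > 0" "\<And>x p. x \<in> h ` cball z L \<Longrightarrow> p \<in> P \<Longrightarrow> \<kappa> \<le> dist p x"
    using compact_far_from_P by blast
  obtain \<rho>0 where \<rho>0: "\<rho>0 > 0" "\<And>x. x \<in> X \<Longrightarrow> (\<And>p. p \<in> P \<Longrightarrow> \<kappa> \<le> dist p x) \<Longrightarrow> normal x \<rho>0"
    using uniform_normal[OF \<kappa>(1)] by blast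
  \<comment> \<open>The term \<open>r - L\<close> keeps discs of radius \<open>\<rho>\<close> about
    points of \<open>cball z L\<close> inside the domain of \<open>h\<close>.\<close>
  define \<rho> where "\<rho> = min \<rho>0 (r - L)"
  have \<rho>: "\<rho> > 0" "\<rho> \<le> \<rho>0" using \<rho>0(1) L(2) by (auto simp: \<rho>_def)
  have step: "isom_on (ball w \<rho>) h" "h ` ball w \<rho> = X \<inter> ball (h w) \<rho>" if w: "w \<in> cball z L" for w
  proof -
    have "h w \<in> X" using w Kr liso_in[OF h] by auto
    then have n: "normal (h w) \<rho>"
      using normal_smaller[OF \<rho>0(2) \<rho>] \<kappa>(2) w by blast
    have "ball w \<rho> \<subseteq> ball z r"
    proof
      fix v assume "v \<in> ball w \<rho>"
      then show "v \<in> ball z r" using w dist_triangle[of z v w] by (simp add: \<rho>_def)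
    qed
    then have "liso (ball w \<rho>) h" using liso_subset[OF h] by blast
    from liso_normal[OF this n] show "isom_on (ball w \<rho>) h" "h ` ball w \<rho> = X \<inter> ball (h w) \<rho>" .
  qed
  have "uniformly_continuous_on {0..1} g"
    using g(1) unfolding path_def by (intro compact_uniformly_continuous) auto
  then obtain \<delta> where \<delta>: "\<delta> > 0"
    "\<And>s t. s \<in> {0..1} \<Longrightarrow> t \<in> {0..1} \<Longrightarrow> dist t s < \<delta> \<Longrightarrow> dist (g t) (g s) < \<rho>"
    unfolding uniformly_continuous_on_def using \<rho>(1) by meson
  obtain n where "inverse (real (Suc n)) < \<delta>" using reals_Archimedean[OF \<delta>(1)] by blast
  define N where "N = Suc n"
  have N: "N > 0" "1 / real N < \<delta>"
    using \<open>inverse (real (Suc n)) < \<delta>\<close> by (simp_all add: N_def inverse_eq_divide)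
  define q where "q k = real k / real N" for k
  have q: "q k \<in> {0..1}" if "k \<le> N" for k using that N by (simp add: q_def)
  \<comment> \<open>The length of the inscribed polygon up to step \<open>k\<close>. Lifting
    preserves the length of each side, so \<open>\<sigma> k\<close> also bounds how far the lift has
    moved from \<open>z\<close>.\<close>
  define \<sigma> where "\<sigma> k = (\<Sum>i<k. dist (g (q i)) (g (q (Suc i))))" for k
  have "\<sigma> N < L"
  proof -
    define ts where "ts = map q [0..<Suc N]"
    have "sorted ts" unfolding ts_def sorted_map
      by (rule sorted_wrt_mono_rel[OF _ sorted_upt[of 0 "Suc N"]])
        (simp add: q_def divide_right_mono)
    moreover have "set ts \<subseteq> {0..1}" using q by (auto simp: ts_def)
    moreover have "(\<Sum>i<length ts - 1. dist (g (ts ! i)) (g (ts ! Suc i))) = \<sigma> N"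
      unfolding \<sigma>_def by (intro sum.cong) (auto simp: ts_def nth_append simp del: upt_Suc)
    ultimately show ?thesis using partition by metis
  qed
  moreover have "\<sigma> k \<le> \<sigma> N" if "k \<le> N" for k
    unfolding \<sigma>_def using that by (intro sum_mono2) auto
  ultimately have \<sigma>: "\<sigma> k \<le> L" if "k \<le> N" for k using that by fastforce
  have "\<exists>w. h w = g (q k) \<and> dist z w \<le> \<sigma> k" if "k \<le> N" for k
    using that
  proof (induction k)
    case 0
    then show ?case using g(3) by (intro exI[of _ z]) (simp add: q_def \<sigma>_def pathstart_def)
  next
    case (Suc k)
    then obtain w where w: "h w = g (q k)" "dist z w \<le> \<sigma> k" by auto
    then have wK: "w \<in> cball z L" using \<sigma>[of k] Suc.prems by simp
    have "dist (q (Suc k)) (q k) < \<delta>" using N by (simp add: q_def dist_real_def diff_divide_distrib[symmetric])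
    then have "dist (g (q (Suc k))) (g (q k)) < \<rho>" using \<delta>(2) q Suc.prems by simp
    moreover have "g (q (Suc k)) \<in> X" using g(2) q[OF Suc.prems] by (auto simp: path_image_def)
    ultimately have "g (q (Suc k)) \<in> h ` ball w \<rho>" using step(2)[OF wK] w(1) by (simp add: dist_commute)
    then obtain v where v: "v \<in> ball w \<rho>" "h v = g (q (Suc k))" by auto
    have "dist w v = dist (g (q k)) (g (q (Suc k)))"
      using isom_onD[OF step(1)[OF wK], of w v] v w(1) \<rho> by simp
    then have "dist z v \<le> \<sigma> (Suc k)"
      using dist_triangle[of z v w] w(2) by (simp add: \<sigma>_def)
    then show ?case using v(2) by blast
  qed
  from this[of N] obtain w where w: "h w = g 1" "dist z w \<le> \<sigma> N" using N by (auto simp: q_def)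
  then have "w \<in> cball z L" using \<sigma>[of N] by simp
  then have "h w \<notin> P" using Kr liso_in[OF h] by blast
  then show False using w(1) g(4) p by (simp add: pathfinish_def)
qed

section \<open>Gluing and prolonging local isometries\<close>

lemma liso_glue:
  fixes f :: "'i \<Rightarrow> complex \<Rightarrow> 'a"
  assumes "\<And>i. i \<in> I \<Longrightarrow> open (S i)" "\<And>i. i \<in> I \<Longrightarrow> liso (S i) (f i)"
    and agree: "\<And>i j z. i \<in> I \<Longrightarrow> j \<in> I \<Longrightarrow> z \<in> S i \<Longrightarrow> z \<in> S j \<Longrightarrow> f i z = f j z"
  obtains g where "liso (\<Union>i\<in>I. S i) g" "\<And>i z. i \<in> I \<Longrightarrow> z \<in> S i \<Longrightarrow> g z = f i z"
proof -
  define g where "g z = f (SOME i. i \<in> I \<and> z \<in> S i) z" for z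
  have g: "g z = f i z" if "i \<in> I" "z \<in> S i" for i z
  proof -
    have "(SOME i. i \<in> I \<and> z \<in> S i) \<in> I \<and> z \<in> S (SOME i. i \<in> I \<and> z \<in> S i)"
      using that by (intro someI[of "\<lambda>i. i \<in> I \<and> z \<in> S i" i]) simp
    then show ?thesis unfolding g_def using agree that by blast
  qed
  have "liso (\<Union>i\<in>I. S i) g"
  proof (rule liso_openI)
    show "open (\<Union>i\<in>I. S i)" using assms(1) by blast
  next
    fix z assume "z \<in> (\<Union>i\<in>I. S i)"
    then obtain i where i: "i \<in> I" "z \<in> S i" by blast
    show "g z \<in> X - P" using liso_in[OF assms(2)[OF i(1)] i(2)] g[OF i] by simp
    obtain s where s: "s > 0" "ball z s \<subseteq> S i" "isom_on (ball z s) (f i)"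
      using liso_ball[OF assms(2)[OF i(1)] assms(1)[OF i(1)] i(2)] .
    have "isom_on (ball z s) g \<longleftrightarrow> isom_on (ball z s) (f i)"
      using s(2) g[OF i(1)] by (intro isom_on_cong) blast
    then show "\<exists>s>0. isom_on (ball z s) g" using s by blast
  qed
  then show thesis using that g by blast
qed

text \<open>Convexity makes the intersection connected, so a common germ already forces agreement on
  all of it.\<close>

lemma liso_glue_convex:
  fixes f g :: "complex \<Rightarrow> 'a"
  assumes S: "open S" "convex S" "liso S f" and T: "open T" "convex T" "liso T g"
    and s: "s > 0" "ball v s \<subseteq> S" "ball v s \<subseteq> T" "\<And>u. u \<in> ball v s \<Longrightarrow> f u = g u"
  obtains h where "liso (S \<union> T) h" "\<And>z. z \<in> S \<Longrightarrow> h z = f z" "\<And>z. z \<in> T \<Longrightarrow> h z = g z"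
proof -
  have agree: "f z = g z" if "z \<in> S" "z \<in> T" for z
  proof (rule liso_unique[of "S \<inter> T" f g s v z])
    show "connected (S \<inter> T)" using S T by (intro convex_connected convex_Int)
    show "open (S \<inter> T)" using S T by blast
    show "liso (S \<inter> T) f" "liso (S \<inter> T) g" using S T liso_subset by blast+
  qed (use s that in auto)
  obtain h where h: "liso (\<Union>i\<in>UNIV. if i then S else T) h"
    "\<And>i z. i \<in> UNIV \<Longrightarrow> z \<in> (if i then S else T) \<Longrightarrow> h z = (if i then f else g) z"
    by (rule liso_glue[of UNIV "\<lambda>i. if i then S else T" "\<lambda>i. if i then f else g"])
      (use S T agree in \<open>auto split: if_splits\<close>)
  have "(\<Union>i\<in>UNIV. if i then S else T) = S \<union> T" by (auto split: if_splits)
  then show thesis using that[of h] h(1) h(2)[of True] h(2)[of False] by simp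
qed

text \<open>At each point of \<open>S\<close> the germ of \<open>h\<close> continues to the full
  normal disc. The point to check is that two such continuations agree where their discs overlap,
  possibly outside \<open>S\<close>.\<close>

lemma liso_extend:
  fixes h :: "complex \<Rightarrow> 'a"
  assumes S: "open S" "convex S" and h: "liso S h"
    and n: "\<And>z. z \<in> S \<Longrightarrow> normal (h z) \<rho>"
  obtains g where "liso (\<Union>z\<in>S. ball z \<rho>) g" "\<And>z. z \<in> S \<Longrightarrow> g z = h z"
proof -
  have "\<exists>e s. isom_on (ball z \<rho>) e \<and> e ` ball z \<rho> = X \<inter> ball (h z) \<rho> \<and> s > 0 \<and> s \<le> \<rho> \<and>
    ball z s \<subseteq> S \<and> (\<forall>u\<in>ball z s. h u = e u)" if z: "z \<in> S" for z
    by (rule liso_germ[OF h S(1) z n[OF z]]) blast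
  then obtain e s where e: "\<And>z. z \<in> S \<Longrightarrow> isom_on (ball z \<rho>) (e z) \<and>
    e z ` ball z \<rho> = X \<inter> ball (h z) \<rho> \<and> s z > 0 \<and> s z \<le> \<rho> \<and>
    ball z (s z) \<subseteq> S \<and> (\<forall>u\<in>ball z (s z). h u = e z u)"
    by metis
  have le: "liso (ball z \<rho>) (e z)" if z: "z \<in> S" for z
    using e[OF z] n[OF z] isom_on_imp_local_isometry_on unfolding liso_def normal_def by metis
  have eh: "e z u = h u" if z: "z \<in> S" and u: "u \<in> S" "u \<in> ball z \<rho>" for z u
  proof (rule liso_unique[of "S \<inter> ball z \<rho>" "e z" h "s z" z u])
    show "connected (S \<inter> ball z \<rho>)" using S by (intro convex_connected convex_Int) auto
    show "open (S \<inter> ball z \<rho>)" using S by blast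
    show "liso (S \<inter> ball z \<rho>) (e z)" "liso (S \<inter> ball z \<rho>) h" using le[OF z] h liso_subset by blast+
    show "ball z (s z) \<subseteq> S \<inter> ball z \<rho>" using e[OF z] by (simp add: subset_ball)
    show "s z > 0" using e[OF z] by blast
    show "e z u = h u" if "u \<in> ball z (s z)" for u using e[OF z] that by simp
  qed (use u in auto)
  obtain g where g: "liso (\<Union>z\<in>S. ball z \<rho>) g" "\<And>i z. i \<in> S \<Longrightarrow> z \<in> ball i \<rho> \<Longrightarrow> g z = e i z"
  proof (rule liso_glue[of S "\<lambda>z. ball z \<rho>" e])
    fix z w u assume z: "z \<in> S" and w: "w \<in> S" and u: "u \<in> ball z \<rho>" "u \<in> ball w \<rho>"
    \<comment> \<open>Overlapping discs have centres less than \<open>2 * \<rho>\<close> apart, so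
      the midpoint lies in both discs, and in \<open>S\<close> by convexity. Near it both
      continuations equal \<open>h\<close>, and the overlap is connected.\<close>
    define m where "m = midpoint z w"
    have mS: "m \<in> S"
      using S(2) z w unfolding m_def by (simp add: midpoint_def convex_alt convexD scaleR_right_distrib)
    have "dist z w < 2 * \<rho>" using u dist_triangle[of z w u] by (simp add: dist_commute)
    then have m: "m \<in> ball z \<rho> \<inter> ball w \<rho>"
      by (simp add: m_def dist_midpoint)
    have "open (S \<inter> ball z \<rho> \<inter> ball w \<rho>)" using S by blast
    then obtain d where d: "d > 0" "ball m d \<subseteq> S \<inter> ball z \<rho> \<inter> ball w \<rho>"
      using m mS by (meson IntI Int_iff openE)
    show "e z u = e w u"
    proof (rule liso_unique[of "ball z \<rho> \<inter> ball w \<rho>" "e z" "e w" d m u])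
      show "connected (ball z \<rho> \<inter> ball w \<rho>)" by (intro convex_connected convex_Int) auto
      show "liso (ball z \<rho> \<inter> ball w \<rho>) (e z)" "liso (ball z \<rho> \<inter> ball w \<rho>) (e w)"
        using le z w liso_subset by blast+
      show "e z v = e w v" if v: "v \<in> ball m d" for v
      proof -
        have "v \<in> S" "v \<in> ball z \<rho>" "v \<in> ball w \<rho>" using v d(2) by blast+
        then show ?thesis using eh[OF z] eh[OF w] by metis
      qed
    qed (use d u in auto)
  qed (use le in auto)
  moreover have "g z = h z" if z: "z \<in> S" for z
  proof -
    have "\<rho> > 0" using n[OF z] by (simp add: normal_def)
    then show ?thesis using g(2)[OF z, of z] eh[OF z z] by simp
  qed
  ultimately show thesis using that by blast
qed

lemma liso_union:
  fixes f :: "'i \<Rightarrow> complex \<Rightarrow> 'a"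
  assumes S: "\<And>i. i \<in> I \<Longrightarrow> open (S i)" "\<And>i. i \<in> I \<Longrightarrow> convex (S i)" "\<And>i. i \<in> I \<Longrightarrow> liso (S i) (f i)"
    and s: "s > 0" "\<And>i. i \<in> I \<Longrightarrow> ball v s \<subseteq> S i" "\<And>i u. i \<in> I \<Longrightarrow> u \<in> ball v s \<Longrightarrow> f i u = e u"
  obtains g where "liso (\<Union>i\<in>I. S i) g" "\<And>i z. i \<in> I \<Longrightarrow> z \<in> S i \<Longrightarrow> g z = f i z"
proof (rule liso_glue[of I S f])
  fix i j z assume i: "i \<in> I" and j: "j \<in> I" and z: "z \<in> S i" "z \<in> S j"
  show "f i z = f j z"
  proof (rule liso_unique[of "S i \<inter> S j" "f i" "f j" s v z])
    show "connected (S i \<inter> S j)" using S(2) i j by (intro convex_connected convex_Int)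
    show "open (S i \<inter> S j)" using S(1) i j by blast
    show "liso (S i \<inter> S j) (f i)" "liso (S i \<inter> S j) (f j)"
      using S(3)[OF i] S(3)[OF j] liso_subset by blast+
    show "ball v s \<subseteq> S i \<inter> S j" using s(2) i j by blast
    show "f i u = f j u" if "u \<in> ball v s" for u using s(3) i j that by metis
  qed (use s(1) z in auto)
qed (use S that in auto)

subsection \<open>Strips\<close>

lemma strip_width_bounded:
  obtains D where "\<And>a b g. liso (strip a b) g \<Longrightarrow> b - a \<le> D"
proof -
  obtain p where p: "p \<in> P" using P_nonempty by blast
  obtain D where D: "D > 0" "\<And>x. x \<in> X \<Longrightarrow> dist p x \<le> D"
    using compact_imp_bounded[OF compact_X] bounded_any_center[of X p]
    by (metis dual_order.trans gt_ex linorder_not_le nless_le order_le_less_trans)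
  have "b - a \<le> 2 * D" if g: "liso (strip a b) g" for a b and g :: "complex \<Rightarrow> 'a"
  proof (cases "a < b")
    case True
    define z where "z = Complex 0 ((a + b) / 2)"
    have "ball z ((b - a) / 2) \<subseteq> strip a b" by (rule strip_ball) (simp_all add: z_def field_simps)
    then have "(b - a) / 2 \<le> dist p (g z)"
      using True p by (intro disc_far liso_subset[OF g]) auto
    also have "\<dots> \<le> D" using True by (intro D(2) liso_in[OF g, THEN DiffD1]) (auto simp: z_def strip_def)
    finally show ?thesis by simp
  qed (use D in auto)
  then show thesis using that by blast
qed

text \<open>Distance from \<open>P\<close> near the upper edge, namely above \<open>c\<close>, gives
  a uniform normal radius there, and discs of this radius reach beyond the edge. A prolongation can
  therefore only be stopped by points approaching \<open>P\<close>.\<close>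

lemma strip_extend:
  assumes g: "liso (strip a b) g" and ab: "a \<le> c" "c < b" and \<kappa>: "\<kappa> > 0"
    "\<And>z p. c < Im z \<Longrightarrow> Im z < b \<Longrightarrow> p \<in> P \<Longrightarrow> \<kappa> \<le> dist p (g z)"
  obtains b' g' where "b' > b" "liso (strip a b') g'" "\<And>z. z \<in> strip a b \<Longrightarrow> g' z = g z"
proof -
  obtain \<rho> where \<rho>: "\<rho> > 0" "\<And>x. x \<in> X \<Longrightarrow> (\<And>p. p \<in> P \<Longrightarrow> \<kappa> \<le> dist p x) \<Longrightarrow> normal x \<rho>"
    using uniform_normal[OF \<kappa>(1)] by blast
  have sub: "strip c b \<subseteq> strip a b" using ab by (auto simp: strip_def)
  have "normal (g z) \<rho>" if "z \<in> strip c b" for z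
    using that liso_in[OF g] sub \<kappa>(2) by (intro \<rho>(2)) (auto simp: strip_def)
  then obtain h where h: "liso (\<Union>z\<in>strip c b. ball z \<rho>) h" "\<And>z. z \<in> strip c b \<Longrightarrow> h z = g z"
    using liso_extend[OF open_strip convex_strip liso_subset[OF g sub]] by blast
  have "strip c (b + \<rho> / 2) \<subseteq> (\<Union>z\<in>strip c b. ball z \<rho>)"
  proof
    fix w assume w: "w \<in> strip c (b + \<rho> / 2)"
    \<comment> \<open>A point vertically below \<open>w\<close>, within \<open>\<rho> / 4\<close> of
      the edge; the maximum with the middle height keeps it above \<open>c\<close>.\<close>
    define z where "z = Complex (Re w) (max ((c + b) / 2) (b - \<rho> / 4))"
    have "z \<in> strip c b" using ab \<rho> by (auto simp: z_def strip_def less_max_iff_disj)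
    moreover have "dist z w < \<rho>" if "Im w \<ge> b"
    proof -
      have "dist z w = \<bar>Im z - Im w\<bar>" by (simp add: z_def dist_norm cmod_def)
      also have "\<dots> < \<rho>"
      proof -
        have "b - \<rho> / 4 \<le> Im z" "Im z < b" using \<rho> ab by (auto simp: z_def)
        moreover have "Im w < b + \<rho> / 2" using w by (simp add: strip_def)
        ultimately show ?thesis using that \<rho>(1) by linarith
      qed
      finally show ?thesis .
    qed
    moreover have "w \<in> strip c b" if "Im w < b" using w that by (simp add: strip_def)
    ultimately have "\<exists>z\<in>strip c b. dist z w < \<rho>"
      using \<rho>(1) by (metis dist_self not_less)
    then show "w \<in> (\<Union>z\<in>strip c b. ball z \<rho>)" by simp
  qed
  then have h': "liso (strip c (b + \<rho> / 2)) h" using liso_subset[OF h(1)] by blast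
  define v where "v = Complex 0 ((c + b) / 2)"
  have vb: "ball v ((b - c) / 2) \<subseteq> strip c b" by (rule strip_ball) (simp_all add: v_def field_simps)
  have vb2: "strip c b \<subseteq> strip c (b + \<rho> / 2)" using \<rho> by (auto simp: strip_def)
  obtain f where f: "liso (strip a b \<union> strip c (b + \<rho> / 2)) f"
    "\<And>z. z \<in> strip a b \<Longrightarrow> f z = g z" "\<And>z. z \<in> strip c (b + \<rho> / 2) \<Longrightarrow> f z = h z"
    by (rule liso_glue_convex[OF open_strip convex_strip g open_strip convex_strip h',
          of "(b - c) / 2" v]) (use ab vb vb2 sub h(2) in auto)
  have "strip a b \<union> strip c (b + \<rho> / 2) = strip a (b + \<rho> / 2)"
    using ab \<rho>(1) by (auto simp: strip_def)
  then show thesis using that[of "b + \<rho> / 2" f] f(1,2) \<rho>(1) by simp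
qed

text \<open>The lower edge is held fixed: this concerns prolongations of \<open>g\<close> across the
  upper edge only, and maximality below is obtained by conjugation.\<close>

definition maximal_above :: "real \<Rightarrow> real \<Rightarrow> (complex \<Rightarrow> 'a) \<Rightarrow> bool" where
  "maximal_above a b g \<longleftrightarrow> (\<forall>b'>b. \<forall>g'. liso (strip a b') g' \<longrightarrow> (\<exists>z\<in>strip a b. g' z \<noteq> g z))"

text \<open>All prolongations of \<open>f\<close> share a germ, so they are compatible and their
  union is a prolongation. The supremum of the heights is attained because the strips are
  open.\<close>

lemma strip_maximal:
  assumes f: "liso (strip a b0) f" and ab: "a < b0"
  obtains b g where "b \<ge> b0" "liso (strip a b) g" "\<And>z. z \<in> strip a b0 \<Longrightarrow> g z = f z"
    "maximal_above a b g"
proof -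
  define B where "B = {b. b \<ge> b0 \<and> (\<exists>g. liso (strip a b) g \<and> (\<forall>z\<in>strip a b0. g z = f z))}"
  obtain D where D: "\<And>a b g. liso (strip a b) g \<Longrightarrow> b - a \<le> D" using strip_width_bounded by blast
  have bdd: "bdd_above B"
  proof (rule bdd_aboveI)
    fix b assume "b \<in> B"
    then show "b \<le> a + D" using D[of a b] by (force simp: B_def)
  qed
  have b0: "b0 \<in> B" using f by (auto simp: B_def)
  obtain F where F: "\<And>b. b \<in> B \<Longrightarrow> liso (strip a b) (F b)" "\<And>b z. b \<in> B \<Longrightarrow> z \<in> strip a b0 \<Longrightarrow> F b z = f z"
  proof -
    have "\<forall>b\<in>B. \<exists>g. liso (strip a b) g \<and> (\<forall>z\<in>strip a b0. g z = f z)" by (auto simp: B_def)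
    then show thesis using that by metis
  qed
  define v where "v = Complex 0 ((a + b0) / 2)"
  have vb: "ball v ((b0 - a) / 2) \<subseteq> strip a b0" by (rule strip_ball) (simp_all add: v_def field_simps)
  have sub: "strip a b0 \<subseteq> strip a b" if "b \<in> B" for b using that by (auto simp: B_def strip_def)
  obtain g where g: "liso (\<Union>b\<in>B. strip a b) g" "\<And>b z. b \<in> B \<Longrightarrow> z \<in> strip a b \<Longrightarrow> g z = F b z"
  proof (rule liso_union[where I = B and S = "strip a" and f = F and s = "(b0 - a) / 2" and v = v and e = f])
    show "ball v ((b0 - a) / 2) \<subseteq> strip a b" if "b \<in> B" for b using vb sub[OF that] by blast
    show "F b u = f u" if "b \<in> B" "u \<in> ball v ((b0 - a) / 2)" for b u
      using F(2) that vb by blast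
  qed (use ab F(1) in auto)
  have "(\<Union>b\<in>B. strip a b) = strip a (Sup B)"
    using b0 less_cSup_iff[OF _ bdd] by (auto simp: strip_def)
  with g have g1: "liso (strip a (Sup B)) g" by simp
  have g2: "g z = f z" if "z \<in> strip a b0" for z
    using g(2)[OF b0 that] F(2)[OF b0 that] by simp
  have "\<exists>z\<in>strip a (Sup B). g' z \<noteq> g z" if b': "b' > Sup B" "liso (strip a b') g'" for b' g'
  proof (rule ccontr)
    assume "\<not> (\<exists>z\<in>strip a (Sup B). g' z \<noteq> g z)"
    moreover have "b0 \<le> Sup B" using b0 bdd by (simp add: cSup_upper)
    ultimately have "g' z = f z" if "z \<in> strip a b0" for z
      using that g2[OF that] by (force simp: strip_def)
    then have "b' \<in> B" using b' \<open>b0 \<le> Sup B\<close> by (auto simp: B_def)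
    then show False using b' cSup_upper[OF _ bdd] by force
  qed
  then show thesis using that[of "Sup B" g] g1 g2 b0 bdd by (simp add: cSup_upper maximal_above_def)
qed

end


section \<open>Limits of local isometries\<close>

lemma strip_translate: "z + of_real x \<in> strip a b \<longleftrightarrow> z \<in> strip a b"
  by (simp add: strip_def)

text \<open>Tychonoff's theorem for countably many factors, in place of a diagonal argument.\<close>

lemma compact_sequences:
  fixes X :: "'a::metric_space set"
  assumes "compact X"
  shows "compact {f :: nat \<Rightarrow> 'a. \<forall>k. f k \<in> X}"
proof -
  have "{f :: nat \<Rightarrow> 'a. \<forall>k. f k \<in> X} = (\<Pi>\<^sub>E k\<in>UNIV. X)" by auto
  moreover have "compactin (product_topology (\<lambda>k::nat. euclidean) UNIV) (\<Pi>\<^sub>E k\<in>UNIV. X)"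
    using assms by (simp add: compactin_PiE)
  ultimately show ?thesis by (simp add: euclidean_product_topology)
qed

context flat_surface
begin

text \<open>
  The values of \<open>h n\<close> stay away from \<open>P\<close> because discs do, so that the normal radius at them is bounded
  below. Hence all \<open>h n\<close> are isometric on a common disc around each point.
\<close>

lemma liso_limit:
  fixes h :: "nat \<Rightarrow> complex \<Rightarrow> 'a"
  assumes S: "open S" and h: "\<And>n. liso (V n) (h n)"
    and near: "\<And>z. z \<in> S \<Longrightarrow> \<exists>\<kappa>>0. \<forall>\<^sub>F n in sequentially. ball z \<kappa> \<subseteq> V n"
  obtains r H where "strict_mono (r :: nat \<Rightarrow> nat)" "liso S H" "\<And>z. z \<in> S \<Longrightarrow> (\<lambda>n. h (r n) z) \<longlonglongrightarrow> H z"
proof -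
  have loc: "\<exists>\<rho>>0. \<exists>\<kappa>>0. ball z \<rho> \<subseteq> S \<and>
    (\<forall>\<^sub>F n in sequentially. ball z \<rho> \<subseteq> V n \<and> isom_on (ball z \<rho>) (h n) \<and> (\<forall>p\<in>P. \<kappa> \<le> dist p (h n z)))"
    if z: "z \<in> S" for z
  proof -
    obtain \<kappa> where \<kappa>: "\<kappa> > 0" "\<forall>\<^sub>F n in sequentially. ball z \<kappa> \<subseteq> V n" using near[OF z] by blast
    obtain \<rho>0 where \<rho>0: "\<rho>0 > 0" "\<And>x. x \<in> X \<Longrightarrow> (\<And>p. p \<in> P \<Longrightarrow> \<kappa> \<le> dist p x) \<Longrightarrow> normal x \<rho>0"
      using uniform_normal[OF \<kappa>(1)] by blast
    obtain d where d: "d > 0" "ball z d \<subseteq> S" using S z openE by blast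
    define \<rho> where "\<rho> = min (min \<kappa> \<rho>0) d"
    have \<rho>: "\<rho> > 0" "\<rho> \<le> \<rho>0" "\<rho> \<le> \<kappa>" "\<rho> \<le> d" using \<kappa> \<rho>0(1) d by (auto simp: \<rho>_def)
    have "ball z \<rho> \<subseteq> V n \<and> isom_on (ball z \<rho>) (h n) \<and> (\<forall>p\<in>P. \<kappa> \<le> dist p (h n z))"
      if V: "ball z \<kappa> \<subseteq> V n" for n
    proof -
      have l: "liso (ball z \<kappa>) (h n)" using liso_subset[OF h V] .
      have far: "\<kappa> \<le> dist p (h n z)" if "p \<in> P" for p using disc_far[OF l \<kappa>(1) that] .
      have "h n z \<in> X" using liso_in[OF l, of z] \<kappa>(1) by simp
      then have n: "normal (h n z) \<rho>" using normal_smaller[OF \<rho>0(2) \<rho>(1,2)] far by blast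
      have sub: "ball z \<rho> \<subseteq> ball z \<kappa>" using \<rho>(3) by (rule subset_ball)
      have "liso (ball z \<rho>) (h n)" using liso_subset[OF l sub] .
      then have "isom_on (ball z \<rho>) (h n)" using liso_normal(1) n by blast
      then show ?thesis using far sub V by blast
    qed
    then have "\<forall>\<^sub>F n in sequentially. ball z \<rho> \<subseteq> V n \<and> isom_on (ball z \<rho>) (h n) \<and> (\<forall>p\<in>P. \<kappa> \<le> dist p (h n z))"
      using \<kappa>(2) by (rule eventually_mono[rotated])
    moreover have "ball z \<rho> \<subseteq> S" using subset_ball[OF \<rho>(4), of z] d(2) by blast
    ultimately show ?thesis using \<rho>(1) \<kappa>(1) by blast
  qed
  obtain D :: "complex set" where D: "countable D" "\<And>U. open U \<Longrightarrow> U \<noteq> {} \<Longrightarrow> \<exists>d\<in>D. d \<in> U"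
    using countable_dense_setE by blast
  have Dne: "D \<noteq> {}" using D(2)[of UNIV] by blast
  define q where "q = from_nat_into D"
  have q: "range q = D" using Dne D(1) by (simp add: q_def range_from_nat_into)
  obtain x0 where x0: "x0 \<in> X" using P_nonempty P_subset by blast
  \<comment> \<open>The values of \<open>h n\<close> at a countable dense set form a point of a
    compact product. The default \<open>x0\<close> fills in where \<open>q k\<close> is outside the
    domain of \<open>h n\<close>; near a given point of \<open>S\<close> this happens for finitely
    many \<open>n\<close> only.\<close>
  define y where "y n k = (if q k \<in> V n then h n (q k) else x0)" for n k
  have "y n \<in> {f. \<forall>k. f k \<in> X}" for n
    using x0 liso_in[OF h] by (auto simp: y_def)
  then obtain l r where l: "strict_mono (r :: nat \<Rightarrow> nat)" "(y \<circ> r) \<longlonglongrightarrow> l"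
    using compact_imp_seq_compact[OF compact_sequences[OF compact_X]] unfolding seq_compact_def by metis
  have yl: "(\<lambda>n. y (r n) k) \<longlonglongrightarrow> l k" for k
    using continuous_on_tendsto_compose[OF continuous_on_product_coordinates[of k] l(2)]
    by (simp add: o_def)
  have ev: "\<forall>\<^sub>F n in sequentially. Q (r n)" if "\<forall>\<^sub>F n in sequentially. Q n" for Q
    using eventually_subseq[OF l(1)] that by (simp add: filterlim_subseq l(1) eventually_compose_filterlim)
  have "\<exists>L\<in>X. (\<lambda>n. h (r n) z) \<longlonglongrightarrow> L" if z: "z \<in> S" for z
  proof -
    obtain \<rho> \<kappa> where \<rho>: "\<rho> > 0" "ball z \<rho> \<subseteq> S"
      and e: "\<forall>\<^sub>F n in sequentially. ball z \<rho> \<subseteq> V n \<and> isom_on (ball z \<rho>) (h n) \<and> (\<forall>p\<in>P. \<kappa> \<le> dist p (h n z))"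
      using loc[OF z] by blast
    have inX: "\<forall>\<^sub>F n in sequentially. h (r n) z \<in> X"
      using ev[OF e]
    proof eventually_elim
      case (elim n)
      have "z \<in> ball z \<rho>" using \<rho>(1) by simp
      then have "z \<in> V (r n)" using elim by blast
      then show ?case using liso_in[OF h] by blast
    qed
    have "Cauchy (\<lambda>n. h (r n) z)"
      unfolding Cauchy_altdef2
    proof (intro allI impI)
      fix \<epsilon> :: real assume \<epsilon>: "\<epsilon> > 0"
      define \<delta> where "\<delta> = min \<rho> (\<epsilon> / 4)"
      have "\<delta> > 0" using \<rho> \<epsilon> by (simp add: \<delta>_def)
      then obtain d where "d \<in> D" "d \<in> ball z \<delta>" using D(2)[of "ball z \<delta>"] by auto
      \<comment> \<open>Convergence is known at the dense point \<open>q k\<close>. Since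
        \<open>h (r n)\<close> is eventually an isometry on a disc containing \<open>z\<close> and
        \<open>q k\<close>, it carries over to \<open>z\<close> up to the distance of the two
        points.\<close>
      then obtain k where k: "q k \<in> ball z \<delta>" using q by blast
      have "\<forall>\<^sub>F n in sequentially. dist (y (r n) k) (l k) < \<epsilon> / 4"
        using yl[of k] \<epsilon> by (intro tendstoD) auto
      then have "\<forall>\<^sub>F n in sequentially. dist (h (r n) z) (l k) < \<epsilon> / 2"
        using ev[OF e]
      proof eventually_elim
        case (elim n)
        have kb: "q k \<in> ball z \<rho>" "z \<in> ball z \<rho>" using k \<rho>(1) by (auto simp: \<delta>_def)
        then have "y (r n) k = h (r n) (q k)" using elim by (auto simp: y_def)
        moreover have "dist (h (r n) z) (h (r n) (q k)) = dist z (q k)"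
          using elim isom_onD[OF _ kb(2,1)] by blast
        moreover have "dist z (q k) < \<epsilon> / 4" using k by (simp add: \<delta>_def)
        ultimately show ?case using elim dist_triangle[of "h (r n) z" "l k" "y (r n) k"] by simp
      qed
      then obtain N where N: "\<And>n. n \<ge> N \<Longrightarrow> dist (h (r n) z) (l k) < \<epsilon> / 2"
        unfolding eventually_sequentially by blast
      have "dist (h (r n) z) (h (r N) z) < \<epsilon>" if "n \<ge> N" for n
        using N[OF that] N[of N] dist_triangle_half_l[of _ "l k" \<epsilon>] by (simp add: dist_commute)
      then show "\<exists>N. \<forall>n\<ge>N. dist (h (r n) z) (h (r N) z) < \<epsilon>" by blast
    qed
    moreover obtain N where N: "\<And>n. n \<ge> N \<Longrightarrow> h (r n) z \<in> X"
      using inX unfolding eventually_sequentially by blast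
    ultimately have C: "Cauchy (\<lambda>n. h (r (n + N)) z)" using Cauchy_subseq_Cauchy[of "\<lambda>n. h (r n) z" "\<lambda>n. n + N"]
      by (simp add: o_def strict_mono_def)
    have "complete X" using compact_X by (rule compact_imp_complete)
    then obtain L where "L \<in> X" "(\<lambda>n. h (r (n + N)) z) \<longlonglongrightarrow> L"
      using C N unfolding complete_def by (metis le_add2)
    then show ?thesis using LIMSEQ_offset[of "\<lambda>n. h (r n) z" N L] by blast
  qed
  then obtain H where H: "\<And>z. z \<in> S \<Longrightarrow> H z \<in> X" "\<And>z. z \<in> S \<Longrightarrow> (\<lambda>n. h (r n) z) \<longlonglongrightarrow> H z"
    by metis
  have "liso S H"
  proof (rule liso_openI[OF S])
    fix z assume z: "z \<in> S"
    obtain \<rho> \<kappa> where \<rho>: "\<rho> > 0" "ball z \<rho> \<subseteq> S" and \<kappa>: "\<kappa> > 0"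
      and e: "\<forall>\<^sub>F n in sequentially. ball z \<rho> \<subseteq> V n \<and> isom_on (ball z \<rho>) (h n) \<and> (\<forall>p\<in>P. \<kappa> \<le> dist p (h n z))"
      using loc[OF z] by blast
    have "\<kappa> \<le> dist p (H z)" if p: "p \<in> P" for p
    proof (rule tendsto_lowerbound)
      show "(\<lambda>n. dist p (h (r n) z)) \<longlonglongrightarrow> dist p (H z)" using H(2)[OF z] by (intro tendsto_intros)
      show "\<forall>\<^sub>F n in sequentially. \<kappa> \<le> dist p (h (r n) z)"
        using ev[OF e] by (rule eventually_mono) (use p in auto)
    qed simp
    then show "H z \<in> X - P" using \<kappa> H(1)[OF z] by force
    have "dist (H u) (H v) = dist u v" if uv: "u \<in> ball z \<rho>" "v \<in> ball z \<rho>" for u v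
    proof (rule LIMSEQ_unique)
      show "(\<lambda>n. dist (h (r n) u) (h (r n) v)) \<longlonglongrightarrow> dist (H u) (H v)"
        using H(2) uv \<rho>(2) by (intro tendsto_intros) auto
      have "\<forall>\<^sub>F n in sequentially. dist (h (r n) u) (h (r n) v) = dist u v"
        using ev[OF e] by (rule eventually_mono) (use uv isom_onD in blast)
      then show "(\<lambda>n. dist (h (r n) u) (h (r n) v)) \<longlonglongrightarrow> dist u v"
        by (rule tendsto_eventually)
    qed
    then show "\<exists>s>0. isom_on (ball z s) H" using \<rho>(1) unfolding isom_on_def by blast
  qed
  then show thesis using that l(1) H(2) by blast
qed

lemma liso_limit_fixed:
  fixes h :: "nat \<Rightarrow> complex \<Rightarrow> 'a"
  assumes S: "open S" and h: "\<And>n. liso S (h n)"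
  obtains r H where "strict_mono (r :: nat \<Rightarrow> nat)" "liso S H" "\<And>z. z \<in> S \<Longrightarrow> (\<lambda>n. h (r n) z) \<longlonglongrightarrow> H z"
proof -
  have "\<exists>\<kappa>>0. \<forall>\<^sub>F n in sequentially. ball z \<kappa> \<subseteq> S" if "z \<in> S" for z
    using that S openE by (metis always_eventually)
  then show thesis by (rule liso_limit[of S "\<lambda>_. S" h, OF S h]) (assumption, rule that)
qed

text \<open>A motion of the plane is controlled by its values at three points that are not
  collinear. The first controls the translation, the second the rotation, the third excludes a
  reflection. A finite test set is essential, since only pointwise closeness is available.\<close>

lemma liso_compare:
  fixes h :: "complex \<Rightarrow> 'a"
  assumes h: "liso S h" "open S" "0 \<in> S" and \<eta>: "\<eta> > 0"
  obtains F \<eta>' where "finite F" "F \<subseteq> S" "\<eta>' > 0"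
    "\<And>g. liso S g \<Longrightarrow> \<forall>u\<in>F. dist (g u) (h u) < \<eta>' \<Longrightarrow>
       \<exists>w a s. norm w < \<eta> \<and> norm a = 1 \<and> norm (a - 1) < \<eta> \<and> s > 0 \<and> ball 0 s \<subseteq> S \<and>
         (\<forall>u\<in>ball 0 s. w + a * u \<in> S \<and> g u = h (w + a * u))"
proof -
  obtain r0 where r0: "normal (h 0) r0" using normal_exists liso_in[OF h(1,3)] by blast
  obtain d where d: "d > 0" "ball 0 d \<subseteq> S" using h openE by blast
  define \<rho> where "\<rho> = min r0 d"
  have \<rho>: "\<rho> > 0" "\<rho> \<le> r0" "\<rho> \<le> d" using r0 d by (auto simp: \<rho>_def normal_def)
  have n: "normal (h 0) \<rho>" using normal_smaller[OF r0 \<rho>(1,2)] .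
  have \<rho>S: "ball 0 \<rho> \<subseteq> S" using subset_ball[OF \<rho>(3), of 0] d(2) by blast
  note hn = liso_normal[OF liso_subset[OF h(1) \<rho>S] n]
  define r where "r = \<rho> / 4"
  have r: "r > 0" using \<rho> by (simp add: r_def)
  define F where "F = {0, of_real r, \<i> * of_real r :: complex}"
  have Fb: "F \<subseteq> ball 0 (\<rho> / 2)" using \<rho> by (auto simp: F_def r_def norm_mult)
  have Fb': "F \<subseteq> ball 0 \<rho>" using Fb \<rho>(1) by (auto simp: F_def r_def norm_mult)
  \<comment> \<open>The bound \<open>r / 2\<close> excludes the reflection and keeps
    \<open>g\<close> inside the chart of \<open>h\<close>; \<open>\<eta>\<close> bounds the
    translation; \<open>\<eta> * r / 2\<close> bounds the rotation, because
    \<open>norm (a - 1) * r < 2 * \<eta>'\<close>.\<close>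
  define \<eta>' where "\<eta>' = min (r / 2) (min \<eta> (\<eta> * r / 2))"
  have \<eta>': "\<eta>' > 0" "\<eta>' \<le> r / 2" "\<eta>' \<le> \<eta>" "2 * \<eta>' \<le> \<eta> * r"
    using \<eta> r by (auto simp: \<eta>'_def min_def)
  have "\<exists>w a s. norm w < \<eta> \<and> norm a = 1 \<and> norm (a - 1) < \<eta> \<and> s > 0 \<and> ball 0 s \<subseteq> S \<and>
       (\<forall>u\<in>ball 0 s. w + a * u \<in> S \<and> g u = h (w + a * u))"
    if g: "liso S g" and close: "\<forall>u\<in>F. dist (g u) (h u) < \<eta>'" for g
  proof -
    have b2: "ball 0 (\<rho> / 2) \<subseteq> ball (0::complex) \<rho>" using \<rho>(1) by (intro subset_ball) simp
    have g0: "dist (h 0) (g 0) < \<eta>'" using close by (simp add: F_def dist_commute)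
    have "normal (g 0) (\<rho> / 2)"
    proof (rule normal_moved[OF n])
      show "g 0 \<in> X" using liso_in[OF g h(3)] by simp
      show "dist (h 0) (g 0) + \<rho> / 2 \<le> \<rho>" using g0 \<eta>'(2) r_def \<rho>(1) by simp
    qed (use \<rho>(1) in simp)
    note gn = liso_normal[OF liso_subset[OF g] this]
    have gi: "isom_on (ball 0 (\<rho> / 2)) g" "g ` ball 0 (\<rho> / 2) = X \<inter> ball (g 0) (\<rho> / 2)"
      using gn b2 \<rho>S by blast+
    have "ball (g 0) (\<rho> / 2) \<subseteq> ball (h 0) \<rho>"
    proof
      fix v assume "v \<in> ball (g 0) (\<rho> / 2)"
      then show "v \<in> ball (h 0) \<rho>"
        using g0 \<eta>'(2) \<rho>(1) dist_triangle[of "h 0" v "g 0"] by (simp add: r_def)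
    qed
    then have im: "g ` ball 0 (\<rho> / 2) \<subseteq> h ` ball 0 \<rho>" unfolding hn(2) gi(2) by blast
    define G where "G u = inv_into (ball 0 \<rho>) h (g u)" for u
    note G = isom_on_lift[OF hn(1) im gi(1), folded G_def]
    have Gc: "norm (G u - u) < \<eta>'" if u: "u \<in> F" for u
    proof -
      have "u \<in> ball 0 (\<rho> / 2)" "u \<in> ball 0 \<rho>" using u Fb Fb' by blast+
      then have "dist (G u) u = dist (g u) (h u)"
        using isom_onD[OF hn(1) G(2), of u u] G(3)[of u] by metis
      then show ?thesis using close u by (simp add: dist_norm)
    qed
    have G0: "norm (G 0) < \<eta>'" using Gc[of 0] by (simp add: F_def)
    obtain a where a: "norm a = 1" "(\<forall>u\<in>ball 0 (\<rho> / 2). G u = G 0 + a * (u - 0)) \<or>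
        (\<forall>u\<in>ball 0 (\<rho> / 2). G u = G 0 + a * cnj (u - 0))"
      by (rule isometry_plane[OF G(1)]) (use \<rho>(1) in \<open>simp, blast\<close>)
    have rF: "of_real r \<in> F" "\<i> * of_real r \<in> F" by (auto simp: F_def)
    note rb = subsetD[OF Fb rF(1)] subsetD[OF Fb rF(2)]
    from a(2) have "G (of_real r) = G 0 + a * of_real r"
    proof
      assume "\<forall>u\<in>ball 0 (\<rho> / 2). G u = G 0 + a * (u - 0)"
      from bspec[OF this rb(1)] show ?thesis by simp
    next
      assume "\<forall>u\<in>ball 0 (\<rho> / 2). G u = G 0 + a * cnj (u - 0)"
      from bspec[OF this rb(1)] show ?thesis by simp
    qed
    then have "norm (a * of_real r - of_real r) \<le> norm (G (of_real r) - of_real r) + norm (G 0)"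
      using norm_triangle_ineq4[of "G (of_real r) - of_real r" "G 0"] by (simp add: algebra_simps)
    also have "\<dots> < 2 * \<eta>'" using G0 Gc[OF rF(1)] by simp
    also have "norm (a * of_real r - of_real r) = norm (a - 1) * r"
      using r norm_mult[of "a - 1" "of_real r"] by (simp add: algebra_simps)
    finally have a1: "norm (a - 1) * r < 2 * \<eta>'" .
    then have "norm (a - 1) * r < \<eta> * r" using \<eta>'(4) by simp
    then have a\<eta>: "norm (a - 1) < \<eta>" using r by simp
    \<comment> \<open>A reflection close to the identity at \<open>\<i> * of_real r\<close> has
      \<open>a\<close> near \<open>-1\<close>, while closeness at \<open>of_real r\<close> puts
      \<open>a\<close> near 1. The two bounds add up to less than \<open>2 * r\<close>, against the
      triangle inequality.\<close>
    have "\<forall>u\<in>ball 0 (\<rho> / 2). G u = G 0 + a * u"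
    proof (rule ccontr)
      assume "\<not> ?thesis"
      then have "\<forall>u\<in>ball 0 (\<rho> / 2). G u = G 0 + a * cnj (u - 0)"
        using a(2) unfolding diff_zero by blast
      from bspec[OF this rb(2)] have "G (\<i> * of_real r) = G 0 + a * cnj (\<i> * of_real r)"
        unfolding diff_zero .
      then have "a * \<i> * of_real r + \<i> * of_real r = G 0 - (G (\<i> * of_real r) - \<i> * of_real r)" by simp
      then have "norm (a * \<i> * of_real r + \<i> * of_real r) \<le> norm (G (\<i> * of_real r) - \<i> * of_real r) + norm (G 0)"
        using norm_triangle_ineq4[of "G 0" "G (\<i> * of_real r) - \<i> * of_real r"] by (simp only: add.commute)
      also have "\<dots> < 2 * \<eta>'" using G0 Gc[OF rF(2)] by simp
      also have "norm (a * \<i> * of_real r + \<i> * of_real r) = norm (a + 1) * r"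
        using r norm_mult[of "a + 1" "\<i> * of_real r"] by (simp add: algebra_simps norm_mult)
      finally have "norm (a + 1) * r + norm (a - 1) * r < 4 * \<eta>'" using a1 by simp
      moreover have "2 \<le> norm (a + 1) + norm (a - 1)"
        using norm_triangle_ineq4[of "a + 1" "a - 1"] by simp
      then have "2 * r \<le> norm (a + 1) * r + norm (a - 1) * r"
        using r by (metis distrib_right mult_right_mono less_imp_le)
      ultimately show False using \<eta>'(2) by simp
    qed
    then have "G 0 + a * u \<in> S \<and> g u = h (G 0 + a * u)" if "u \<in> ball 0 (\<rho> / 2)" for u
      using G(2,3)[OF that] \<rho>S that by (metis subsetD)
    then show ?thesis using G0 \<eta>'(3) a(1) a\<eta> \<rho>(1) b2 \<rho>S
      by (intro exI[of _ "G 0"] exI[of _ a] exI[of _ "\<rho> / 2"]) auto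
  qed
  moreover have "F \<subseteq> S" using Fb' \<rho>S by blast
  ultimately show thesis using that[of F \<eta>'] \<eta>'(1) by (simp add: F_def)
qed

text \<open>The outcome of a family of crossing strips whose angles tend to 0; its failure for
  \<open>h\<close> is what forces nearby strips to be parallel. Convergence is demanded below height
  \<open>b\<close> only, as \<open>h\<close> is defined only there.\<close>

definition limit_extends :: "real \<Rightarrow> real \<Rightarrow> (complex \<Rightarrow> 'a) \<Rightarrow> bool" where
  "limit_extends \<epsilon> b h \<longleftrightarrow>
     (\<exists>(x :: nat \<Rightarrow> real) H. liso (strip (-\<epsilon>) (b + \<epsilon>)) H \<and>
        (\<forall>z\<in>strip (-\<epsilon>) b. (\<lambda>n. h (z + of_real (x n))) \<longlonglongrightarrow> H z))"

text \<open>
  A strip of half-width \<open>\<epsilon>\<close> that crosses the strip of \<open>h\<close> at a small angle prolongs \<open>h\<close> across its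
  upper boundary along a segment of length about \<open>\<epsilon>\<close> divided by the angle. Recentering at that segment
  and letting the angle tend to \<open>0\<close> gives a limit of translates of \<open>h\<close> on a higher strip.
\<close>

lemma tilted_strip:
  assumes \<epsilon>: "\<epsilon> > 0" and h: "liso (strip (-\<epsilon>) b) h" and noext: "\<not> limit_extends \<epsilon> b h"
  obtains \<eta> where "\<eta> > 0" "\<And>g w a s. liso (band \<epsilon>) g \<Longrightarrow> w \<in> strip (-\<epsilon>) b \<Longrightarrow> norm a = 1 \<Longrightarrow>
    norm (a - 1) < \<eta> \<Longrightarrow> s > 0 \<Longrightarrow> (\<And>u. u \<in> ball 0 s \<Longrightarrow> g u = h (w + a * u)) \<Longrightarrow> Im a = 0"
proof (rule ccontr)
  assume contra: "\<not> thesis"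
  have "\<exists>g w a s. liso (band \<epsilon>) g \<and> w \<in> strip (-\<epsilon>) b \<and> norm a = 1 \<and>
    norm (a - 1) < inverse (real (Suc n)) \<and> s > 0 \<and> (\<forall>u\<in>ball 0 s. g u = h (w + a * u)) \<and> Im a \<noteq> 0" for n
    using contra that[of "inverse (real (Suc n))"] by fastforce
  then obtain g w a s where gs: "\<And>n. liso (band \<epsilon>) (g n) \<and> w n \<in> strip (-\<epsilon>) b \<and> norm (a n) = 1 \<and>
    norm (a n - 1) < inverse (real (Suc n)) \<and> s n > 0 \<and> (\<forall>u\<in>ball 0 (s n). g n u = h (w n + a n * u)) \<and> Im (a n) \<noteq> 0"
    by metis
  \<comment> \<open>In the coordinates of \<open>h\<close> the crossing strip is \<open>T n\<close>,
    with axis through \<open>w n\<close> in direction \<open>a n\<close>. It meets the line at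
    height \<open>b\<close> at parameter \<open>t n\<close>, in a point with real part
    \<open>x n\<close>, which is taken as the new origin of abscissae.\<close>
  define t where "t n = (b - Im (w n)) / Im (a n)" for n
  define x where "x n = Re (w n + a n * of_real (t n))" for n
  define T where "T n = {z. cnj (a n) * (z - w n) \<in> band \<epsilon>}" for n
  have aa: "a n * cnj (a n) = 1" for n
    using complex_norm_square[of "a n"] gs[of n] by simp
  have c: "of_real (x n) + \<i> * of_real b = w n + a n * of_real (t n)" for n
    using gs[of n] by (simp add: complex_eq_iff x_def t_def)
  have opT: "open (T n)" for n
  proof -
    have "T n = (\<lambda>z. cnj (a n) * (z - w n)) -` band \<epsilon>" by (auto simp: T_def)
    then show ?thesis by (simp add: continuous_open_vimage continuous_intros)
  qed
  have cvT: "convex (T n)" for n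
    unfolding convex_alt
  proof (intro ballI allI impI)
    fix y z and u :: real assume y: "y \<in> T n" and z: "z \<in> T n" and u: "0 \<le> u \<and> u \<le> 1"
    have "cnj (a n) * ((1 - u) *\<^sub>R y + u *\<^sub>R z - w n) =
      (1 - u) *\<^sub>R (cnj (a n) * (y - w n)) + u *\<^sub>R (cnj (a n) * (z - w n))"
      by (simp add: scaleR_conv_of_real algebra_simps)
    then show "(1 - u) *\<^sub>R y + u *\<^sub>R z \<in> T n"
      using y z u convex_strip[of "-\<epsilon>" \<epsilon>] unfolding T_def convex_alt by simp
  qed
  have "\<exists>K. liso (strip (-\<epsilon>) b \<union> T n) K \<and> (\<forall>z\<in>strip (-\<epsilon>) b. K z = h z)" for n
  proof -
    define G where "G z = g n (cnj (a n) * (z - w n))" for z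
    have G: "liso (T n) G" unfolding G_def
      by (rule liso_compose[of "band \<epsilon>"]) (use gs[of n] isom_on_rotate(2) in \<open>auto simp: T_def\<close>)
    obtain d where d: "d > 0" "ball (w n) d \<subseteq> strip (-\<epsilon>) b" using gs[of n] open_strip openE by blast
    define s' where "s' = min d (min (s n) \<epsilon>)"
    have s': "s' > 0" "s' \<le> d" "s' \<le> s n" "s' \<le> \<epsilon>" using d \<epsilon> gs[of n] by (auto simp: s'_def)
    have u: "cnj (a n) * (z - w n) \<in> ball 0 s'" if "z \<in> ball (w n) s'" for z
      using that gs[of n] by (simp add: norm_mult dist_norm norm_minus_commute)
    have "ball (0::complex) s' \<subseteq> band \<epsilon>" by (rule strip_ball) (use s' in auto)
    then have sub: "ball (w n) s' \<subseteq> T n" using u unfolding T_def by blast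
    have eq: "h z = G z" if z: "z \<in> ball (w n) s'" for z
    proof -
      have "cnj (a n) * (z - w n) \<in> ball 0 (s n)" using u[OF z] s'(3) by simp
      moreover have "w n + a n * (cnj (a n) * (z - w n)) = z"
        using aa[of n] by (simp add: mult.assoc[symmetric])
      ultimately show ?thesis using gs[of n] unfolding G_def by metis
    qed
    show ?thesis
      by (rule liso_glue_convex[OF open_strip convex_strip h opT cvT G s'(1) _ sub eq])
        (use subset_ball[OF s'(2), of "w n"] d(2) in blast)+
  qed
  then obtain K where K: "\<And>n. liso (strip (-\<epsilon>) b \<union> T n) (K n)" "\<And>n z. z \<in> strip (-\<epsilon>) b \<Longrightarrow> K n z = h z"
    by metis
  define V where "V n = {z. z + of_real (x n) \<in> strip (-\<epsilon>) b \<union> T n}" for n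
  have V: "liso (V n) (\<lambda>z. K n (z + of_real (x n)))" for n
    by (rule liso_compose[OF K(1)[of n] isom_on_translate(1)]) (auto simp: V_def)
  \<comment> \<open>Below height \<open>b\<close> the strip of \<open>h\<close> covers the point for
    every \<open>n\<close>. From \<open>b\<close> upwards the recentred crossing strip does so
    eventually: its axis passes through \<open>\<i> * of_real b\<close> and its direction tends to
    the horizontal.\<close>
  have near: "\<exists>\<kappa>>0. \<forall>\<^sub>F n in sequentially. ball z \<kappa> \<subseteq> V n" if z: "z \<in> strip (-\<epsilon>) (b + \<epsilon>)" for z
  proof (cases "Im z < b")
    case True
    then have "z \<in> strip (-\<epsilon>) b" using z by (simp add: strip_def)
    then obtain d where d: "d > 0" "ball z d \<subseteq> strip (-\<epsilon>) b" using open_strip openE by blast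
    then have "ball z d \<subseteq> V n" for n unfolding V_def using strip_translate by blast
    then show ?thesis using d(1) by (intro exI[of _ d]) simp
  next
    case False
    \<comment> \<open>The room left below the top edge. One third of it goes to the radius of the
      disc and one third to the tilt, which displaces points at distance at most \<open>R\<close>
      from the centre of rotation by less than \<open>m / 3\<close>.\<close>
    define m where "m = \<epsilon> - (Im z - b)"
    have m: "m > 0" "m \<le> \<epsilon>" using z False by (auto simp: m_def strip_def)
    define R where "R = norm (z - \<i> * of_real b) + m / 3"
    have R: "R > 0" using m by (simp add: R_def add_nonneg_pos)
    have "\<forall>\<^sub>F n in sequentially. inverse (real (Suc n)) < m / 3 / R"
      using LIMSEQ_inverse_real_of_nat m R by (intro order_tendstoD) auto
    then have "\<forall>\<^sub>F n in sequentially. ball z (m / 3) \<subseteq> V n"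
    proof eventually_elim
      case (elim n)
      have aR: "norm (a n - 1) * R < m / 3"
      proof -
        have "norm (a n - 1) < m / 3 / R" using elim gs[of n] by auto
        then show ?thesis using R by (simp add: pos_less_divide_eq)
      qed
      show ?case
      proof
        fix y assume y: "y \<in> ball z (m / 3)"
        define v where "v = y - \<i> * of_real b"
        have yz: "norm (y - z) < m / 3" using y by (simp add: dist_norm norm_minus_commute)
        have "norm v \<le> norm (y - z) + norm (z - \<i> * of_real b)"
          unfolding v_def using norm_triangle_ineq[of "y - z" "z - \<i> * of_real b"] by simp
        then have vR: "norm v \<le> R" using yz by (simp add: R_def)
        have "\<bar>Im y - Im z\<bar> < m / 3" using yz abs_Im_le_cmod[of "y - z"] by simp
        moreover have "Im v = Im y - b" by (simp add: v_def)
        ultimately have v1: "Im v < \<epsilon> - m + m / 3" "- (m / 3) < Im v"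
          using False m_def by linarith+
        have "cnj (a n) * v - v = cnj (a n - 1) * v" by (simp add: algebra_simps)
        then have "norm (cnj (a n) * v - v) = norm (a n - 1) * norm v"
          by (metis complex_mod_cnj norm_mult)
        also have "\<dots> \<le> norm (a n - 1) * R" using vR by (simp add: mult_left_mono)
        finally have "\<bar>Im (cnj (a n) * v) - Im v\<bar> < m / 3"
          using aR abs_Im_le_cmod[of "cnj (a n) * v - v"] by simp
        then have v2: "\<bar>Im (cnj (a n) * v)\<bar> < \<epsilon>" using v1 m by linarith
        have "cnj (a n) * (y + of_real (x n) - w n) = cnj (a n) * v + (a n * cnj (a n)) * of_real (t n)"
        proof -
          have "y + of_real (x n) - w n = v + a n * of_real (t n)"
            using c[of n] by (simp add: v_def algebra_simps)
          then show ?thesis by (simp add: algebra_simps)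
        qed
        then have "Im (cnj (a n) * (y + of_real (x n) - w n)) = Im (cnj (a n) * v)" by (simp add: aa)
        then have "y + of_real (x n) \<in> T n" using v2 by (auto simp: T_def strip_def abs_less_iff)
        then show "y \<in> V n" by (simp add: V_def)
      qed
    qed
    then show ?thesis using m(1) by (intro exI[of _ "m / 3"]) simp
  qed
  obtain r H where r: "strict_mono (r :: nat \<Rightarrow> nat)" and H: "liso (strip (-\<epsilon>) (b + \<epsilon>)) H"
    "\<And>z. z \<in> strip (-\<epsilon>) (b + \<epsilon>) \<Longrightarrow> (\<lambda>n. K (r n) (z + of_real (x (r n)))) \<longlonglongrightarrow> H z"
    by (rule liso_limit[OF open_strip V near]) blast+
  have "(\<lambda>n. h (z + of_real ((x \<circ> r) n))) \<longlonglongrightarrow> H z" if z: "z \<in> strip (-\<epsilon>) b" for z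
  proof -
    have "z \<in> strip (-\<epsilon>) (b + \<epsilon>)" using z \<epsilon> by (simp add: strip_def)
    from H(2)[OF this] show ?thesis using K(2) z by (simp add: strip_translate)
  qed
  then have "limit_extends \<epsilon> b h" unfolding limit_extends_def using H(1) by blast
  then show False using noext by simp
qed

text \<open>Closeness at finitely many points gives a small rigid motion, and the absence of a
  higher limit makes its rotation real. Being close to 1 it equals 1, so only a translation remains.
  It may have a vertical part, hence the condition that \<open>w + z\<close> stays in the domain of
  \<open>h\<close>.\<close>

lemma strip_parallel:
  assumes \<epsilon>: "\<epsilon> > 0" "\<epsilon> \<le> b" and h: "liso (strip (-\<epsilon>) b) h" and noext: "\<not> limit_extends \<epsilon> b h"
    and \<eta>: "\<eta> > 0"
  obtains F \<eta>' where "finite F" "F \<subseteq> band \<epsilon>" "\<eta>' > 0"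
    "\<And>g. liso (band \<epsilon>) g \<Longrightarrow> \<forall>u\<in>F. dist (g u) (h u) < \<eta>' \<Longrightarrow>
       \<exists>w. norm w < \<eta> \<and> (\<forall>z\<in>band \<epsilon>. w + z \<in> strip (-\<epsilon>) b \<longrightarrow> g z = h (w + z))"
proof -
  obtain \<eta>0 where \<eta>0: "\<eta>0 > 0" "\<And>g w a s. liso (band \<epsilon>) g \<Longrightarrow> w \<in> strip (-\<epsilon>) b \<Longrightarrow> norm a = 1 \<Longrightarrow>
    norm (a - 1) < \<eta>0 \<Longrightarrow> s > 0 \<Longrightarrow> (\<And>u. u \<in> ball 0 s \<Longrightarrow> g u = h (w + a * u)) \<Longrightarrow> Im a = 0"
    by (rule tilted_strip[OF \<epsilon>(1) h noext]) blast
  have sub: "band \<epsilon> \<subseteq> strip (-\<epsilon>) b" using \<epsilon> by (auto simp: strip_def)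
  have 0: "0 \<in> band \<epsilon>" using \<epsilon> by (simp add: strip_def)
  \<comment> \<open>\<open>\<eta>\<close> bounds the translation, \<open>\<eta>0\<close> is the
    angle from which a tilt is excluded, and 1 separates the rotation from
    \<open>-1\<close>.\<close>
  define \<eta>1 where "\<eta>1 = min \<eta> (min \<eta>0 1)"
  have \<eta>1: "\<eta>1 > 0" "\<eta>1 \<le> \<eta>" "\<eta>1 \<le> \<eta>0" "\<eta>1 \<le> 1" using \<eta> \<eta>0(1) by (auto simp: \<eta>1_def)
  obtain F \<eta>' where F: "finite F" "F \<subseteq> band \<epsilon>" and \<eta>': "\<eta>' > 0"
    "\<And>g. liso (band \<epsilon>) g \<Longrightarrow> \<forall>u\<in>F. dist (g u) (h u) < \<eta>' \<Longrightarrow>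
       \<exists>w a s. norm w < \<eta>1 \<and> norm a = 1 \<and> norm (a - 1) < \<eta>1 \<and> s > 0 \<and> ball 0 s \<subseteq> band \<epsilon> \<and>
         (\<forall>u\<in>ball 0 s. w + a * u \<in> band \<epsilon> \<and> g u = h (w + a * u))"
    by (rule liso_compare[OF liso_subset[OF h sub] open_strip 0 \<eta>1(1)]) blast
  have "\<exists>w. norm w < \<eta> \<and> (\<forall>z\<in>band \<epsilon>. w + z \<in> strip (-\<epsilon>) b \<longrightarrow> g z = h (w + z))"
    if g: "liso (band \<epsilon>) g" and close: "\<forall>u\<in>F. dist (g u) (h u) < \<eta>'" for g
  proof -
    obtain w a s where w: "norm w < \<eta>1" and a: "norm a = 1" "norm (a - 1) < \<eta>1"
      and s: "s > 0" "ball 0 s \<subseteq> band \<epsilon>"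
      and eq: "\<forall>u\<in>ball 0 s. w + a * u \<in> band \<epsilon> \<and> g u = h (w + a * u)"
      using \<eta>'(2)[OF g close] by blast
    have "w + a * 0 \<in> band \<epsilon>" using eq s(1) by (metis centre_in_ball)
    then have "w \<in> strip (-\<epsilon>) b" using sub by auto
    then have Ima: "Im a = 0" using \<eta>0(2)[OF g _ a(1) _ s(1), of w] a(2) \<eta>1(3) eq by auto
    then have "\<bar>Re a\<bar> = 1" using a(1) by (simp add: cmod_def)
    moreover have "Re a \<noteq> -1" using a(2) \<eta>1(4) Ima by (auto simp: cmod_def)
    ultimately have "a = 1" using Ima by (simp add: complex_eq_iff abs_if split: if_splits)
    have "g z = h (w + z)" if z: "z \<in> band \<epsilon>" "w + z \<in> strip (-\<epsilon>) b" for z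
    proof (rule liso_unique[of "band \<epsilon> \<inter> strip (-\<epsilon> - Im w) (b - Im w)" g "\<lambda>z. h (w + z)" s 0 z])
      show "connected (band \<epsilon> \<inter> strip (-\<epsilon> - Im w) (b - Im w))"
        by (intro convex_connected convex_Int) auto
      show "open (band \<epsilon> \<inter> strip (-\<epsilon> - Im w) (b - Im w))" by (intro open_Int open_strip)
      show "liso (band \<epsilon> \<inter> strip (-\<epsilon> - Im w) (b - Im w)) g" using g liso_subset by blast
      have "liso (band \<epsilon> \<inter> strip (-\<epsilon> - Im w) (b - Im w)) (\<lambda>z. h (z + w))"
        by (rule liso_compose[OF h isom_on_translate(1)]) (auto simp: strip_def)
      then show "liso (band \<epsilon> \<inter> strip (-\<epsilon> - Im w) (b - Im w)) (\<lambda>z. h (w + z))"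
        by (simp add: add.commute)
      show "ball 0 s \<subseteq> band \<epsilon> \<inter> strip (-\<epsilon> - Im w) (b - Im w)"
      proof
        fix u assume u: "u \<in> ball (0::complex) s"
        then have "w + u \<in> band \<epsilon>" "u \<in> band \<epsilon>" using eq \<open>a = 1\<close> s(2) by auto
        then show "u \<in> band \<epsilon> \<inter> strip (-\<epsilon> - Im w) (b - Im w)"
          using \<epsilon> by (auto simp: strip_def)
      qed
      show "g u = h (w + u)" if "u \<in> ball 0 s" for u using eq that \<open>a = 1\<close> by simp
    qed (use s z in \<open>auto simp: strip_def\<close>)
    then show ?thesis using w \<eta>1(2) by (intro exI[of _ w]) auto
  qed
  then show thesis using that F \<eta>'(1) by blast
qed

section \<open>Strips that repeat under a translation\<close>

lemma strip_period:
  assumes f: "liso (strip a b) f" and s: "s > 0" "ball v s \<subseteq> strip a b"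
    "\<And>u. u \<in> ball v s \<Longrightarrow> f (u + of_real T) = f u" and z: "z \<in> strip a b"
  shows "f (z + of_real T) = f z"
proof (rule liso_unique[of "strip a b" "\<lambda>z. f (z + of_real T)" f s v z])
  show "liso (strip a b) (\<lambda>z. f (z + of_real T))"
    by (rule liso_compose[OF f isom_on_translate(1)]) (auto simp: strip_translate)
qed (use assms in \<open>auto intro: convex_connected\<close>)

lemma strip_period_extend:
  assumes g: "liso (strip a b) g" and \<epsilon>: "\<epsilon> > 0" "band \<epsilon> \<subseteq> strip a b"
    and gh: "\<And>z. z \<in> band \<epsilon> \<Longrightarrow> g z = h z"
    and per: "\<And>z. z \<in> band \<epsilon> \<Longrightarrow> h (z + of_real T) = h z" and z: "z \<in> strip a b"
  shows "g (z + of_real T) = g z"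
proof (rule strip_period[OF g \<epsilon>(1) _ _ z])
  have b0: "ball 0 \<epsilon> \<subseteq> band \<epsilon>" by (rule strip_ball) auto
  then show "ball 0 \<epsilon> \<subseteq> strip a b" using \<epsilon>(2) by blast
  fix u assume "u \<in> ball (0::complex) \<epsilon>"
  then have u: "u \<in> band \<epsilon>" using b0 by blast
  then have "u + of_real T \<in> band \<epsilon>" by (simp add: strip_translate)
  then show "g (u + of_real T) = g u" using gh per u by simp
qed

text \<open>\<open>f\<close> and its copy moved by \<open>T\<close> have a common germ near
  \<open>v + T\<close>, so they glue to a strip that is higher by \<open>Im T\<close>. This is how
  maximality excludes a vertical component in a return.\<close>

lemma strip_shift_up:
  assumes f: "liso (strip a b) f" and s: "s > 0" "ball v s \<subseteq> strip a b"
    "\<And>u. u \<in> ball v s \<Longrightarrow> u + T \<in> strip a b \<and> f (u + T) = f u" and T: "Im T > 0"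
  obtains b' g where "b' > b" "liso (strip a b') g" "\<And>z. z \<in> strip a b \<Longrightarrow> g z = f z"
proof -
  have g2: "liso (strip (a + Im T) (b + Im T)) (\<lambda>z. f (z - T))"
    by (rule liso_compose[OF f isom_on_translate(2)]) (auto simp: strip_def)
  have shifted: "u - T \<in> ball v s" if "u \<in> ball (v + T) s" for u
    using that by (simp add: dist_norm algebra_simps)
  have u1: "u \<in> strip a b" if "u \<in> ball (v + T) s" for u
    using s(3)[OF shifted[OF that]] by simp
  have u2: "u \<in> strip (a + Im T) (b + Im T)" if "u \<in> ball (v + T) s" for u
    using s(2) shifted[OF that] by (auto simp: strip_def)
  have u3: "f u = f (u - T)" if "u \<in> ball (v + T) s" for u
    using s(3)[OF shifted[OF that]] by simp
  obtain h where h: "liso (strip a b \<union> strip (a + Im T) (b + Im T)) h"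
    "\<And>z. z \<in> strip a b \<Longrightarrow> h z = f z" "\<And>z. z \<in> strip (a + Im T) (b + Im T) \<Longrightarrow> h z = f (z - T)"
    by (rule liso_glue_convex[OF open_strip convex_strip f open_strip convex_strip g2, of s "v + T"])
      (use s(1) u1 u2 u3 in auto)
  have "v + T \<in> strip a b" using u1[of "v + T"] s(1) by simp
  moreover have "v \<in> strip a b" using s(1,2) by auto
  ultimately have "strip a b \<union> strip (a + Im T) (b + Im T) = strip a (b + Im T)"
    using T by (auto simp: strip_def)
  then show thesis using that[of "b + Im T" h] h(1,2) T by simp
qed

text \<open>A return by a downward \<open>T\<close> is, read backwards, a return by the upward
  \<open>- T\<close>; so the prolongation is upwards in either case.\<close>

lemma strip_shift:
  assumes f: "liso (strip a b) f" and s: "s > 0" "ball v s \<subseteq> strip a b"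
    "\<And>u. u \<in> ball v s \<Longrightarrow> u + T \<in> strip a b \<and> f (u + T) = f u" and T: "Im T \<noteq> 0"
  obtains b' g where "b' > b" "liso (strip a b') g" "\<And>z. z \<in> strip a b \<Longrightarrow> g z = f z"
proof (cases "Im T > 0")
  case True
  then show thesis using strip_shift_up[OF f s] that by blast
next
  case False
  have shifted: "u - T \<in> ball v s" if "u \<in> ball (v + T) s" for u
    using that by (simp add: dist_norm algebra_simps)
  have "ball (v + T) s \<subseteq> strip a b"
    using s(3)[OF shifted] by auto
  moreover have "u + (- T) \<in> strip a b \<and> f (u + (- T)) = f u" if "u \<in> ball (v + T) s" for u
    using s(3)[OF shifted[OF that]] s(2) shifted[OF that] by auto
  moreover have "Im (- T) > 0" using False T by simp
  ultimately show thesis using strip_shift_up[OF f s(1), of "v + T" "- T"] that by metis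
qed

text \<open>On the band, \<open>f\<close> lies in the closure of the horizontal translates of
  \<open>g\<close> for pointwise convergence, that is, in the orbit closure. Since only the band is
  tested, the relation passes to every prolongation of \<open>f\<close>.\<close>

definition approximated :: "real \<Rightarrow> (complex \<Rightarrow> 'a) \<Rightarrow> (complex \<Rightarrow> 'a) \<Rightarrow> bool" where
  "approximated \<epsilon> g f \<longleftrightarrow> (\<forall>F. finite F \<longrightarrow> F \<subseteq> band \<epsilon> \<longrightarrow>
     (\<forall>\<eta>>0. \<exists>x::real. \<forall>z\<in>F. dist (g (z + of_real x)) (f z) < \<eta>))"

lemma approximated_trans:
  assumes gf: "approximated \<epsilon> g f" and fh: "approximated \<epsilon> f h"
  shows "approximated \<epsilon> g h"
  unfolding approximated_def
proof (intro allI impI)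
  fix F :: "complex set" and \<eta> :: real assume F: "finite F" "F \<subseteq> band \<epsilon>" and \<eta>: "0 < \<eta>"
  obtain x where x: "\<And>z. z \<in> F \<Longrightarrow> dist (f (z + of_real x)) (h z) < \<eta> / 2"
    using fh F \<eta> unfolding approximated_def by (metis half_gt_zero)
  define F' where "F' = (\<lambda>z. z + of_real x) ` F"
  have "finite F'" "F' \<subseteq> band \<epsilon>" using F by (auto simp: F'_def strip_def)
  then obtain y where y: "\<And>z. z \<in> F' \<Longrightarrow> dist (g (z + of_real y)) (f z) < \<eta> / 2"
    using gf \<eta> unfolding approximated_def by (metis half_gt_zero)
  have "dist (g (z + of_real (x + y))) (h z) < \<eta>" if z: "z \<in> F" for z
  proof -
    have "z + of_real x \<in> F'" using z by (simp add: F'_def)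
    then show ?thesis
      using y[of "z + of_real x"] x[OF z] dist_triangle_half_r[of "f (z + of_real x)"]
      by (simp add: dist_commute add.assoc dist_triangle_lt[of _ "f (z + of_real x)"])
  qed
  then show "\<exists>x. \<forall>z\<in>F. dist (g (z + of_real x)) (h z) < \<eta>" by blast
qed

lemma approximated_limit:
  assumes "\<And>z. z \<in> band \<epsilon> \<Longrightarrow> (\<lambda>n. g (z + of_real (x n))) \<longlonglongrightarrow> f z"
  shows "approximated \<epsilon> g f"
  unfolding approximated_def
proof (intro allI impI)
  fix F :: "complex set" and \<eta> :: real assume F: "finite F" "F \<subseteq> band \<epsilon>" and \<eta>: "0 < \<eta>"
  have "\<forall>\<^sub>F n in sequentially. \<forall>z\<in>F. dist (g (z + of_real (x n))) (f z) < \<eta>"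
  proof (rule eventually_ball_finite[OF F(1)], intro ballI)
    fix z assume "z \<in> F"
    then have "z \<in> band \<epsilon>" using F(2) by blast
    from tendstoD[OF assms[OF this] \<eta>]
    show "\<forall>\<^sub>F n in sequentially. dist (g (z + of_real (x n))) (f z) < \<eta>" .
  qed
  from eventually_happens'[OF sequentially_bot this]
  show "\<exists>x. \<forall>z\<in>F. dist (g (z + of_real x)) (f z) < \<eta>" by blast
qed

text \<open>
  Among the strips approximated by translates of \<open>g\<close>, one of nearly maximal height, prolonged as far
  as possible, returns close to itself. By near-maximality it returns parallel to itself, hence after
  a translation; a vertical component of the translation would prolong the strip.
  So this strip is periodic, and \<open>g\<close>, which comes close to it, is parallel to it.
\<close>

theorem strip_periodic:
  assumes \<epsilon>: "\<epsilon> > 0" and g: "liso (band \<epsilon>) g"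
  obtains T where "T > 0" "\<And>z. z \<in> band \<epsilon> \<Longrightarrow> g (z + of_real T) = g z"
proof -
  define B where "B = {b. \<epsilon> \<le> b \<and> (\<exists>f. liso (strip (-\<epsilon>) b) f \<and> approximated \<epsilon> g f)}"
  have "approximated \<epsilon> g g"
    using \<epsilon> by (auto simp: approximated_def intro!: exI[of _ 0])
  then have \<epsilon>B: "\<epsilon> \<in> B" using g by (auto simp: B_def)
  obtain D where D: "\<And>a b g. liso (strip a b) g \<Longrightarrow> b - a \<le> D" using strip_width_bounded by blast
  have bdd: "bdd_above B"
  proof (rule bdd_aboveI)
    fix b assume "b \<in> B"
    then show "b \<le> D - \<epsilon>" using D[of "-\<epsilon>" b] by (force simp: B_def)
  qed
  \<comment> \<open>The slack \<open>\<epsilon>\<close> is the height gained in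
    \<open>limit_extends\<close>: for any strip of the orbit closure with height at least
    \<open>b1\<close>, this gain would exceed the supremum.\<close>
  obtain b1 where b1: "b1 \<in> B" "Sup B - \<epsilon> < b1"
    using less_cSupD[of B "Sup B - \<epsilon>"] \<epsilon>B \<epsilon> by auto
  then obtain f1 where f1: "\<epsilon> \<le> b1" "liso (strip (-\<epsilon>) b1) f1" "approximated \<epsilon> g f1"
    by (auto simp: B_def)
  obtain b f where b: "b1 \<le> b" "liso (strip (-\<epsilon>) b) f" "\<And>z. z \<in> strip (-\<epsilon>) b1 \<Longrightarrow> f z = f1 z"
    and max: "maximal_above (-\<epsilon>) b f"
    by (rule strip_maximal[OF f1(2)]) (use f1(1) \<epsilon> in auto)
  have \<epsilon>b: "\<epsilon> \<le> b" using f1(1) b(1) by simp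
  have sub: "band \<epsilon> \<subseteq> strip (-\<epsilon>) b" "band \<epsilon> \<subseteq> strip (-\<epsilon>) b1"
    using \<epsilon>b f1(1) by (auto simp: strip_def)
  have gf: "approximated \<epsilon> g f"
    unfolding approximated_def
  proof (intro allI impI)
    fix F :: "complex set" and \<eta> :: real assume F: "finite F" "F \<subseteq> band \<epsilon>" "0 < \<eta>"
    then obtain x where "\<forall>z\<in>F. dist (g (z + of_real x)) (f1 z) < \<eta>"
      using f1(3) unfolding approximated_def by blast
    then show "\<exists>x. \<forall>z\<in>F. dist (g (z + of_real x)) (f z) < \<eta>" using b(3) sub F(2) by (metis subsetD)
  qed
  have noext: "\<not> limit_extends \<epsilon> b f'" if f': "approximated \<epsilon> g f'" for f'
  proof
    assume "limit_extends \<epsilon> b f'"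
    then obtain x :: "nat \<Rightarrow> real" and H where H: "liso (strip (-\<epsilon>) (b + \<epsilon>)) H"
      "\<And>z. z \<in> strip (-\<epsilon>) b \<Longrightarrow> (\<lambda>n. f' (z + of_real (x n))) \<longlonglongrightarrow> H z"
      unfolding limit_extends_def by blast
    have "approximated \<epsilon> f' H" using H(2) sub by (intro approximated_limit[where x = x]) blast
    then have "approximated \<epsilon> g H" using approximated_trans[OF f'] by blast
    then have "b + \<epsilon> \<in> B" using H(1) \<epsilon>b \<epsilon> by (auto simp: B_def)
    then have "b + \<epsilon> \<le> Sup B" using bdd by (rule cSup_upper)
    then show False using b1(2) b(1) by simp
  qed
  have trans: "liso (strip (-\<epsilon>) c) (\<lambda>z. k (z + of_real x))" if "liso (strip (-\<epsilon>) c) k" for c k x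
    by (rule liso_compose[OF that isom_on_translate(1)]) (auto simp: strip_translate)

  \<comment> \<open>Translating by integers keeps different returns at least 1 apart, so that their
    difference has a nonzero horizontal part. The limit \<open>f'\<close> is again in the orbit
    closure, hence nearby strips are parallel to it.\<close>
  obtain r f' where r: "strict_mono (r :: nat \<Rightarrow> nat)" and f': "liso (strip (-\<epsilon>) b) f'"
    "\<And>z. z \<in> strip (-\<epsilon>) b \<Longrightarrow> (\<lambda>n. f (z + of_real (real (r n)))) \<longlonglongrightarrow> f' z"
    by (rule liso_limit_fixed[where h = "\<lambda>n z. f (z + of_real (real n))", OF open_strip trans[OF b(2)]])
      (rule that)
  have "approximated \<epsilon> g f'"
  proof (rule approximated_trans[OF gf approximated_limit])
    fix z assume "z \<in> band \<epsilon>"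
    then show "(\<lambda>n. f (z + of_real (real (r n)))) \<longlonglongrightarrow> f' z" using f'(2) sub(1) by blast
  qed
  note noext' = noext[OF this]
  \<comment> \<open>The bound 1/8 keeps the two corrections \<open>w\<close> from cancelling the
    horizontal distance 1; \<open>\<epsilon> / 8\<close> keeps the discs in use inside the
    band.\<close>
  define \<eta> where "\<eta> = min (1 / 8) (\<epsilon> / 8)"
  have \<eta>: "\<eta> > 0" "\<eta> \<le> 1 / 8" "\<eta> \<le> \<epsilon> / 8" using \<epsilon> by (auto simp: \<eta>_def)
  obtain F \<eta>' where F: "finite F" "F \<subseteq> band \<epsilon>" and \<eta>': "\<eta>' > 0"
    "\<And>k. liso (band \<epsilon>) k \<Longrightarrow> (\<forall>u\<in>F. dist (k u) (f' u) < \<eta>') \<Longrightarrow>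
       (\<exists>w. norm w < \<eta> \<and> (\<forall>z\<in>band \<epsilon>. w + z \<in> strip (-\<epsilon>) b \<longrightarrow> k z = f' (w + z)))"
    by (rule strip_parallel[OF \<epsilon> \<epsilon>b f'(1) noext' \<eta>(1)]) blast
  have "\<forall>\<^sub>F n in sequentially. \<forall>u\<in>F. dist (f (u + of_real (real (r n)))) (f' u) < \<eta>'"
  proof (rule eventually_ball_finite[OF F(1)], intro ballI)
    fix u assume "u \<in> F"
    then have "u \<in> strip (-\<epsilon>) b" using F(2) sub(1) by blast
    from tendstoD[OF f'(2)[OF this] \<eta>'(1)]
    show "\<forall>\<^sub>F n in sequentially. dist (f (u + of_real (real (r n)))) (f' u) < \<eta>'" .
  qed
  then obtain N where N: "\<And>n u. n \<ge> N \<Longrightarrow> u \<in> F \<Longrightarrow> dist (f (u + of_real (real (r n)))) (f' u) < \<eta>'"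
    unfolding eventually_sequentially by blast
  have "\<exists>w. norm w < \<eta> \<and> (\<forall>u\<in>ball 0 \<eta>. u - w \<in> strip (-\<epsilon>) b \<and> f (u - w + of_real (real (r n))) = f' u)"
    if n: "n \<ge> N" for n
  proof -
    obtain w where w: "norm w < \<eta>"
      "\<And>z. z \<in> band \<epsilon> \<Longrightarrow> w + z \<in> strip (-\<epsilon>) b \<Longrightarrow> f (z + of_real (real (r n))) = f' (w + z)"
      using \<eta>'(2)[OF trans[OF liso_subset[OF b(2) sub(1)]]] N[OF n] by blast
    have "u - w \<in> strip (-\<epsilon>) b \<and> f (u - w + of_real (real (r n))) = f' u" if u: "u \<in> ball 0 \<eta>" for u
    proof -
      have "\<bar>Im u\<bar> < \<eta>" "\<bar>Im w\<bar> < \<eta>" using u w(1) abs_Im_le_cmod[of u] abs_Im_le_cmod[of w] by auto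
      then have "u - w \<in> band \<epsilon>" "u \<in> strip (-\<epsilon>) b"
        using \<eta>(3) \<epsilon> \<epsilon>b by (auto simp: strip_def)
      then show ?thesis using w(2)[of "u - w"] sub(1) by auto
    qed
    then show ?thesis using w(1) by blast
  qed
  then obtain w where w: "\<And>n. n \<ge> N \<Longrightarrow> norm (w n) < \<eta>"
    "\<And>n u. n \<ge> N \<Longrightarrow> u \<in> ball 0 \<eta> \<Longrightarrow> u - w n \<in> strip (-\<epsilon>) b"
    "\<And>n u. n \<ge> N \<Longrightarrow> u \<in> ball 0 \<eta> \<Longrightarrow> f (u - w n + of_real (real (r n))) = f' u"
    by metis
  \<comment> \<open>Two late translates of \<open>f\<close> both coincide with \<open>f'\<close>
    near 0 up to small shifts. Eliminating \<open>f'\<close> shows that \<open>f\<close> repeats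
    under the difference \<open>T\<close> of the two displacements.\<close>
  define M where "M = Suc N"
  have MN: "M \<ge> N" by (simp add: M_def)
  define T where "T = of_real (real (r M)) - w M - (of_real (real (r N)) - w N)"
  define v where "v = of_real (real (r N)) - w N"
  have rMN: "real (r M) \<ge> real (r N) + 1"
    using strict_monoD[OF r, of N M] by (simp add: M_def)
  have ReT: "Re T > 0"
    using rMN w(1)[OF MN] w(1)[of N] abs_Re_le_cmod[of "w M"] abs_Re_le_cmod[of "w N"] \<eta>(2)
    by (simp add: T_def)
  have vb: "u - v \<in> ball 0 \<eta>" if "u \<in> ball v \<eta>" for u
    using that by (simp add: dist_norm norm_minus_commute)
  have v1: "u \<in> strip (-\<epsilon>) b" if "u \<in> ball v \<eta>" for u
    using w(2)[OF _ vb[OF that], of N] by (auto simp: v_def strip_def)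
  have v2: "u + T \<in> strip (-\<epsilon>) b" if "u \<in> ball v \<eta>" for u
    using w(2)[OF MN vb[OF that]] by (auto simp: v_def T_def strip_def)
  have v3: "f (u + T) = f u" if "u \<in> ball v \<eta>" for u
    using w(3)[OF MN vb[OF that]] w(3)[OF _ vb[OF that], of N] by (simp add: v_def T_def algebra_simps)
  have vsub: "ball v \<eta> \<subseteq> strip (-\<epsilon>) b" using v1 by blast
  have "Im T = 0"
  proof (rule ccontr)
    assume "Im T \<noteq> 0"
    then obtain b' h where "b' > b" "liso (strip (-\<epsilon>) b') h" "\<And>z. z \<in> strip (-\<epsilon>) b \<Longrightarrow> h z = f z"
      using strip_shift[OF b(2) \<eta>(1) vsub, of T] v2 v3 by blast
    then show False using max unfolding maximal_above_def by blast
  qed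
  then have T: "T = of_real (Re T)" by (simp add: complex_eq_iff)
  have per: "f (z + of_real (Re T)) = f z" if "z \<in> strip (-\<epsilon>) b" for z
    by (rule strip_period[OF b(2) \<eta>(1) vsub _ that]) (use v3 T in simp)

  \<comment> \<open>The period now passes from \<open>f\<close> back to \<open>g\<close>: some
    translate of \<open>g\<close> is close to \<open>f\<close>, hence parallel to it, and so
    inherits the horizontal period on a small disc, from which it spreads.\<close>
  have "\<epsilon> / 2 > 0" using \<epsilon> by simp
  then obtain F \<eta>' where F: "finite F" "F \<subseteq> band \<epsilon>" and \<eta>': "\<eta>' > 0"
    "\<And>k. liso (band \<epsilon>) k \<Longrightarrow> (\<forall>u\<in>F. dist (k u) (f u) < \<eta>') \<Longrightarrow>
       (\<exists>w. norm w < \<epsilon> / 2 \<and> (\<forall>z\<in>band \<epsilon>. w + z \<in> strip (-\<epsilon>) b \<longrightarrow> k z = f (w + z)))"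
    by (rule strip_parallel[OF \<epsilon> \<epsilon>b b(2) noext[OF gf]]) blast
  obtain x where "\<forall>u\<in>F. dist (g (u + of_real x)) (f u) < \<eta>'"
    using gf F(1,2) \<eta>'(1) unfolding approximated_def by blast
  then obtain w where w: "norm w < \<epsilon> / 2"
    "\<And>z. z \<in> band \<epsilon> \<Longrightarrow> w + z \<in> strip (-\<epsilon>) b \<Longrightarrow> g (z + of_real x) = f (w + z)"
    using \<eta>'(2)[OF trans[OF g]] by blast
  have "g (z + of_real (Re T)) = g z" if z: "z \<in> band \<epsilon>" for z
  proof (rule strip_period[OF g _ _ _ z])
    show "\<epsilon> / 2 > 0" using \<epsilon> by simp
    show "ball (of_real x) (\<epsilon> / 2) \<subseteq> band \<epsilon>" by (rule strip_ball) (use \<epsilon> in auto)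
    fix u :: complex assume u: "u \<in> ball (of_real x) (\<epsilon> / 2)"
    define z where "z = u - of_real x"
    have "\<bar>Im z\<bar> < \<epsilon> / 2" "\<bar>Im w\<bar> < \<epsilon> / 2"
      using u w(1) abs_Im_le_cmod[of z] abs_Im_le_cmod[of w]
      by (auto simp: z_def dist_norm norm_minus_commute)
    then have zs: "z \<in> band \<epsilon>" "w + z \<in> strip (-\<epsilon>) b"
      using \<epsilon>b by (auto simp: strip_def)
    have "g (u + of_real (Re T)) = g ((z + of_real (Re T)) + of_real x)" by (simp add: z_def algebra_simps)
    also have "\<dots> = f (w + (z + of_real (Re T)))"
      using zs by (intro w(2)) (auto simp: strip_def)
    also have "\<dots> = f (w + z)" using per[OF zs(2)] by (simp add: add.assoc)
    also have "\<dots> = g (z + of_real x)" using w(2)[OF zs] by simp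
    also have "\<dots> = g u" by (simp add: z_def)
    finally show "g (u + of_real (Re T)) = g u" .
  qed
  then show thesis using that[of "Re T"] ReT by blast
qed

lemma strip_period_reduce:
  assumes T: "T > 0" and per: "\<And>z. z \<in> strip a b \<Longrightarrow> f (z + of_real T) = f z"
  obtains y where "y \<in> {0..T}" "\<And>z. z \<in> strip a b \<Longrightarrow> f (z + of_real x) = f (z + of_real y)"
proof -
  have pern: "f (z + of_real (real n * T)) = f z" if "z \<in> strip a b" for z n
  proof (induction n)
    case (Suc n)
    have "f (z + of_real (real (Suc n) * T)) = f ((z + of_real (real n * T)) + of_real T)"
      by (simp add: algebra_simps)
    also have "\<dots> = f (z + of_real (real n * T))"
      using that by (intro per) (simp only: strip_translate)
    finally show ?case using Suc by simp
  qed simp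
  have peri: "f (z + of_real (of_int k * T)) = f z" if z: "z \<in> strip a b" for z k
  proof (cases "k \<ge> 0")
    case True
    then show ?thesis using pern[OF z, of "nat k"] by simp
  next
    case False
    have "z + of_real (of_int k * T) \<in> strip a b" using z by (simp only: strip_translate)
    from pern[OF this, of "nat (-k)"] False show ?thesis by simp
  qed
  define y where "y = x - of_int \<lfloor>x / T\<rfloor> * T"
  have "of_int \<lfloor>x / T\<rfloor> * T \<le> x / T * T"
    using T by (intro mult_right_mono) auto
  moreover have "x / T * T \<le> (of_int \<lfloor>x / T\<rfloor> + 1) * T"
    using T by (intro mult_right_mono) linarith+
  ultimately have "y \<in> {0..T}" using T by (simp add: y_def algebra_simps)
  moreover have "f (z + of_real x) = f (z + of_real y)" if "z \<in> strip a b" for z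
  proof -
    have "z + of_real y \<in> strip a b" using that by (simp only: strip_translate)
    from peri[OF this, of "\<lfloor>x / T\<rfloor>"] show ?thesis by (simp add: y_def)
  qed
  ultimately show thesis using that by blast
qed

text \<open>The translates of a periodic strip form a circle, so a limit of them is again a
  translate of \<open>f\<close>. A prolongation of the limit would then prolong \<open>f\<close>
  itself. This replaces near-maximality in the proof of finiteness.\<close>

lemma periodic_not_limit_extends:
  assumes \<epsilon>: "\<epsilon> > 0" and f: "liso (strip (-\<epsilon>) b) f" and T: "T > 0"
    and per: "\<And>z. z \<in> strip (-\<epsilon>) b \<Longrightarrow> f (z + of_real T) = f z"
    and max: "maximal_above (-\<epsilon>) b f"
  shows "\<not> limit_extends \<epsilon> b f"
proof
  assume "limit_extends \<epsilon> b f"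
  then obtain x :: "nat \<Rightarrow> real" and H where H: "liso (strip (-\<epsilon>) (b + \<epsilon>)) H"
    "\<And>z. z \<in> strip (-\<epsilon>) b \<Longrightarrow> (\<lambda>n. f (z + of_real (x n))) \<longlonglongrightarrow> H z"
    unfolding limit_extends_def by blast
  have "\<exists>y\<in>{0..T}. \<forall>z\<in>strip (-\<epsilon>) b. f (z + of_real (x n)) = f (z + of_real y)" for n
    by (rule strip_period_reduce[OF T, of "-\<epsilon>" b f "x n"]) (use per in blast)+
  then obtain y where y: "\<And>n. y n \<in> {0..T}"
    and fy: "\<And>n z. z \<in> strip (-\<epsilon>) b \<Longrightarrow> f (z + of_real (x n)) = f (z + of_real (y n))"
    by metis
  obtain l r where l: "strict_mono (r :: nat \<Rightarrow> nat)" "(y \<circ> r) \<longlonglongrightarrow> l"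
    using compact_imp_seq_compact[OF compact_Icc[of 0 T]] y unfolding seq_compact_def by metis
  have "H z = f (z + of_real l)" if z: "z \<in> strip (-\<epsilon>) b" for z
  proof (rule LIMSEQ_unique)
    show "(\<lambda>n. f (z + of_real (x (r n)))) \<longlonglongrightarrow> H z"
      using LIMSEQ_subseq_LIMSEQ[OF H(2)[OF z] l(1)] by (simp add: o_def)
    have "(\<lambda>n. z + complex_of_real (y (r n))) \<longlonglongrightarrow> z + of_real l"
      using l(2) by (intro tendsto_intros) (simp add: o_def)
    moreover have "isCont f (z + of_real l)"
      using f z local_isometry_on_continuous[of "strip (-\<epsilon>) b" f] unfolding liso_def
      by (simp add: continuous_on_eq_continuous_at strip_translate)
    ultimately show "(\<lambda>n. f (z + of_real (x (r n)))) \<longlonglongrightarrow> f (z + of_real l)"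
      using isCont_tendsto_compose fy[OF z] by fastforce
  qed
  then have Hf: "H (z - of_real l) = f z" if "z \<in> strip (-\<epsilon>) b" for z
    using that by (simp add: strip_def)
  have "liso (strip (-\<epsilon>) (b + \<epsilon>)) (\<lambda>z. H (z - of_real l))"
    by (rule liso_compose[OF H(1) isom_on_translate(2)]) (auto simp: strip_def)
  from max[unfolded maximal_above_def, rule_format, OF _ this] show False using \<epsilon> Hf by auto
qed

end


section \<open>Geodesics\<close>

lemma geodesic_curve_reflect:
  assumes "geodesic_curve X P J \<gamma>"
  shows "geodesic_curve X P (uminus ` J) (\<lambda>t. \<gamma> (- t))"
proof -
  have J: "is_interval J" "interior J \<noteq> {}" "continuous_on J \<gamma>" "\<gamma> ` J \<subseteq> X"
    "\<gamma> ` interior J \<subseteq> X - P" "local_isometry_on (interior J) \<gamma>"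
    using assms by (auto simp: geodesic_curve_def)
  have int: "interior (uminus ` J) = uminus ` interior J" by (rule interior_negations)
  have "continuous_on (uminus ` J) (\<lambda>t. \<gamma> (- t))"
    by (rule continuous_on_compose2[OF J(3)]) (auto intro: continuous_intros)
  moreover have "local_isometry_on (uminus ` interior J) (\<lambda>t. \<gamma> (- t))"
    by (rule local_isometry_on_compose[OF J(6)]) (auto simp: isom_on_def dist_real_def)
  moreover have "is_interval (uminus ` J)" using J(1) by simp
  ultimately show ?thesis using J int by (auto simp: geodesic_curve_def)
qed

text \<open>Time reversal reduces the lower end of the domain to the upper one.\<close>

lemma geodesic_reflect:
  assumes "geodesic X P J \<gamma>"
  shows "geodesic X P (uminus ` J) (\<lambda>t. \<gamma> (- t))"
  unfolding geodesic_def
proof (intro conjI allI impI)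
  show "geodesic_curve X P (uminus ` J) (\<lambda>t. \<gamma> (- t))"
    using assms geodesic_curve_reflect by (auto simp: geodesic_def)
next
  fix J' \<gamma>'
  assume *: "geodesic_curve X P J' \<gamma>' \<and> uminus ` J \<subseteq> J' \<and> (\<forall>t\<in>uminus ` J. \<gamma>' t = \<gamma> (- t))"
  have "J \<subseteq> uminus ` J'"
  proof
    fix t assume "t \<in> J"
    then have "- t \<in> J'" using * by blast
    then show "t \<in> uminus ` J'" by (metis image_eqI minus_minus)
  qed
  moreover have "\<forall>t\<in>J. \<gamma>' (- t) = \<gamma> t" using * by auto
  ultimately have "uminus ` J' = J"
    using assms geodesic_curve_reflect[of X P J' \<gamma>'] * unfolding geodesic_def by blast
  then show "J' = uminus ` J" by (auto simp: image_image)
qed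

context flat_surface
begin

text \<open>Off \<open>P\<close> a geodesic can always be continued past a finite upper end
  \<open>b\<close>, against maximality. If \<open>b\<close> is missing from \<open>J\<close>, the
  limit point is added; if it is present, a flat chart at the end continues the curve.\<close>

lemma geodesic_bdd_above_hits:
  assumes g: "geodesic X P J \<gamma>" and bdd: "bdd_above J"
  shows "\<gamma> ` J \<inter> P \<noteq> {}"
proof
  assume no: "\<gamma> ` J \<inter> P = {}"
  have J: "is_interval J" "interior J \<noteq> {}" "continuous_on J \<gamma>" "\<gamma> ` J \<subseteq> X"
    "\<gamma> ` interior J \<subseteq> X - P" "local_isometry_on (interior J) \<gamma>"
    using g by (auto simp: geodesic_def geodesic_curve_def)
  have max: "J' = J" if "geodesic_curve X P J' \<gamma>'" "J \<subseteq> J'" "\<And>t. t \<in> J \<Longrightarrow> \<gamma>' t = \<gamma> t" for J' \<gamma>'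
    using g that unfolding geodesic_def by blast
  have l: "liso (interior J) \<gamma>" using J by (auto simp: liso_def)
  have cvJ: "convex (interior J)" using J(1) by (intro convex_interior is_interval_convex)
  have Jne: "J \<noteq> {}" using J(2) interior_subset by blast
  define b where "b = Sup J"
  have bJ: "t \<le> b" if "t \<in> J" for t using that bdd by (simp add: b_def cSup_upper)
  obtain t0 where t0: "t0 \<in> interior J" using J(2) by blast
  have t0b: "t0 < b"
  proof -
    obtain e where "e > 0" "ball t0 e \<subseteq> J" using t0 by (meson mem_interior)
    then have "t0 + e / 2 \<in> J" by (auto simp: dist_real_def subset_iff)
    then show ?thesis using bJ[of "t0 + e / 2"] \<open>e > 0\<close> by simp
  qed
  have inJ: "{t0..<b} \<subseteq> interior J"
  proof -
    have 1: "{t0..<b} \<subseteq> J"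
    proof
      fix t assume t: "t \<in> {t0..<b}"
      then obtain j where j: "j \<in> J" "t < j" using less_cSupD[OF Jne, of t] by (auto simp: b_def)
      have "t0 \<in> J" using t0 interior_subset by blast
      from J(1)[unfolded is_interval_1, rule_format, OF this j(1)] show "t \<in> J" using t j(2) by auto
    qed
    then have sub: "{t0<..<b} \<subseteq> interior J" by (intro interior_maximal) auto
    show ?thesis
    proof
      fix t assume "t \<in> {t0..<b}"
      then show "t \<in> interior J" using t0 subsetD[OF sub, of t] by (cases "t = t0") auto
    qed
  qed
  have inJ': "t \<in> J" if "t0 \<le> t" "t < b" for t
  proof -
    have "t \<in> {t0..<b}" using that by simp
    then show ?thesis using inJ interior_subset by blast
  qed
  show False
  proof (cases "b \<in> J")
    case False
    then have lt: "t < b" if "t \<in> J" for t using bJ[OF that] that by (metis order_less_le)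
    have lip: "dist (\<gamma> s) (\<gamma> t) \<le> \<bar>s - t\<bar>" if "t0 < s" "s < b" "t0 < t" "t < b" for s t
      using local_isometry_on_lipschitz[OF J(6) cvJ, of s t] subsetD[OF inJ] that by (simp add: dist_real_def)
    obtain x where x: "x \<in> X" and dx: "\<And>t. t0 < t \<Longrightarrow> t < b \<Longrightarrow> dist (\<gamma> t) x \<le> b - t"
      by (rule limit_at_end[OF t0b, of \<gamma>]) (use inJ' J(4) lip in auto)
    \<comment> \<open>The added point may lie in \<open>P\<close>. This is permitted for an
      endpoint, as the conditions on the flat part concern the interior, which does not
      change.\<close>
    define \<gamma>' where "\<gamma>' t = (if t = b then x else \<gamma> t)" for t
    define J' where "J' = insert b J"
    have int: "interior J' = interior J"
    proof
      have "interior J' \<subseteq> J"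
      proof
        fix t assume t: "t \<in> interior J'"
        then obtain e where "e > 0" "ball t e \<subseteq> J'" by (meson mem_interior)
        then have "t + e / 2 \<in> J'" by (auto simp: dist_real_def subset_iff)
        then have "t + e / 2 \<le> b" using bJ by (auto simp: J'_def)
        then show "t \<in> J" using t interior_subset[of J'] \<open>e > 0\<close> by (auto simp: J'_def)
      qed
      then show "interior J' \<subseteq> interior J" by (simp add: interior_maximal)
      show "interior J \<subseteq> interior J'" by (rule interior_mono) (auto simp: J'_def)
    qed
    have eq: "\<gamma>' t = \<gamma> t" if "t \<in> J" for t using that False by (auto simp: \<gamma>'_def)
    have eqi: "\<gamma>' t = \<gamma> t" if "t \<in> interior J" for t using that interior_subset[of J] eq by blast
    have un: "J' = J \<union> {t0<..b}" 
    proof (intro equalityI subsetI)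
      fix t assume "t \<in> J \<union> {t0<..b}"
      then show "t \<in> J'" using inJ'[of t] by (cases "t = b") (auto simp: J'_def)
    qed (use t0b in \<open>auto simp: J'_def\<close>)
    have "(t0 + b) / 2 \<in> J \<inter> {t0<..b}" using inJ' t0b by simp
    then have "is_interval J'"
      using J(1) unfolding un is_interval_connected_1
      by (intro connected_Un) auto
    moreover have "continuous_on J' \<gamma>'"
    proof -
      show ?thesis
        unfolding un
      proof (rule continuous_on_Un_local_open)
        have e1: "(J \<union> {t0<..b}) \<inter> {..<b} = J" using lt un by (auto simp: J'_def)
        show "openin (top_of_set (J \<union> {t0<..b})) J"
          using openin_open_Int[OF open_lessThan[of b], of "J \<union> {t0<..b}"] unfolding e1 .
        have e2: "(J \<union> {t0<..b}) \<inter> {t0<..} = {t0<..b}" using bJ by auto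
        show "openin (top_of_set (J \<union> {t0<..b})) {t0<..b}"
          using openin_open_Int[OF open_greaterThan[of t0], of "J \<union> {t0<..b}"] unfolding e2 .
        show "continuous_on J \<gamma>'" using J(3) eq by (simp cong: continuous_on_cong)
        show "continuous_on {t0<..b} \<gamma>'"
        proof -
          have "dist (\<gamma>' s) (\<gamma>' t) \<le> dist s t" if "s \<in> {t0<..b}" "t \<in> {t0<..b}" for s t
          proof -
            show ?thesis using that dx lip
              by (cases "s = b"; cases "t = b") (auto simp: \<gamma>'_def dist_real_def dist_commute[of x])
          qed
          then show ?thesis unfolding continuous_on_iff by (meson order_le_less_trans)
        qed
      qed
    qed
    moreover have "local_isometry_on (interior J') \<gamma>'"
      unfolding int using J(6) eqi local_isometry_on_cong[of "interior J" \<gamma>' \<gamma>] by simp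
    moreover have "\<gamma>' ` J' \<subseteq> X" using eq J(4) x by (auto simp: J'_def \<gamma>'_def)
    moreover have "\<gamma>' ` interior J' \<subseteq> X - P" unfolding int using eqi J(5) by auto
    ultimately have "geodesic_curve X P J' \<gamma>'" using int J(2) by (simp add: geodesic_curve_def)
    then have "J' = J" using eq by (intro max[of J' \<gamma>']) (auto simp: J'_def)
    then show False using False by (auto simp: J'_def)
  next
    case True
    then have "\<gamma> b \<in> X - P" using no J(4) by auto
    then obtain \<rho> where n: "normal (\<gamma> b) \<rho>" using normal_exists by blast
    then have \<rho>: "\<rho> > 0" by (simp add: normal_def)
    obtain d where d: "d > 0" "\<And>t. t \<in> J \<Longrightarrow> dist t b < d \<Longrightarrow> dist (\<gamma> t) (\<gamma> b) < \<rho> / 2"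
      using J(3) True \<rho> unfolding continuous_on_iff by (metis half_gt_zero)
    \<comment> \<open>At \<open>b\<close> itself nothing is known about the direction, since the
      local isometry holds on the interior. So the chart is placed at an interior point close enough
      to \<open>b\<close> for its disc to reach beyond \<open>b\<close>.\<close>
    define t1 where "t1 = max t0 (b - min d (\<rho> / 2) / 2)"
    have t1: "t1 \<in> {t0..<b}" "b - t1 < d" "b < t1 + \<rho> / 2" using t0b d(1) \<rho> by (auto simp: t1_def)
    have t1J: "t1 \<in> interior J" using t1 inJ by blast
    have "dist (\<gamma> t1) (\<gamma> b) < \<rho> / 2"
      using t1 t1J interior_subset[of J] by (intro d(2)) (auto simp: dist_real_def)
    then have n1: "normal (\<gamma> t1) (\<rho> / 2)"
      using liso_in[OF l t1J] \<rho> by (intro normal_moved[OF n]) (auto simp: dist_commute)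
    define c where "c = t1 + \<rho> / 2"
    obtain e :: "complex \<Rightarrow> 'a" and s where e: "isom_on (ball (of_real t1) (\<rho> / 2)) e"
      "e ` ball (of_real t1) (\<rho> / 2) = X \<inter> ball (\<gamma> t1) (\<rho> / 2)"
      "s > 0" "s \<le> \<rho> / 2" "ball t1 s \<subseteq> interior J" "\<And>u. u \<in> ball t1 s \<Longrightarrow> \<gamma> u = e (of_real u)"
      by (rule curve_germ[OF l open_interior t1J n1]) (rule that)
    define m where "m t = e (complex_of_real t)" for t :: real
    have m: "liso (ball t1 (\<rho> / 2)) m"
      unfolding m_def
    proof (rule liso_compose[where g = complex_of_real])
      show "liso (ball (of_real t1) (\<rho> / 2)) e"
        using isom_on_imp_local_isometry_on[OF e(1)] e(2) n1 unfolding liso_def normal_def by blast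
    qed (auto simp: isom_on_def dist_norm simp flip: of_real_diff)
    have eq1: "\<gamma> t = m t" if "t \<in> interior J" "t \<in> ball t1 (\<rho> / 2)" for t
    proof (rule curve_unique[of "interior J \<inter> ball t1 (\<rho> / 2)" \<gamma> m s t1 t])
      show "connected (interior J \<inter> ball t1 (\<rho> / 2))"
        using cvJ by (intro convex_connected convex_Int) auto
      show "liso (interior J \<inter> ball t1 (\<rho> / 2)) \<gamma>" "liso (interior J \<inter> ball t1 (\<rho> / 2)) m"
        using l m liso_subset by blast+
      show "ball t1 s \<subseteq> interior J \<inter> ball t1 (\<rho> / 2)" using e(4,5) by auto
      show "\<gamma> u = m u" if "u \<in> ball t1 s" for u using e(6)[OF that] by (simp add: m_def)
    qed (use e(3) that in auto)
    \<comment> \<open>As \<open>b\<close> is not an interior point, unique continuation stops short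
      of it, and continuity supplies the value.\<close>
    have eqb: "\<gamma> b = m b"
    proof (rule tendsto_unique[OF _ _ _, of "at b within {t1<..<b}"])
      show "at b within {t1<..<b} \<noteq> bot"
        using t1(1) by (simp add: at_within_eq_bot_iff closure_greaterThanLessThan)
      have sub: "{t1<..<b} \<subseteq> J" using t1(1) inJ' by auto
      show "(\<gamma> \<longlongrightarrow> \<gamma> b) (at b within {t1<..<b})"
        using J(3) True sub unfolding continuous_on_def by (meson tendsto_within_subset)
      have "continuous_on (ball t1 (\<rho> / 2)) m"
        using m local_isometry_on_continuous unfolding liso_def by blast
      moreover have "b \<in> ball t1 (\<rho> / 2)" "{t1<..<b} \<subseteq> ball t1 (\<rho> / 2)"
        using t1 by (auto simp: dist_real_def)
      ultimately have "(m \<longlongrightarrow> m b) (at b within {t1<..<b})"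
        unfolding continuous_on_def by (meson tendsto_within_subset)
      then show "(\<gamma> \<longlongrightarrow> m b) (at b within {t1<..<b})"
      proof (rule Lim_transform_eventually)
        show "\<forall>\<^sub>F t in at b within {t1<..<b}. m t = \<gamma> t"
          unfolding eventually_at_filter
          using eq1 t1 inJ \<open>{t1<..<b} \<subseteq> ball t1 (\<rho> / 2)\<close>
          by (intro always_eventually) (auto simp: subset_iff)
      qed
    qed
    define \<gamma>' where "\<gamma>' t = (if t \<in> J then \<gamma> t else m t)" for t
    define J' where "J' = J \<union> {t1<..<c}"
    have eq: "\<gamma>' t = \<gamma> t" if "t \<in> J" for t using that by (simp add: \<gamma>'_def)
    have eqm: "\<gamma>' t = m t" if "t \<in> {t1<..<c}" for t
    proof -
      have "t \<in> ball t1 (\<rho> / 2)" using that by (auto simp: c_def dist_real_def)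
      moreover have "t < b \<Longrightarrow> t \<in> interior J" using that inJ t1(1) by auto
      ultimately show ?thesis using eq1 eqb bJ[of t] by (cases t b rule: linorder_cases) (auto simp: \<gamma>'_def)
    qed
    have cb: "b < c" using t1 by (simp add: c_def)
    have mem: "t \<in> J" if "t \<in> J'" "t \<le> b" for t
      using that True inJ'[of t] t1(1) by (cases "t = b") (auto simp: J'_def)
    have int: "interior J' = interior J \<union> {t1<..<c}"
    proof
      show "interior J' \<subseteq> interior J \<union> {t1<..<c}"
      proof
        fix t assume t: "t \<in> interior J'"
        then have "t \<in> J'" using interior_subset by blast
        show "t \<in> interior J \<union> {t1<..<c}"
        proof (cases "t > t1")
          case True
          then show ?thesis using \<open>t \<in> J'\<close> bJ[of t] cb by (auto simp: J'_def)
        next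
          case False
          have "interior J' \<inter> {..<b} \<subseteq> interior J"
            using mem interior_subset[of J'] by (intro interior_maximal) auto
          then show ?thesis using t False t1(1) by auto
        qed
      qed
      show "interior J \<union> {t1<..<c} \<subseteq> interior J'"
        by (intro Un_least interior_mono interior_maximal) (auto simp: J'_def)
    qed
    have "b \<in> J \<inter> {t1<..<c}" using True t1(1) cb by simp
    then have "is_interval J'"
      using J(1) unfolding J'_def is_interval_connected_1
      by (intro connected_Un) auto
    moreover have "continuous_on J' \<gamma>'"
    proof -
      have un: "J' = J' \<inter> {..<b} \<union> {t1<..<c}" using bJ t1(1) cb by (fastforce simp: J'_def)
      have "continuous_on (J' \<inter> {..<b} \<union> {t1<..<c}) \<gamma>'"
      proof (rule continuous_on_Un_local_open)
        show "openin (top_of_set (J' \<inter> {..<b} \<union> {t1<..<c})) (J' \<inter> {..<b})"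
          unfolding un[symmetric] by (simp add: openin_open_Int)
        show "openin (top_of_set (J' \<inter> {..<b} \<union> {t1<..<c})) {t1<..<c}"
          by (rule open_subset) auto
        have "continuous_on J \<gamma>'" using J(3) eq by (simp cong: continuous_on_cong)
        then show "continuous_on (J' \<inter> {..<b}) \<gamma>'"
          by (rule continuous_on_subset) (use mem in auto)
        have "continuous_on {t1<..<c} m"
          using m local_isometry_on_continuous unfolding liso_def
          by (rule_tac continuous_on_subset[of "ball t1 (\<rho> / 2)"]) (auto simp: c_def dist_real_def)
        then show "continuous_on {t1<..<c} \<gamma>'" by (rule continuous_on_eq) (rule eqm[symmetric])
      qed
      then show ?thesis using un by simp
    qed
    moreover have L: "liso (interior J') \<gamma>'"
    proof (rule liso_openI[OF open_interior])
      fix t assume t: "t \<in> interior J'"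
      have 1: "liso (interior J) \<gamma>'"
        using l liso_cong[of "interior J" \<gamma>' \<gamma>] eq interior_subset[of J] by blast
      have "liso {t1<..<c} m" by (rule liso_subset[OF m]) (auto simp: c_def dist_real_def)
      then have 2: "liso {t1<..<c} \<gamma>'" using liso_cong[of "{t1<..<c}" \<gamma>' m] eqm by blast
      have "\<gamma>' t \<in> X - P \<and> (\<exists>s>0. isom_on (ball t s) \<gamma>')"
        using t liso_in[OF 1] liso_in[OF 2] liso_ball[OF 1 open_interior] liso_ball[OF 2 open_greaterThanLessThan]
        unfolding int by (metis Un_iff)
      then show "\<gamma>' t \<in> X - P" "\<exists>s>0. isom_on (ball t s) \<gamma>'" by blast+
    qed
    moreover have "\<gamma>' ` J' \<subseteq> X"
    proof -
      have "m t \<in> X" if "t \<in> {t1<..<c}" for t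
        using liso_in[OF m, of t] that by (auto simp: c_def dist_real_def)
      then show ?thesis using eq eqm J(4) by (auto simp: J'_def image_subset_iff)
    qed
    ultimately have "geodesic_curve X P J' \<gamma>'"
      using int J(2) by (auto simp: geodesic_curve_def liso_def)
    then have "J' = J" using eq by (intro max[of J' \<gamma>']) (auto simp: J'_def)
    moreover have "(b + c) / 2 \<in> J'" using t1 cb by (auto simp: J'_def)
    ultimately show False using bJ cb by force
  qed
qed

lemma geodesic_complete:
  assumes g: "geodesic X P J \<gamma>" and no: "\<gamma> ` J \<inter> P = {}"
  shows "J = UNIV" "liso UNIV \<gamma>"
proof -
  have gc: "geodesic_curve X P J \<gamma>" using g by (simp add: geodesic_def)
  have above: "\<not> bdd_above J" using geodesic_bdd_above_hits[OF g] no by blast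
  have "(\<lambda>t. \<gamma> (- t)) ` (uminus ` J) = \<gamma> ` J" by (simp add: image_image)
  then have "\<not> bdd_above (uminus ` J)" using geodesic_bdd_above_hits[OF geodesic_reflect[OF g]] no by metis
  then have below: "\<not> bdd_below J" by (simp add: bdd_above_uminus)
  have "t \<in> J" for t
  proof -
    obtain u where "u \<in> J" "t \<le> u" using above by (meson bdd_above.unfold linorder_le_cases)
    moreover obtain s where "s \<in> J" "s \<le> t" using below by (meson bdd_below.unfold linorder_le_cases)
    ultimately show ?thesis using gc unfolding geodesic_curve_def is_interval_1 by blast
  qed
  then show J: "J = UNIV" by blast
  show "liso UNIV \<gamma>" using gc by (auto simp: J geodesic_curve_def liso_def)
qed

section \<open>Flat strips around geodesics\<close>

lemma strip_grow:
  assumes \<epsilon>: "\<epsilon> > 0" and f: "liso (strip a b0) f" "a < 0" "0 < b0"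
    and far: "\<And>t p. p \<in> P \<Longrightarrow> \<epsilon> \<le> dist p (f (of_real t))"
  obtains g where "liso (strip a \<epsilon>) g" "\<And>t. g (of_real t) = f (of_real t)"
proof -
  obtain b g where b: "b0 \<le> b" "liso (strip a b) g" "\<And>z. z \<in> strip a b0 \<Longrightarrow> g z = f z"
    and max: "maximal_above a b g"
    by (rule strip_maximal[OF f(1)]) (use f in auto)
  have real: "g (of_real t) = f (of_real t)" for t using f by (intro b(3)) (auto simp: strip_def)
  have "\<epsilon> \<le> b"
  proof (rule ccontr)
    assume "\<not> \<epsilon> \<le> b"
    \<comment> \<open>If the strip ended at a height \<open>b\<close> below
      \<open>\<epsilon>\<close>, its points above the axis would be within \<open>b\<close> of an
      axis that is \<open>\<epsilon>\<close> away from \<open>P\<close>; this leaves a positive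
      distance and hence room to prolong.\<close>
    have far': "\<epsilon> - b \<le> dist p (g z)" if z: "0 < Im z" "Im z < b" and p: "p \<in> P" for z p
    proof -
      have "dist (g (of_real (Re z))) (g z) \<le> dist (of_real (Re z)) z"
        using f z b(1) by (intro liso_lipschitz[OF b(2) convex_strip]) (auto simp: strip_def)
      also have "\<dots> = Im z" using z by (simp add: dist_norm cmod_def)
      finally show ?thesis
        using far[OF p, of "Re z"] real[of "Re z"] dist_triangle[of p "g (of_real (Re z))" "g z"] z
        by (simp add: dist_commute)
    qed
    obtain b' g' where "b' > b" "liso (strip a b') g'" "\<And>z. z \<in> strip a b \<Longrightarrow> g' z = g z"
      by (rule strip_extend[OF b(2), of 0 "\<epsilon> - b"]) (use f b(1) \<open>\<not> \<epsilon> \<le> b\<close> far' in auto)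
    then show False using max unfolding maximal_above_def by blast
  qed
  then have "strip a \<epsilon> \<subseteq> strip a b" by (auto simp: strip_def)
  then show thesis using that real liso_subset[OF b(2)] by blast
qed

text \<open>Rectangles around longer and longer pieces of the geodesic give a thin strip along all
  of it. Its upper side is then widened to \<open>\<epsilon>\<close>, and after conjugation its
  other side too.\<close>

lemma geodesic_strip:
  fixes \<gamma> :: "real \<Rightarrow> 'a"
  assumes \<epsilon>: "\<epsilon> > 0" and \<gamma>: "liso UNIV \<gamma>" and far: "\<And>t p. p \<in> P \<Longrightarrow> \<epsilon> \<le> dist p (\<gamma> t)"
  obtains h where "liso (band \<epsilon>) h" "\<And>t. h (of_real t) = \<gamma> t"
proof -
  have "\<epsilon> / 2 > 0" using \<epsilon> by simp
  from uniform_normal[OF this] obtain \<rho> where \<rho>: "\<rho> > 0"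
    "\<And>x. x \<in> X \<Longrightarrow> (\<And>p. p \<in> P \<Longrightarrow> \<epsilon> / 2 \<le> dist p x) \<Longrightarrow> normal x \<rho>" by blast
  \<comment> \<open>Points within \<open>\<epsilon> / 2\<close> of the axis are still
    \<open>\<epsilon> / 2\<close> away from \<open>P\<close> and have normal radius
    \<open>\<rho>\<close>; \<open>\<rho> / 2\<close> puts the first rectangle into the initial
    disc.\<close>
  define \<delta> where "\<delta> = min (\<rho> / 2) (\<epsilon> / 2)"
  have \<delta>: "\<delta> > 0" "2 * \<delta> \<le> \<rho>" "2 * \<delta> \<le> \<epsilon>" using \<rho>(1) \<epsilon> by (auto simp: \<delta>_def)
  define S where "S n = {z. \<bar>Re z\<bar> < \<delta> * real (Suc n)} \<inter> strip (-\<delta>) \<delta>" for n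
  have Re_eq: "{z. \<bar>Re z\<bar> < \<delta> * real (Suc n)} = {z. Re z < \<delta> * real (Suc n)} \<inter> {z. Re z > - (\<delta> * real (Suc n))}" for n
    by auto
  have opS: "open (S n)" and cvS: "convex (S n)" for n
    unfolding S_def Re_eq
    by (intro open_Int open_strip open_halfspace_Re_gt open_halfspace_Re_lt,
        intro convex_Int convex_strip convex_halfspace_Re_gt convex_halfspace_Re_lt)
  have b0: "ball 0 \<delta> \<subseteq> S n" for n
  proof
    fix z :: complex assume "z \<in> ball 0 \<delta>"
    then have "\<bar>Re z\<bar> < \<delta>" "\<bar>Im z\<bar> < \<delta>" using abs_Re_le_cmod[of z] abs_Im_le_cmod[of z] by auto
    moreover have "\<delta> * 1 \<le> \<delta> * real (Suc n)" using \<delta>(1) by (intro mult_left_mono) auto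
    ultimately have "\<bar>Re z\<bar> < \<delta> * real (Suc n)" "- \<delta> < Im z" "Im z < \<delta>" by linarith+
    then show "z \<in> S n" unfolding S_def strip_def by blast
  qed
  have rS: "complex_of_real t \<in> S n \<longleftrightarrow> t \<in> ball 0 (\<delta> * real (Suc n))" for t n
    using \<delta>(1) by (auto simp: S_def strip_def dist_real_def)
  have of_real_isom: "isom_on A complex_of_real" for A
    by (auto simp: isom_on_def dist_norm simp flip: of_real_diff)
  have "normal (\<gamma> 0) \<rho>"
    using \<rho>(2) liso_in[OF \<gamma>, of 0] far[of _ 0] \<epsilon> by (smt (verit) DiffD1 UNIV_I field_sum_of_halves)
  then obtain e :: "complex \<Rightarrow> 'a" and s where e: "isom_on (ball (of_real 0) \<rho>) e"
      "e ` ball (of_real 0) \<rho> = X \<inter> ball (\<gamma> 0) \<rho>"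
      "s > 0" "s \<le> \<rho>" "ball (0::real) s \<subseteq> UNIV" "\<And>u. u \<in> ball 0 s \<Longrightarrow> \<gamma> u = e (of_real u)"
    by (rule curve_germ[OF \<gamma> open_UNIV UNIV_I]) (rule that)
  have le: "liso (ball 0 \<rho>) e"
    using isom_on_imp_local_isometry_on[OF e(1)] e(2) \<open>normal (\<gamma> 0) \<rho>\<close> unfolding liso_def normal_def by auto
  have on_line: "f (of_real t) = \<gamma> t"
    if f: "liso (S n) f" and ag: "d > 0" "d \<le> \<delta>" "\<And>t. t \<in> ball 0 d \<Longrightarrow> f (of_real t) = \<gamma> t" and t: "of_real t \<in> S n"
    for n f d t
  proof (rule curve_unique[of "ball 0 (\<delta> * real (Suc n))" "\<lambda>t. f (of_real t)" \<gamma> d 0 t])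
    show "liso (ball 0 (\<delta> * real (Suc n))) (\<lambda>t. f (of_real t))"
      by (rule liso_compose[OF f of_real_isom]) (use rS in blast)
    show "ball 0 d \<subseteq> ball 0 (\<delta> * real (Suc n))"
    proof (rule subset_ball)
      have "\<delta> * 1 \<le> \<delta> * real (Suc n)" using \<delta>(1) by (intro mult_left_mono) auto
      then show "d \<le> \<delta> * real (Suc n)" using ag(2) by simp
    qed
    show "liso (ball 0 (\<delta> * real (Suc n))) \<gamma>" using liso_subset[OF \<gamma> subset_UNIV] .
  qed (use ag t rS in auto)
  \<comment> \<open>The last conjunct fixes the side on which the rectangle is attached. The
    geodesic alone determines it only up to a mirror image, and the common germ \<open>e\<close>
    makes the rectangles fit together.\<close>
  have "\<exists>h. liso (S n) h \<and> (\<forall>t. of_real t \<in> S n \<longrightarrow> h (of_real t) = \<gamma> t) \<and> (\<forall>u\<in>ball 0 \<delta>. h u = e u)" for n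
  proof (induction n)
    case 0
    have "S 0 \<subseteq> ball 0 \<rho>"
    proof
      fix z assume "z \<in> S 0"
      then have "\<bar>Re z\<bar> < \<delta>" "\<bar>Im z\<bar> < \<delta>" by (auto simp: S_def strip_def)
      then show "z \<in> ball 0 \<rho>" using cmod_le[of z] \<delta>(2) by simp
    qed
    then have l0: "liso (S 0) e" using le liso_subset by blast
    moreover have "e (of_real t) = \<gamma> t" if "of_real t \<in> S 0" for t
      by (rule on_line[OF l0 _ _ _ that, of "min s \<delta>"]) (use e(3,6) \<delta>(1) in auto)
    ultimately show ?case by blast
  next
    case (Suc n)
    then obtain h where h: "liso (S n) h" "\<And>t. of_real t \<in> S n \<Longrightarrow> h (of_real t) = \<gamma> t"
      "\<And>u. u \<in> ball 0 \<delta> \<Longrightarrow> h u = e u" by blast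
    have "normal (h z) \<rho>" if z: "z \<in> S n" for z
    proof (rule \<rho>(2))
      show "h z \<in> X" using liso_in[OF h(1) z] by simp
      fix p assume p: "p \<in> P"
      have rz: "of_real (Re z) \<in> S n" using z \<delta>(1) by (auto simp: S_def strip_def)
      have "dist (h (of_real (Re z))) (h z) \<le> dist (of_real (Re z)) z"
        by (rule liso_lipschitz[OF h(1) cvS rz z])
      also have "\<dots> = \<bar>Im z\<bar>" by (simp add: dist_norm cmod_def)
      also have "\<dots> < \<delta>" using z by (auto simp: S_def strip_def)
      finally show "\<epsilon> / 2 \<le> dist p (h z)"
        using far[OF p, of "Re z"] h(2)[OF rz] dist_triangle[of p "h (of_real (Re z))" "h z"] \<delta>(3)
        by (simp add: dist_commute)
    qed
    then obtain g where g: "liso (\<Union>z\<in>S n. ball z \<rho>) g" "\<And>z. z \<in> S n \<Longrightarrow> g z = h z"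
      using liso_extend[OF opS cvS h(1)] by blast
    have "S (Suc n) \<subseteq> (\<Union>z\<in>S n. ball z \<rho>)"
    proof
      fix z assume z: "z \<in> S (Suc n)"
      define k where "k = real (Suc n)"
      have k: "k > 0" by (simp add: k_def)
      \<comment> \<open>Contracting the real part by \<open>k / (k + 1)\<close> maps the longer
        rectangle into the shorter one and moves each point by less than
        \<open>\<delta>\<close>.\<close>
      define z' where "z' = Complex (Re z * (k / (k + 1))) (Im z)"
      have Rez: "\<bar>Re z\<bar> < \<delta> * (k + 1)" using z by (simp add: S_def k_def add.commute)
      then have Rez': "\<bar>Re z\<bar> / (k + 1) < \<delta>" using k by (simp add: pos_divide_less_eq)
      have "\<bar>Re z'\<bar> = (\<bar>Re z\<bar> / (k + 1)) * k" using k by (simp add: z'_def abs_mult)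
      also have "\<dots> < \<delta> * k" using Rez' k by (rule mult_strict_right_mono)
      finally have "z' \<in> S n" using z by (simp add: S_def k_def z'_def strip_def)
      moreover have "dist z' z < \<rho>"
      proof -
        have "Re z' - Re z = - (Re z / (k + 1))" using k by (simp add: z'_def field_simps)
        then have "dist z' z = \<bar>Re z\<bar> / (k + 1)"
          using k by (simp add: dist_norm cmod_def z'_def)
        then show ?thesis using Rez' \<delta> by simp
      qed
      ultimately show "z \<in> (\<Union>z\<in>S n. ball z \<rho>)" by auto
    qed
    then have lg: "liso (S (Suc n)) g" using g(1) liso_subset by blast
    have ge: "g u = e u" if "u \<in> ball 0 \<delta>" for u
      using g(2) h(3)[OF that] b0 that by (metis subsetD)
    have "g (of_real t) = \<gamma> t" if "of_real t \<in> S (Suc n)" for t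
      by (rule on_line[OF lg _ _ _ that, of "min s \<delta>"]) (use ge e(3,6) \<delta>(1) in auto)
    then show ?case using lg ge by blast
  qed
  then obtain h where h: "\<And>n. liso (S n) (h n)" "\<And>n t. of_real t \<in> S n \<Longrightarrow> h n (of_real t) = \<gamma> t"
    "\<And>n u. u \<in> ball 0 \<delta> \<Longrightarrow> h n u = e u" by metis
  obtain g where g: "liso (\<Union>n\<in>UNIV. S n) g" "\<And>n z. n \<in> UNIV \<Longrightarrow> z \<in> S n \<Longrightarrow> g z = h n z"
    by (rule liso_union[of UNIV S h \<delta> 0 e]) (use opS cvS h \<delta>(1) b0 in auto)
  have cover: "\<exists>n. z \<in> S n" if z: "z \<in> strip (-\<delta>) \<delta>" for z
  proof -
    obtain n where "\<bar>Re z\<bar> / \<delta> < real n" using reals_Archimedean2 by blast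
    then have "\<bar>Re z\<bar> < \<delta> * real (Suc n)" using \<delta>(1) by (simp add: pos_divide_less_eq algebra_simps)
    then show ?thesis using z by (auto simp: S_def)
  qed
  have "(\<Union>n\<in>UNIV. S n) = strip (-\<delta>) \<delta>" using cover by (auto simp: S_def)
  with g have lg: "liso (strip (-\<delta>) \<delta>) g" by simp
  have g\<gamma>: "g (of_real t) = \<gamma> t" for t
  proof -
    have "of_real t \<in> strip (-\<delta>) \<delta>" using \<delta>(1) by (simp add: strip_def)
    then obtain n where "of_real t \<in> S n" using cover by blast
    then show ?thesis using g(2)[of n] h(2) by simp
  qed
  obtain g1 where g1: "liso (strip (-\<delta>) \<epsilon>) g1" "\<And>t. g1 (of_real t) = g (of_real t)"
    by (rule strip_grow[OF \<epsilon> lg]) (use \<delta>(1) far g\<gamma> in auto)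
  have "liso (strip (-\<epsilon>) \<delta>) (\<lambda>z. g1 (cnj z))"
    by (rule liso_compose[OF g1(1) isom_on_cnj]) (auto simp: strip_def)
  then obtain g2 where g2: "liso (band \<epsilon>) g2" "\<And>t. g2 (of_real t) = g1 (cnj (of_real t))"
    by (rule strip_grow[OF \<epsilon>]) (use \<epsilon> \<delta>(1) far g\<gamma> g1(2) in auto)
  show thesis using that[OF g2(1)] g2(2) g1(2) g\<gamma> by simp
qed

end


section \<open>Cylinders\<close>

lemma isom_on_pair: "isom_on S (\<lambda>z. (Re z, Im z))"
  by (simp add: isom_on_def dist_Pair_Pair dist_real_def dist_norm[where 'a = complex] cmod_def)

lemma isom_on_Complex: "isom_on S (\<lambda>(t, s). Complex t (s + m))"
  by (auto simp: isom_on_def dist_Pair_Pair dist_real_def dist_norm[where 'a = complex] cmod_def)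

lemma tendsto_at_left_of_bound:
  fixes k :: "real \<Rightarrow> 'a::metric_space"
  assumes "c < \<delta>" "\<And>s. c < s \<Longrightarrow> s < \<delta> \<Longrightarrow> dist (k s) x \<le> \<delta> - s"
  shows "(k \<longlongrightarrow> x) (at_left \<delta>)"
proof (rule tendstoI)
  fix e :: real assume "e > 0"
  then have "max c (\<delta> - e) < \<delta>" using assms(1) by simp
  moreover have "dist (k s) x < e" if "max c (\<delta> - e) < s" "s < \<delta>" for s
    using assms(2)[of s] that by auto
  ultimately show "\<forall>\<^sub>F s in at_left \<delta>. dist (k s) x < e"
    unfolding eventually_at_left_field by blast
qed

context flat_surface
begin

text \<open>The conical point sits on the upper edge above \<open>t\<close>, expressed by the rate
  at which the vertical segment approaches it. In this form it needs no boundary curve and is easily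
  translated.\<close>

definition singular_top :: "real \<Rightarrow> real \<Rightarrow> (complex \<Rightarrow> 'a) \<Rightarrow> bool" where
  "singular_top a b f \<longleftrightarrow> (\<exists>t. \<exists>p\<in>P. \<forall>s. a < s \<longrightarrow> s < b \<longrightarrow> dist (f (Complex t s)) p \<le> b - s)"

text \<open>Vertical limits define the boundary curve. If it avoided \<open>P\<close>, compactness
  over one period would keep it uniformly away from \<open>P\<close>, and the strip could be
  prolonged.\<close>

lemma strip_boundary:
  assumes f: "liso (strip a b) f" and ab: "a < b" and T: "T > 0"
    and per: "\<And>z. z \<in> strip a b \<Longrightarrow> f (z + of_real T) = f z"
    and max: "maximal_above a b f"
  obtains \<eta> where "\<And>t s. a < s \<Longrightarrow> s < b \<Longrightarrow> dist (f (Complex t s)) (\<eta> t) \<le> b - s" "range \<eta> \<inter> P \<noteq> {}"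
proof -
  have lip: "dist (f y) (f z) \<le> dist y z" if "y \<in> strip a b" "z \<in> strip a b" for y z
    using liso_lipschitz[OF f convex_strip that] .
  have "\<exists>x\<in>X. \<forall>s. a < s \<longrightarrow> s < b \<longrightarrow> dist (f (Complex t s)) x \<le> b - s" for t
  proof -
    have "f (Complex t s) \<in> X" if "a < s" "s < b" for s
      using liso_in[OF f, of "Complex t s"] that by (simp add: strip_def)
    moreover have "dist (f (Complex t s)) (f (Complex t s')) \<le> \<bar>s - s'\<bar>"
      if "a < s" "s < b" "a < s'" "s' < b" for s s'
      using lip[of "Complex t s" "Complex t s'"] that by (simp add: strip_def dist_norm cmod_def)
    ultimately show ?thesis by (rule limit_at_end[OF ab, of "\<lambda>s. f (Complex t s)"]) auto
  qed
  then obtain \<eta> where \<eta>: "\<And>t. \<eta> t \<in> X"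
    "\<And>t s. a < s \<Longrightarrow> s < b \<Longrightarrow> dist (f (Complex t s)) (\<eta> t) \<le> b - s" by metis
  have \<eta>lip: "dist (\<eta> t) (\<eta> t') \<le> dist t t'" for t t'
  proof (rule field_le_epsilon)
    fix e :: real assume e: "e > 0"
    define s where "s = max ((a + b) / 2) (b - e / 2)"
    have s: "a < s" "s < b" using ab e by (auto simp: s_def less_max_iff_disj)
    have "b - e / 2 \<le> s" unfolding s_def by (rule max.cobounded2)
    then have se: "b - s \<le> e / 2" by simp
    have "dist (f (Complex t s)) (f (Complex t' s)) \<le> dist (Complex t s) (Complex t' s)"
      by (rule lip) (use s in \<open>auto simp: strip_def\<close>)
    also have "\<dots> = dist t t'" by (simp add: dist_norm cmod_def)
    finally show "dist (\<eta> t) (\<eta> t') \<le> dist t t' + e"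
      using \<eta>(2)[OF s(1,2), of t] \<eta>(2)[OF s(1,2), of t'] se
        dist_triangle[of "\<eta> t" "\<eta> t'" "f (Complex t s)"]
        dist_triangle[of "f (Complex t s)" "\<eta> t'" "f (Complex t' s)"]
      by (simp add: dist_commute)
  qed
  have "range \<eta> \<inter> P \<noteq> {}"
  proof
    assume no: "range \<eta> \<inter> P = {}"
    have "continuous_on {0..T} \<eta>"
      unfolding continuous_on_iff by (meson \<eta>lip order_le_less_trans)
    then have "compact (\<eta> ` {0..T})" by (intro compact_continuous_image) auto
    moreover have "\<eta> ` {0..T} \<subseteq> X - P" using \<eta>(1) no by blast
    ultimately obtain \<kappa> where \<kappa>: "\<kappa> > 0" "\<And>x p. x \<in> \<eta> ` {0..T} \<Longrightarrow> p \<in> P \<Longrightarrow> \<kappa> \<le> dist p x"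
      using compact_far_from_P by blast
    \<comment> \<open>Above \<open>c\<close> the points are within \<open>\<kappa> / 2\<close> of
      the boundary curve and keep the other half of \<open>\<kappa>\<close> as distance from
      \<open>P\<close>.\<close>
    define c where "c = max a (b - \<kappa> / 2)"
    have c: "a \<le> c" "c < b" using ab \<kappa> by (auto simp: c_def)
    have far: "\<kappa> / 2 \<le> dist p (f z)" if z: "c < Im z" "Im z < b" and p: "p \<in> P" for z p
    proof -
      obtain y where y: "y \<in> {0..T}"
        "\<And>u. u \<in> strip a b \<Longrightarrow> f (u + of_real (Re z)) = f (u + of_real y)"
        by (rule strip_period_reduce[OF T, of a b f "Re z"]) (use per in blast)+
      have "Complex 0 (Im z) \<in> strip a b" using z c by (simp add: strip_def)
      moreover have "Complex 0 (Im z) + of_real (Re z) = z" "Complex 0 (Im z) + of_real y = Complex y (Im z)"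
        by (simp_all add: complex_eq_iff)
      ultimately have "f z = f (Complex y (Im z))" using y(2) by metis
      then have "dist (f z) (\<eta> y) \<le> b - Im z" using \<eta>(2)[of "Im z" y] z c by simp
      moreover have "b - Im z \<le> \<kappa> / 2" using z by (simp add: c_def)
      moreover have "\<kappa> \<le> dist p (\<eta> y)" using \<kappa>(2) y(1) p by blast
      ultimately show ?thesis using dist_triangle[of p "\<eta> y" "f z"] by simp
    qed
    obtain b' g' where "b' > b" "liso (strip a b') g'" "\<And>z. z \<in> strip a b \<Longrightarrow> g' z = f z"
      by (rule strip_extend[OF f c, of "\<kappa> / 2"]) (use \<kappa>(1) far in auto)
    then show False using max unfolding maximal_above_def by blast
  qed
  then show thesis using that \<eta>(2) by blast
qed

text \<open>Periods are bounded below because \<open>f\<close> is injective on a small disc, and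
  their infimum is a period by continuity. The definition of a cylinder requires this least
  one.\<close>

lemma least_period:
  assumes f: "liso (strip a b) f" and ab: "a < b" and T: "T > 0"
    and per: "\<And>z. z \<in> strip a b \<Longrightarrow> f (z + of_real T) = f z"
  obtains l where "l > 0" "\<And>z. z \<in> strip a b \<Longrightarrow> f (z + of_real l) = f z"
    "\<And>l'. 0 < l' \<Longrightarrow> l' < l \<Longrightarrow> \<exists>z\<in>strip a b. f (z + of_real l') \<noteq> f z"
proof -
  define Q where "Q = {T. T > 0 \<and> (\<forall>z\<in>strip a b. f (z + of_real T) = f z)}"
  have TQ: "T \<in> Q" using T per by (simp add: Q_def)
  define v where "v = Complex 0 ((a + b) / 2)"
  have v: "v \<in> strip a b" using ab by (simp add: v_def strip_def)
  obtain r where r: "r > 0" "isom_on (ball v r) f" using liso_ball[OF f open_strip v] by blast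
  have lower: "r \<le> t" if t: "t \<in> Q" for t
  proof (rule ccontr)
    assume "\<not> r \<le> t"
    then have "v + of_real t \<in> ball v r" "v \<in> ball v r" using t r(1) by (auto simp: Q_def dist_norm)
    then have "dist (f (v + of_real t)) (f v) = t" using isom_onD[OF r(2)] t by (simp add: Q_def dist_norm)
    then show False using t v by (auto simp: Q_def)
  qed
  have bdd: "bdd_below Q" using lower by (rule bdd_belowI)
  define l where "l = Inf Q"
  have "r \<le> l" unfolding l_def using TQ lower by (intro cInf_greatest) auto
  then have l: "l > 0" using r(1) by simp
  have "f (z + of_real l) = f z" if z: "z \<in> strip a b" for z
  proof -
    have "\<exists>t\<in>Q. t < l + inverse (real (Suc n))" for n
      using cInf_lessD[of Q "l + inverse (real (Suc n))"] TQ by (auto simp: l_def)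
    then obtain t where t: "\<And>n. t n \<in> Q" "\<And>n. t n < l + inverse (real (Suc n))" by metis
    have "t \<longlonglongrightarrow> l"
    proof (rule tendsto_sandwich[of "\<lambda>_. l"])
      show "(\<lambda>n. l + inverse (real (Suc n))) \<longlonglongrightarrow> l"
        using tendsto_add[OF tendsto_const LIMSEQ_inverse_real_of_nat, of l] by simp
      show "\<forall>\<^sub>F n in sequentially. l \<le> t n" using t(1) bdd by (simp add: l_def cInf_lower)
      show "\<forall>\<^sub>F n in sequentially. t n \<le> l + inverse (real (Suc n))"
        using t(2) by (intro always_eventually allI less_imp_le)
    qed simp
    then have "(\<lambda>n. z + complex_of_real (t n)) \<longlonglongrightarrow> z + of_real l" by (intro tendsto_intros)
    moreover have "isCont f (z + of_real l)"
      using f z local_isometry_on_continuous[of "strip a b" f] unfolding liso_def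
      by (simp add: continuous_on_eq_continuous_at strip_translate)
    ultimately have "(\<lambda>n. f (z + of_real (t n))) \<longlonglongrightarrow> f (z + of_real l)"
      by (rule isCont_tendsto_compose[rotated])
    moreover have "f (z + of_real (t n)) = f z" for n using t(1)[of n] z by (simp add: Q_def)
    ultimately have "(\<lambda>n. f z) \<longlonglongrightarrow> f (z + of_real l)" by simp
    then show ?thesis by (simp add: LIMSEQ_const_iff)
  qed
  moreover have "\<exists>z\<in>strip a b. f (z + of_real l') \<noteq> f z" if "0 < l'" "l' < l" for l'
  proof (rule ccontr)
    assume "\<not> ?thesis"
    then have "l' \<in> Q" using that by (simp add: Q_def)
    then show False using cInf_lower[OF _ bdd, of l'] that by (simp add: l_def)
  qed
  ultimately show thesis using that l by blast
qed

text \<open>The band is prolonged as far as possible upwards, then, after conjugation, as far as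
  possible on the other side. Each edge meets \<open>P\<close> by \<open>strip_boundary\<close>,
  since the period persists under prolongation.\<close>

lemma maximal_cylinder_of_strip:
  assumes \<epsilon>: "\<epsilon> > 0" and h: "liso (band \<epsilon>) h" and T: "T > 0"
    and per: "\<And>z. z \<in> band \<epsilon> \<Longrightarrow> h (z + of_real T) = h z"
  obtains c where "maximal_cylinder X P c" "belongs_to UNIV (\<lambda>t. h (of_real t)) c"
proof -
  obtain b g1 where b: "\<epsilon> \<le> b" "liso (strip (-\<epsilon>) b) g1" "\<And>z. z \<in> band \<epsilon> \<Longrightarrow> g1 z = h z"
    and max1: "maximal_above (-\<epsilon>) b g1"
    by (rule strip_maximal[OF h]) (use \<epsilon> in auto)
  have g1c: "liso (strip (-b) \<epsilon>) (\<lambda>z. g1 (cnj z))"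
    by (rule liso_compose[OF b(2) isom_on_cnj]) (auto simp: strip_def)
  obtain a' g2 where a': "\<epsilon> \<le> a'" "liso (strip (-b) a') g2" "\<And>z. z \<in> strip (-b) \<epsilon> \<Longrightarrow> g2 z = g1 (cnj z)"
    and max2: "maximal_above (-b) a' g2"
    by (rule strip_maximal[OF g1c]) (use \<epsilon> b(1) in auto)
  define a where "a = - a'"
  define g where "g z = g2 (cnj z)" for z
  have ab: "a \<le> -\<epsilon>" "\<epsilon> \<le> b" "a < b" using a' b \<epsilon> by (auto simp: a_def)
  have g: "liso (strip a b) g"
    unfolding g_def by (rule liso_compose[OF a'(2) isom_on_cnj]) (auto simp: strip_def a_def)
  have g_g1: "g z = g1 z" if "z \<in> strip (-\<epsilon>) b" for z
    using a'(3)[of "cnj z"] that by (simp add: g_def strip_def)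
  have gh: "g z = h z" if "z \<in> band \<epsilon>" for z
    using g_g1[of z] b(3)[OF that] that ab by (simp add: strip_def)
  have sub: "band \<epsilon> \<subseteq> strip a b" "strip (-\<epsilon>) b \<subseteq> strip a b" using ab by (auto simp: strip_def)
  note gper = strip_period_extend[OF g \<epsilon> sub(1) gh per]
  \<comment> \<open>Prolonging downwards does not spoil maximality above: a higher strip, cut off at
    \<open>-\<epsilon>\<close>, would prolong \<open>g1\<close>.\<close>
  have maxg: "maximal_above a b g"
    unfolding maximal_above_def
  proof (intro allI impI)
    fix b' g' assume b': "b < b'" "liso (strip a b') g'"
    have "liso (strip (-\<epsilon>) b') g'" by (rule liso_subset[OF b'(2)]) (use ab in \<open>auto simp: strip_def\<close>)
    then obtain z where "z \<in> strip (-\<epsilon>) b" "g' z \<noteq> g1 z"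
      using max1 b'(1) unfolding maximal_above_def by blast
    then show "\<exists>z\<in>strip a b. g' z \<noteq> g z" using g_g1 sub(2) by (intro bexI[of _ z]) auto
  qed
  have per2: "g2 (z + of_real T) = g2 z" if "z \<in> strip (-b) a'" for z
    using gper[of "cnj z"] that by (simp add: g_def strip_def a_def)
  obtain \<eta>1 where \<eta>1: "\<And>t s. a < s \<Longrightarrow> s < b \<Longrightarrow> dist (g (Complex t s)) (\<eta>1 t) \<le> b - s" "range \<eta>1 \<inter> P \<noteq> {}"
    by (rule strip_boundary[OF g ab(3) T gper maxg]) blast+
  have "- b < a'" using ab by (simp add: a_def)
  obtain \<eta>2 where \<eta>2: "\<And>t s. -b < s \<Longrightarrow> s < a' \<Longrightarrow> dist (g2 (Complex t s)) (\<eta>2 t) \<le> a' - s" "range \<eta>2 \<inter> P \<noteq> {}"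
    by (rule strip_boundary[OF a'(2) \<open>- b < a'\<close> T per2 max2]) blast+
  obtain l where l: "l > 0" "\<And>z. z \<in> strip a b \<Longrightarrow> g (z + of_real l) = g z"
    "\<And>l'. 0 < l' \<Longrightarrow> l' < l \<Longrightarrow> \<exists>z\<in>strip a b. g (z + of_real l') \<noteq> g z"
    by (rule least_period[OF g ab(3) T gper]) blast+
  \<comment> \<open>The definition of a maximal cylinder requires an interval symmetric about 0, so
    heights are measured from the middle line.\<close>
  define m where "m = (a + b) / 2"
  define \<delta> where "\<delta> = (b - a) / 2"
  define k where "k = (\<lambda>(t, s). g (Complex t (s + m)))"
  define I where "I = {-\<delta><..<\<delta>}"
  have \<delta>: "\<delta> > 0" "m + \<delta> = b" "m - \<delta> = a" using ab by (auto simp: \<delta>_def m_def field_simps)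
  have inS: "Complex t (s + m) \<in> strip a b \<longleftrightarrow> s \<in> I" for t s
    using \<delta> by (auto simp: strip_def I_def)
  have kl: "liso (UNIV \<times> I) k"
  proof -
    have "liso (UNIV \<times> I) (\<lambda>x. g (case x of (t, s) \<Rightarrow> Complex t (s + m)))"
      by (rule liso_compose[OF g isom_on_Complex]) (use inS in auto)
    then show ?thesis by (simp add: k_def case_prod_unfold)
  qed
  have "cylinder X P (l, I, k)"
    unfolding cylinder_def case_prod_conv
  proof (intro conjI allI impI ballI)
    show "0 < l" by (rule l(1))
    show "is_interval I" by (simp add: I_def)
    show "interior I \<noteq> {}" using \<delta>(1) by (simp add: I_def interior_open)
    show "k ` (UNIV \<times> I) \<subseteq> X - P" "local_isometry_on (UNIV \<times> I) k" using kl by (auto simp: liso_def)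
    show "k (t + l, s) = k (t, s)" if "s \<in> I" for t s
    proof -
      have "Complex t (s + m) + of_real l = Complex (t + l) (s + m)" by (simp add: complex_eq_iff)
      then show ?thesis using l(2)[of "Complex t (s + m)"] that inS by (simp add: k_def)
    qed
    fix l' assume "0 < l' \<and> l' < l"
    then obtain z where z: "z \<in> strip a b" "g (z + of_real l') \<noteq> g z" using l(3) by blast
    have zl: "z + of_real l' = Complex (Re z + l') (Im z)" by (simp add: complex_eq_iff)
    have "Im z - m \<in> I" using z(1) inS[of "Re z" "Im z - m"] by simp
    moreover have "k (Re z + l', Im z - m) \<noteq> k (Re z, Im z - m)"
      using z(2) by (simp add: k_def zl)
    ultimately show "\<exists>t. \<exists>s\<in>I. k (t + l', s) \<noteq> k (t, s)" by blast
  qed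
  moreover have "((\<lambda>s. k (t, s)) \<longlongrightarrow> \<eta>1 t) (at_left \<delta>)" for t
  proof (rule tendsto_at_left_of_bound[of "-\<delta>"])
    show "dist (k (t, s)) (\<eta>1 t) \<le> \<delta> - s" if "-\<delta> < s" "s < \<delta>" for s
      using \<eta>1(1)[of "s + m" t] that \<delta> by (simp add: k_def)
  qed (use \<delta>(1) in simp)
  moreover have "((\<lambda>s. k (t, s)) \<longlongrightarrow> \<eta>2 t) (at_right (-\<delta>))" for t
  proof -
    have "((\<lambda>s. k (t, - s)) \<longlongrightarrow> \<eta>2 t) (at_left \<delta>)"
    proof (rule tendsto_at_left_of_bound[of "-\<delta>"])
      show "dist (k (t, - s)) (\<eta>2 t) \<le> \<delta> - s" if "-\<delta> < s" "s < \<delta>" for s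
        using \<eta>2(1)[of "s - m" t] that \<delta> by (simp add: k_def g_def a_def complex_cnj)
    qed (use \<delta>(1) in simp)
    then show ?thesis by (simp add: at_left_minus filterlim_filtermap)
  qed
  ultimately have "maximal_cylinder X P (l, I, k)"
    unfolding maximal_cylinder_def case_prod_conv
    using \<delta>(1) \<eta>1(2) \<eta>2(2) I_def by (intro conjI exI[of _ \<delta>]) blast+
  moreover have "belongs_to UNIV (\<lambda>t. h (of_real t)) (l, I, k)"
  proof -
    have "- m \<in> I" using \<delta> ab \<epsilon> by (auto simp: I_def)
    moreover have "h (of_real t) = k (t, - m)" for t
      using gh[of "of_real t"] \<epsilon> by (simp add: k_def strip_def complex_of_real_def)
    ultimately show ?thesis by (auto simp: belongs_to_def)
  qed
  ultimately show thesis using that by blast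
qed

section \<open>Geodesics that keep a distance from the singular set\<close>

lemma geodesic_avoiding_far:
  assumes "geodesic_avoiding X P \<epsilon> J \<gamma>" "\<epsilon> > 0"
  shows "J = UNIV" "liso UNIV \<gamma>" "\<And>t p. p \<in> P \<Longrightarrow> \<epsilon> \<le> dist p (\<gamma> t)"
proof -
  have g: "geodesic X P J \<gamma>" and no: "\<gamma> ` J \<inter> singular_nbhd X P \<epsilon> = {}"
    using assms(1) by (auto simp: geodesic_avoiding_def)
  have "P \<subseteq> singular_nbhd X P \<epsilon>" using P_subset assms(2) by (force simp: singular_nbhd_def)
  then have no': "\<gamma> ` J \<inter> P = {}" using no by blast
  show J: "J = UNIV" and l: "liso UNIV \<gamma>" using geodesic_complete[OF g no'] .
  fix t p assume p: "p \<in> P"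
  have "\<gamma> t \<in> X" "\<gamma> t \<notin> singular_nbhd X P \<epsilon>" using no liso_in[OF l, of t] J by auto
  then show "\<epsilon> \<le> dist p (\<gamma> t)" using p by (force simp: singular_nbhd_def)
qed

lemma geodesic_avoiding_periodic:
  assumes \<epsilon>: "\<epsilon> > 0" and g: "geodesic_avoiding X P \<epsilon> J \<gamma>"
  shows "periodic_geodesic J \<gamma>" "\<exists>c. maximal_cylinder X P c \<and> belongs_to J \<gamma> c"
proof -
  note far = geodesic_avoiding_far[OF g \<epsilon>]
  obtain h where h: "liso (band \<epsilon>) h" "\<And>t. h (of_real t) = \<gamma> t"
    by (rule geodesic_strip[OF \<epsilon> far(2,3)]) blast+
  obtain T where T: "T > 0" "\<And>z. z \<in> band \<epsilon> \<Longrightarrow> h (z + of_real T) = h z"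
    by (rule strip_periodic[OF \<epsilon> h(1)]) blast
  have "\<gamma> (t + T) = \<gamma> t" for t
    using T(2)[of "of_real t"] \<epsilon> by (simp add: strip_def flip: h(2))
  then show "periodic_geodesic J \<gamma>" using T(1) far(1) by (auto simp: periodic_geodesic_def)
  obtain c where "maximal_cylinder X P c" "belongs_to UNIV (\<lambda>t. h (of_real t)) c"
    by (rule maximal_cylinder_of_strip[OF \<epsilon> h(1) T]) blast+
  then have "maximal_cylinder X P c \<and> belongs_to J \<gamma> c" by (simp add: h(2) far(1))
  then show "\<exists>c. maximal_cylinder X P c \<and> belongs_to J \<gamma> c" by blast
qed

text \<open>A closure disjoint from \<open>P\<close> is compact and therefore keeps some distance
  \<open>\<kappa>\<close> from \<open>P\<close>, so the quantitative statement applies with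
  \<open>\<kappa>\<close> for \<open>\<epsilon>\<close>.\<close>

lemma geodesic_closure:
  assumes g: "geodesic X P J \<gamma>" and no: "closure (\<gamma> ` J) \<inter> P = {}"
  shows "periodic_geodesic J \<gamma>"
proof -
  have sub: "\<gamma> ` J \<subseteq> X" using g by (auto simp: geodesic_def geodesic_curve_def)
  have "closure (\<gamma> ` J) \<subseteq> X"
    using sub compact_X by (intro closure_minimal compact_imp_closed)
  then have "compact (closure (\<gamma> ` J))" "closure (\<gamma> ` J) \<subseteq> X - P"
    using compact_Int_closed[OF compact_X closed_closure, of "\<gamma> ` J"] no by (auto simp: Int_absorb1)
  then obtain \<kappa> where \<kappa>: "\<kappa> > 0" "\<And>x p. x \<in> closure (\<gamma> ` J) \<Longrightarrow> p \<in> P \<Longrightarrow> \<kappa> \<le> dist p x"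
    using compact_far_from_P by blast
  have "geodesic_avoiding X P \<kappa> J \<gamma>"
    using g \<kappa>(2) closure_subset[of "\<gamma> ` J"] by (fastforce simp: geodesic_avoiding_def singular_nbhd_def)
  then show ?thesis using geodesic_avoiding_periodic(1)[OF \<kappa>(1)] by blast
qed

section \<open>Rigidity of maximal strips\<close>

lemma singular_top_le:
  assumes f: "liso (strip a b) f" and f': "liso (strip a' b') f'"
    and s: "s > 0" "ball v s \<subseteq> strip a b" "ball v s \<subseteq> strip a' b'" "\<And>u. u \<in> ball v s \<Longrightarrow> f u = f' u"
    and top: "singular_top a b f"
  shows "b' \<le> b"
proof (rule ccontr)
  assume "\<not> b' \<le> b"
  obtain t p where p: "p \<in> P" "\<And>s. a < s \<Longrightarrow> s < b \<Longrightarrow> dist (f (Complex t s)) p \<le> b - s"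
    using top unfolding singular_top_def by blast
  have "v \<in> strip a b" "v \<in> strip a' b'" using s by auto
  then have v: "a < b" "a' < b" by (auto simp: strip_def)
  have eq: "f z = f' z" if "z \<in> strip a b" "z \<in> strip a' b'" for z
  proof -
    obtain h where h: "\<And>z. z \<in> strip a b \<Longrightarrow> h z = f z" "\<And>z. z \<in> strip a' b' \<Longrightarrow> h z = f' z"
      by (rule liso_glue_convex[OF open_strip convex_strip f open_strip convex_strip f' s]) blast+
    then show ?thesis using that by metis
  qed
  have xS: "Complex t b \<in> strip a' b'" using v \<open>\<not> b' \<le> b\<close> by (simp add: strip_def)
  \<comment> \<open>Were \<open>f'\<close> defined at height \<open>b\<close>, it would take there,
    by continuity, the limit \<open>p\<close> of \<open>f\<close> along the vertical segment; but
    \<open>f'\<close> avoids \<open>P\<close>.\<close>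
  have "dist (f' (Complex t b)) p \<le> 0 + e" if e: "e > 0" for e
  proof -
    define s where "s = max ((max a a' + b) / 2) (b - e / 2)"
    have "(max a a' + b) / 2 < b" "max a a' < (max a a' + b) / 2" using v by auto
    then have s: "max a a' < s" "s < b" using e by (auto simp: s_def less_max_iff_disj)
    have "b - e / 2 \<le> s" unfolding s_def by (rule max.cobounded2)
    then have se: "b - s \<le> e / 2" by simp
    have sS: "Complex t s \<in> strip a b" "Complex t s \<in> strip a' b'"
      using s \<open>\<not> b' \<le> b\<close> by (auto simp: strip_def)
    have "dist (f' (Complex t b)) (f' (Complex t s)) \<le> dist (Complex t b) (Complex t s)"
      by (rule liso_lipschitz[OF f' convex_strip xS sS(2)])
    also have "\<dots> = b - s" using s by (simp add: dist_norm cmod_def)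
    finally show ?thesis
      using eq[OF sS] p(2)[of s] s se dist_triangle[of "f' (Complex t b)" p "f' (Complex t s)"] by simp
  qed
  then have "dist (f' (Complex t b)) p \<le> 0" by (rule field_le_epsilon)
  then show False using liso_in[OF f' xS] p(1) by simp
qed

text \<open>A conical point on either edge blocks prolongation in both directions, so the edges are
  determined by any germ of \<open>f\<close>. The lower edge is the upper edge of the conjugate
  strip.\<close>

definition singular_strip :: "real \<Rightarrow> real \<Rightarrow> (complex \<Rightarrow> 'a) \<Rightarrow> bool" where
  "singular_strip a b f \<longleftrightarrow> liso (strip a b) f \<and> singular_top a b f \<and> singular_top (-b) (-a) (\<lambda>z. f (cnj z))"

lemma singular_strip_unique:
  assumes f: "singular_strip a b f" and f': "singular_strip a' b' f'"
    and s: "s > 0" "ball v s \<subseteq> strip a b" "ball v s \<subseteq> strip a' b'" "\<And>u. u \<in> ball v s \<Longrightarrow> f u = f' u"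
  shows "a = a'" "b = b'"
proof -
  note F = f[unfolded singular_strip_def] and F' = f'[unfolded singular_strip_def]
  have le: "liso (strip (-b) (-a)) (\<lambda>z. f (cnj z))" "liso (strip (-b') (-a')) (\<lambda>z. f' (cnj z))"
    by (rule liso_compose[OF _ isom_on_cnj], use F F' in blast, force simp: strip_def)+
  have cb: "cnj u \<in> ball v s" if "u \<in> ball (cnj v) s" for u
    using that by (simp add: dist_norm) (metis complex_cnj_cnj complex_cnj_diff complex_mod_cnj)
  have c: "ball (cnj v) s \<subseteq> strip (-b) (-a)" "ball (cnj v) s \<subseteq> strip (-b') (-a')"
  proof -
    have "u \<in> strip (-b) (-a)" "u \<in> strip (-b') (-a')" if "u \<in> ball (cnj v) s" for u
      using subsetD[OF s(2) cb[OF that]] subsetD[OF s(3) cb[OF that]] by (auto simp: strip_def)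
    then show "ball (cnj v) s \<subseteq> strip (-b) (-a)" "ball (cnj v) s \<subseteq> strip (-b') (-a')" by blast+
  qed
  have ce: "f (cnj u) = f' (cnj u)" if "u \<in> ball (cnj v) s" for u using s(4)[OF cb[OF that]] .
  have "b' \<le> b" "b \<le> b'"
    using singular_top_le[of a b f a' b' f', OF _ _ s] singular_top_le[of a' b' f' a b f, OF _ _ s(1,3,2) s(4)[symmetric]]
      F F' by blast+
  then show "b = b'" by simp
  have "- a' \<le> - a"
    by (rule singular_top_le[OF le s(1) c ce]) (use F in auto)
  moreover have "- a \<le> - a'"
    by (rule singular_top_le[OF le(2,1) s(1) c(2,1) ce[symmetric]]) (use F' in auto)
  ultimately show "a = a'" by simp
qed

lemma singular_strip_translate:
  assumes f: "singular_strip a b f"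
  shows "singular_strip (a - Im w) (b - Im w) (\<lambda>z. f (z + w))"
proof -
  note F = f[unfolded singular_strip_def]
  have "liso (strip (a - Im w) (b - Im w)) (\<lambda>z. f (z + w))"
    by (rule liso_compose[OF _ isom_on_translate(1)], use F in blast) (auto simp: strip_def)
  moreover have tr: "singular_top (c - Im w) (d - Im w) (\<lambda>z. k (z + w))" if "singular_top c d k" for c d k w
  proof -
    obtain t p where p: "p \<in> P" "\<And>s. c < s \<Longrightarrow> s < d \<Longrightarrow> dist (k (Complex t s)) p \<le> d - s"
      using \<open>singular_top c d k\<close> unfolding singular_top_def by blast
    have "dist (k (Complex (t - Re w) s + w)) p \<le> d - Im w - s" if "c - Im w < s" "s < d - Im w" for s
    proof -
      have "Complex (t - Re w) s + w = Complex t (s + Im w)" by (simp add: complex_eq_iff)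
      then show ?thesis using p(2)[of "s + Im w"] that by simp
    qed
    then show ?thesis using p(1) unfolding singular_top_def by blast
  qed
  moreover have "singular_top (- (b - Im w)) (- (a - Im w)) (\<lambda>z. f (cnj z + w))"
    using tr[of "-b" "-a" "\<lambda>z. f (cnj z)" "cnj w"] F by (simp add: add.commute)
  ultimately show ?thesis using F unfolding singular_strip_def by blast
qed

text \<open>The vertical Lipschitz bound turns the limits at the two ends of \<open>I\<close> into
  the rates required by \<open>singular_top\<close>.\<close>

lemma maximal_cylinder_singular_strip:
  assumes c: "maximal_cylinder X P (l, I, h)"
  obtains \<delta> where "\<delta> > 0" "I = {-\<delta><..<\<delta>}" "singular_strip (-\<delta>) \<delta> (\<lambda>z. h (Re z, Im z))"
proof -
  obtain \<delta> \<eta>1 \<eta>2 where \<delta>: "\<delta> > 0" "I = {-\<delta><..<\<delta>}"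
    and \<eta>1: "\<And>t. ((\<lambda>s. h (t, s)) \<longlongrightarrow> \<eta>1 t) (at_left \<delta>)" "range \<eta>1 \<inter> P \<noteq> {}"
    and \<eta>2: "\<And>t. ((\<lambda>s. h (t, s)) \<longlongrightarrow> \<eta>2 t) (at_right (-\<delta>))" "range \<eta>2 \<inter> P \<noteq> {}"
    and cyl: "cylinder X P (l, I, h)"
    using c unfolding maximal_cylinder_def case_prod_conv by blast
  have "liso (UNIV \<times> I) h" using cyl by (auto simp: cylinder_def liso_def)
  then have f: "liso (strip (-\<delta>) \<delta>) (\<lambda>z. h (Re z, Im z))"
    by (rule liso_compose[OF _ isom_on_pair]) (auto simp: strip_def \<delta>(2))
  have vert: "dist (h (t, s)) (h (t, s')) \<le> \<bar>s - s'\<bar>" if "s \<in> I" "s' \<in> I" for t s s'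
    using liso_lipschitz[OF f convex_strip, of "Complex t s" "Complex t s'"] that
    by (simp add: strip_def \<delta>(2) dist_norm cmod_def)
  have top: "dist (k s) x \<le> \<delta> - s"
    if k: "(k \<longlongrightarrow> x) (at_left \<delta>)" "\<And>s s'. s \<in> I \<Longrightarrow> s' \<in> I \<Longrightarrow> dist (k s) (k s') \<le> \<bar>s - s'\<bar>"
      and s: "-\<delta> < s" "s < \<delta>" for k :: "real \<Rightarrow> 'a" and x s
  proof (rule tendsto_upperbound)
    show "((\<lambda>s'. dist (k s) (k s')) \<longlongrightarrow> dist (k s) x) (at_left \<delta>)"
      using k(1) by (intro tendsto_intros)
    have "dist (k s) (k s') \<le> \<delta> - s" if "s < s'" "s' < \<delta>" for s'
      using k(2)[of s s'] s that by (simp add: \<delta>(2))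
    then show "\<forall>\<^sub>F s' in at_left \<delta>. dist (k s) (k s') \<le> \<delta> - s"
      unfolding eventually_at_left_field using s(2) by blast
  qed simp
  obtain t1 where "\<eta>1 t1 \<in> P" using \<eta>1(2) by blast
  moreover have "dist (h (t1, s)) (\<eta>1 t1) \<le> \<delta> - s" if "-\<delta> < s" "s < \<delta>" for s
    by (rule top[OF \<eta>1(1) vert that])
  ultimately have "singular_top (-\<delta>) \<delta> (\<lambda>z. h (Re z, Im z))"
    unfolding singular_top_def by (intro exI[of _ t1] bexI[of _ "\<eta>1 t1"]) auto
  moreover obtain t2 where "\<eta>2 t2 \<in> P" using \<eta>2(2) by blast
  moreover have "dist (h (t2, - s)) (\<eta>2 t2) \<le> \<delta> - s" if s: "-\<delta> < s" "s < \<delta>" for s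
  proof (rule top[OF _ _ s])
    show "((\<lambda>s. h (t2, - s)) \<longlongrightarrow> \<eta>2 t2) (at_left \<delta>)"
      using \<eta>2(1)[of t2] by (simp add: at_right_minus[of "-\<delta>"] filterlim_filtermap)
    show "dist (h (t2, - s)) (h (t2, - s')) \<le> \<bar>s - s'\<bar>" if "s \<in> I" "s' \<in> I" for s s'
      using vert[of "-s" "-s'" t2] that by (auto simp: \<delta>(2))
  qed
  ultimately have "singular_top (-\<delta>) \<delta> (\<lambda>z. h (Re (cnj z), Im (cnj z)))"
    unfolding singular_top_def by (intro exI[of _ t2] bexI[of _ "\<eta>2 t2"]) auto
  then show thesis using that[OF \<delta>] f \<open>singular_top (-\<delta>) \<delta> (\<lambda>z. h (Re z, Im z))\<close>
    unfolding singular_strip_def by simp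
qed

text \<open>A common germ forces equal edges, then equal maps by unique continuation, then equal
  circumferences, as each is the least period. The reparametrization is a rotation of the
  circle.\<close>

lemma same_cylinder_of_germ:
  assumes c1: "maximal_cylinder X P (l1, I1, h1)" and c2: "maximal_cylinder X P (l2, I2, h2)"
    and s: "s > 0" "\<And>u. u \<in> ball 0 s \<Longrightarrow> Im (u + v1) \<in> I1 \<and> Im (u + v2) \<in> I2 \<and>
      h1 (Re (u + v1), Im (u + v1)) = h2 (Re (u + v2), Im (u + v2))"
  shows "((l1, I1, h1), (l2, I2, h2)) \<in> same_cylinder"
proof -
  obtain \<delta>1 where \<delta>1: "\<delta>1 > 0" "I1 = {-\<delta>1<..<\<delta>1}" "singular_strip (-\<delta>1) \<delta>1 (\<lambda>z. h1 (Re z, Im z))"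
    by (rule maximal_cylinder_singular_strip[OF c1])
  obtain \<delta>2 where \<delta>2: "\<delta>2 > 0" "I2 = {-\<delta>2<..<\<delta>2}" "singular_strip (-\<delta>2) \<delta>2 (\<lambda>z. h2 (Re z, Im z))"
    by (rule maximal_cylinder_singular_strip[OF c2])
  define f1 where "f1 z = h1 (Re z, Im z)" for z
  define w where "w = v2 - v1"
  define f2 where "f2 z = h2 (Re (z + w), Im (z + w))" for z
  have f1: "singular_strip (-\<delta>1) \<delta>1 f1" using \<delta>1(3) by (simp add: f1_def[abs_def])
  have f2: "singular_strip (-\<delta>2 - Im w) (\<delta>2 - Im w) f2"
    using singular_strip_translate[OF \<delta>2(3), of w] by (simp add: f2_def[abs_def])
  have b: "u - v1 \<in> ball 0 s" if "u \<in> ball v1 s" for u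
    using that by (simp add: dist_norm norm_minus_commute)
  have sub: "ball v1 s \<subseteq> strip (-\<delta>1) \<delta>1" "ball v1 s \<subseteq> strip (-\<delta>2 - Im w) (\<delta>2 - Im w)"
    using s(2)[OF b] \<delta>1(2) \<delta>2(2) by (force simp: strip_def w_def)+
  have eq: "f1 u = f2 u" if "u \<in> ball v1 s" for u
    using s(2)[OF b[OF that]] by (simp add: f1_def f2_def w_def algebra_simps)
  have ends: "-\<delta>1 = -\<delta>2 - Im w" "\<delta>1 = \<delta>2 - Im w"
    using singular_strip_unique[OF f1 f2 s(1) sub eq] by auto
  \<comment> \<open>Both intervals are symmetric about 0, so equality of both pairs of edges leaves
    no vertical shift.\<close>
  then have w0: "Im w = 0" and \<delta>: "\<delta>1 = \<delta>2" by auto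
  have all: "f1 z = f2 z" if "z \<in> strip (-\<delta>1) \<delta>1" for z
    by (rule liso_unique[of "strip (-\<delta>1) \<delta>1" f1 f2 s v1 z])
      (use f1 f2 w0 \<delta> s(1) sub eq that in \<open>auto simp: singular_strip_def intro: convex_connected\<close>)
  have h12: "h1 (t, s) = h2 (t + Re w, s)" if "s \<in> I1" for t s
    using all[of "Complex t s"] that w0 by (simp add: f1_def f2_def strip_def \<delta>1(2))
  have II: "I1 = I2" using \<delta> \<delta>1(2) \<delta>2(2) by simp
  have C1: "0 < l1" "\<And>t s. s \<in> I1 \<Longrightarrow> h1 (t + l1, s) = h1 (t, s)"
    "\<And>l'. 0 < l' \<Longrightarrow> l' < l1 \<Longrightarrow> \<exists>t. \<exists>s\<in>I1. h1 (t + l', s) \<noteq> h1 (t, s)"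
    using c1 by (auto simp: maximal_cylinder_def cylinder_def)
  have C2: "0 < l2" "\<And>t s. s \<in> I2 \<Longrightarrow> h2 (t + l2, s) = h2 (t, s)"
    "\<And>l'. 0 < l' \<Longrightarrow> l' < l2 \<Longrightarrow> \<exists>t. \<exists>s\<in>I2. h2 (t + l', s) \<noteq> h2 (t, s)"
    using c2 by (auto simp: maximal_cylinder_def cylinder_def)
  have h21: "h2 (t, s) = h1 (t - Re w, s)" if "s \<in> I1" for t s using h12[OF that, of "t - Re w"] by simp
  have "h1 (t + l2, s) = h1 (t, s)" if "s \<in> I1" for t s
    using C2(2)[of s "t + Re w"] h12[OF that] that II by (simp add: algebra_simps)
  then have "l1 \<le> l2" using C1(3)[of l2] C2(1) by force
  moreover have "h2 (t + l1, s) = h2 (t, s)" if "s \<in> I2" for t s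
    using C1(2)[of s "t - Re w"] h21[of s] that II by (simp add: algebra_simps)
  then have "l2 \<le> l1" using C2(3)[of l1] C1(1) by force
  ultimately show ?thesis
    unfolding same_cylinder_iff using II h21
    by (intro conjI bexI[of _ 1] exI[of _ "- Re w"] exI[of _ 0]) auto
qed

text \<open>Bands around geodesics of infinitely many cylinders accumulate at a band
  \<open>G\<close>, which is periodic. Late bands are parallel to its maximal upward prolongation
  \<open>F\<close> and share a germ with it, so their cylinders coincide.\<close>

lemma finite_maximal_cylinders:
  assumes \<epsilon>: "\<epsilon> > 0"
  defines "C \<equiv> {c. maximal_cylinder X P c \<and> (\<exists>J \<gamma>. geodesic_avoiding X P \<epsilon> J \<gamma> \<and> belongs_to J \<gamma> c)}"
  shows "finite (C // same_cylinder)"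
proof (rule ccontr)
  assume "infinite (C // same_cylinder)"
  then obtain E :: "nat \<Rightarrow> 'a cyl set" where E: "inj E" "range E \<subseteq> C // same_cylinder"
    using infinite_countable_subset by blast
  have "\<exists>c. c \<in> C \<and> E n = same_cylinder `` {c}" for n
    using E(2) by (meson quotientE range_subsetD)
  then obtain c where c: "\<And>n. c n \<in> C" "\<And>n. E n = same_cylinder `` {c n}" by metis
  have diff: "(c n, c m) \<notin> same_cylinder" if "n \<noteq> m" for n m
  proof
    assume "(c n, c m) \<in> same_cylinder"
    then have "E n = E m" unfolding c(2) by (rule equiv_class_eq[OF equiv_same_cylinder])
    then show False using E(1) that by (simp add: inj_eq)
  qed
  define I where "I n = fst (snd (c n))" for n
  define h where "h n = snd (snd (c n))" for n
  have cn: "c n = (fst (c n), I n, h n)" for n by (simp add: I_def h_def)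
  have "\<exists>s0. liso (band \<epsilon>) (\<lambda>z. h n (Re z, Im z + s0)) \<and> (\<forall>s. \<bar>s - s0\<bar> < \<epsilon> \<longrightarrow> s \<in> I n)" for n
  proof -
    have mc: "maximal_cylinder X P (fst (c n), I n, h n)"
      using c(1)[of n] cn[of n] by (simp add: C_def)
    obtain J \<gamma> where \<gamma>: "geodesic_avoiding X P \<epsilon> J \<gamma>" "belongs_to J \<gamma> (fst (c n), I n, h n)"
      using c(1)[of n] cn[of n] by (auto simp: C_def)
    then obtain s0 where s0: "s0 \<in> I n" "\<And>t. \<gamma> t = h n (t, s0)" by (auto simp: belongs_to_def)
    have far: "\<epsilon> \<le> dist p (h n (t, s0))" if "p \<in> P" for p t
      using geodesic_avoiding_far(3)[OF \<gamma>(1) \<epsilon> that] s0(2) by simp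
    obtain \<delta> where \<delta>: "\<delta> > 0" "I n = {-\<delta><..<\<delta>}" "singular_strip (-\<delta>) \<delta> (\<lambda>z. h n (Re z, Im z))"
      by (rule maximal_cylinder_singular_strip[OF mc])
    note S = \<delta>(3)[unfolded singular_strip_def]
    have s0I: "-\<delta> < s0" "s0 < \<delta>" using s0(1) \<delta>(2) by auto
    obtain t p where "p \<in> P" "\<And>s. -\<delta> < s \<Longrightarrow> s < \<delta> \<Longrightarrow> dist (h n (t, s)) p \<le> \<delta> - s"
      using S unfolding singular_top_def by auto
    \<comment> \<open>The geodesic at height \<open>s0\<close> is at least \<open>\<epsilon>\<close>
      from the conical point on the edge, and at most \<open>\<delta> - s0\<close> by the vertical
      segment. So the cylinder contains a band of half-width \<open>\<epsilon>\<close> around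
      it.\<close>
    from far[OF this(1), of t] this(2)[OF s0I] have 1: "s0 + \<epsilon> \<le> \<delta>" by (simp add: dist_commute)
    obtain t p where "p \<in> P" "\<And>s. -\<delta> < s \<Longrightarrow> s < \<delta> \<Longrightarrow> dist (h n (t, - s)) p \<le> \<delta> - s"
      using S unfolding singular_top_def by auto
    from far[OF this(1), of t] this(2)[of "-s0"] s0I have 2: "- \<delta> \<le> s0 - \<epsilon>" by (simp add: dist_commute)
    have "liso (band \<epsilon>) (\<lambda>z. h n (Re (z + \<i> * of_real s0), Im (z + \<i> * of_real s0)))"
      by (rule liso_compose[OF _ isom_on_translate(1)], use S in blast)
        (use 1 2 in \<open>auto simp: strip_def\<close>)
    then show ?thesis using 1 2 by (intro exI[of _ s0]) (auto simp: \<delta>(2))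
  qed
  then obtain s0 where s0: "\<And>n. liso (band \<epsilon>) (\<lambda>z. h n (Re z, Im z + s0 n))"
    "\<And>n s. \<bar>s - s0 n\<bar> < \<epsilon> \<Longrightarrow> s \<in> I n" by metis
  define g where "g n z = h n (Re z, Im z + s0 n)" for n z
  have g: "liso (band \<epsilon>) (g n)" for n using s0(1)[of n] by (simp add: g_def[abs_def])
  obtain r G where r: "strict_mono (r :: nat \<Rightarrow> nat)" and G: "liso (band \<epsilon>) G"
    "\<And>z. z \<in> band \<epsilon> \<Longrightarrow> (\<lambda>n. g (r n) z) \<longlonglongrightarrow> G z"
    by (rule liso_limit_fixed[OF open_strip g]) (rule that)
  obtain T where T: "T > 0" "\<And>z. z \<in> band \<epsilon> \<Longrightarrow> G (z + of_real T) = G z"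
    by (rule strip_periodic[OF \<epsilon> G(1)]) blast
  obtain b F where b: "\<epsilon> \<le> b" "liso (strip (-\<epsilon>) b) F" "\<And>z. z \<in> band \<epsilon> \<Longrightarrow> F z = G z"
    and max: "maximal_above (-\<epsilon>) b F"
    by (rule strip_maximal[OF G(1)]) (use \<epsilon> in auto)
  have sub: "band \<epsilon> \<subseteq> strip (-\<epsilon>) b" using b(1) by (auto simp: strip_def)
  note per = strip_period_extend[OF b(2) \<epsilon> sub b(3) T(2)]
  have noext: "\<not> limit_extends \<epsilon> b F"
    by (rule periodic_not_limit_extends[OF \<epsilon> b(2) T(1) per max])
  have \<epsilon>2: "\<epsilon> / 2 > 0" using \<epsilon> by simp
  obtain A \<eta>' where A: "finite A" "A \<subseteq> band \<epsilon>" and \<eta>': "\<eta>' > 0"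
    "\<And>k. liso (band \<epsilon>) k \<Longrightarrow> (\<forall>u\<in>A. dist (k u) (F u) < \<eta>') \<Longrightarrow>
       (\<exists>w. norm w < \<epsilon> / 2 \<and> (\<forall>z\<in>band \<epsilon>. w + z \<in> strip (-\<epsilon>) b \<longrightarrow> k z = F (w + z)))"
    by (rule strip_parallel[OF \<epsilon> b(1,2) noext \<epsilon>2]) (rule that)
  have "\<forall>\<^sub>F n in sequentially. \<forall>u\<in>A. dist (g (r n) u) (F u) < \<eta>'"
  proof (rule eventually_ball_finite[OF A(1)], intro ballI)
    fix u assume "u \<in> A"
    then have u: "u \<in> band \<epsilon>" using A(2) by blast
    from tendstoD[OF G(2)[OF u] \<eta>'(1)]
    show "\<forall>\<^sub>F n in sequentially. dist (g (r n) u) (F u) < \<eta>'" unfolding b(3)[OF u] .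
  qed
  then obtain N where N: "\<And>n. n \<ge> N \<Longrightarrow> \<forall>u\<in>A. dist (g (r n) u) (F u) < \<eta>'"
    unfolding eventually_sequentially by blast
  have "\<exists>w. norm w < \<epsilon> / 2 \<and> (\<forall>u\<in>ball 0 (\<epsilon> / 2). g (r n) (u - w) = F u)" if n: "n \<ge> N" for n
  proof -
    obtain w where w: "norm w < \<epsilon> / 2"
      "\<forall>z\<in>band \<epsilon>. w + z \<in> strip (-\<epsilon>) b \<longrightarrow> g (r n) z = F (w + z)"
      using \<eta>'(2)[OF g N[OF n]] by blast
    have "g (r n) (u - w) = F u" if u: "u \<in> ball 0 (\<epsilon> / 2)" for u
    proof -
      have "\<bar>Im u\<bar> < \<epsilon> / 2" "\<bar>Im w\<bar> < \<epsilon> / 2" using u w(1) abs_Im_le_cmod[of u] abs_Im_le_cmod[of w] by auto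
      then have "u - w \<in> band \<epsilon>" "w + (u - w) \<in> strip (-\<epsilon>) b"
        using b(1) by (auto simp: strip_def)
      then show ?thesis using w(2) by force
    qed
    then show ?thesis using w(1) by blast
  qed
  then obtain w where w: "\<And>n. n \<ge> N \<Longrightarrow> norm (w n) < \<epsilon> / 2"
    "\<And>n u. n \<ge> N \<Longrightarrow> u \<in> ball 0 (\<epsilon> / 2) \<Longrightarrow> g (r n) (u - w n) = F u"
    by metis
  \<comment> \<open>The translation from the coordinates of \<open>F\<close> to those of the
    cylinder: back by the displacement \<open>w n\<close>, then up to the height of the avoiding
    geodesic.\<close>
  define v where "v n = \<i> * of_real (s0 (r n)) - w n" for n
  have v: "Im (u + v n) \<in> I (r n)" "h (r n) (Re (u + v n), Im (u + v n)) = F u"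
    if "n \<ge> N" "u \<in> ball 0 (\<epsilon> / 2)" for n u
  proof -
    have "\<bar>Im u\<bar> < \<epsilon> / 2" "\<bar>Im (w n)\<bar> < \<epsilon> / 2"
      using that w(1)[OF that(1)] abs_Im_le_cmod[of u] abs_Im_le_cmod[of "w n"] by auto
    then show "Im (u + v n) \<in> I (r n)" by (intro s0(2)) (simp add: v_def)
    show "h (r n) (Re (u + v n), Im (u + v n)) = F u"
      using w(2)[OF that] by (simp add: g_def v_def algebra_simps)
  qed
  have mc: "maximal_cylinder X P (fst (c n), I n, h n)" for n
    using c(1)[of n] cn[of n] by (simp add: C_def)
  have "((fst (c (r N)), I (r N), h (r N)), (fst (c (r (Suc N))), I (r (Suc N)), h (r (Suc N)))) \<in> same_cylinder"
    by (rule same_cylinder_of_germ[OF mc[of "r N"] mc[of "r (Suc N)"] \<epsilon>2, of "v N" "v (Suc N)"]) (use v in simp)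
  then have "(c (r N), c (r (Suc N))) \<in> same_cylinder" unfolding cn[symmetric] .
  moreover have "r N \<noteq> r (Suc N)" using strict_monoD[OF r, of N "Suc N"] by simp
  ultimately show False using diff by blast
qed

end

theorem proposition12:
  fixes X P :: "'a::metric_space set"
  assumes "escs X P" and "compact X" and "connected X" and "orientable X P" and "P \<noteq> {}"
  shows "(\<forall>J \<gamma>. geodesic X P J \<gamma> \<longrightarrow> periodic_geodesic J \<gamma> \<or> closure (\<gamma> ` J) \<inter> P \<noteq> {}) \<and>
    (\<forall>\<epsilon>>0.
      (\<forall>J \<gamma>. geodesic_avoiding X P \<epsilon> J \<gamma> \<longrightarrow>
         periodic_geodesic J \<gamma> \<and> (\<exists>c. maximal_cylinder X P c \<and> belongs_to J \<gamma> c)) \<and>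
      finite ({c. maximal_cylinder X P c \<and>
                  (\<exists>J \<gamma>. geodesic_avoiding X P \<epsilon> J \<gamma> \<and> belongs_to J \<gamma> c)} // same_cylinder))"
proof -
  interpret flat_surface X P
    using assms by unfold_locales (auto simp: escs_def)
  show ?thesis
    using geodesic_closure geodesic_avoiding_periodic finite_maximal_cylinders by blast
qed

end
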